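(* Let $\mathcal A$ be a Riemannian submersion Lie algebroid over $B$, with anchor $\#$, vertical bundle $\iota:\ker\#\hookrightarrow\mathcal A$, orthogonal horizontal lift $\gamma:TB\to\mathcal A$ and vertical projection $\omega:\mathcal A\to\ker\#$, and let $\nabla,\widetilde\nabla,\widehat\nabla$ be the Levi-Civita connections on $\mathcal A$, $TB$, $\ker\#$. For $D\in\Gamma\mathfrak D_{\mathfrak{so}}(\mathcal A)$ write $$(D)=\begin{pmatrix}\#\circ D\circ\gamma&\#\circ D\circ\iota\\ \omega\circ D\circ\gamma&\omega\circ D\circ\iota\end{pmatrix}$$ with respect to the orthogonal decomposition $\mathcal A\simeq\gamma(TB)\oplus_\perp\iota(\ker\#)$. Then: (1) The diagonal block $g:\mathfrak D_{\mathfrak{so}}(\mathcal A)\to\mathfrak D_{\mathfrak{so}}(TB)$, $D\mapsto\#\circ D\circ\gamma$, is (well defined and) anchor-preserving, and $\widetilde\nabla=g\circ\nabla\circ\gamma$, i.e. $\widetilde\nabla_S=g(\nabla_{\gamma(S)})$ for $S\in\Gamma(TB)$. (2) Likewise $\widehat g:\mathfrak D_{\mathfrak{so}}(\mathcal A)\to\mathfrak D_{\mathfrak{so}}(\ker\#)$, $D\mapsto\omega\circ D\circ\iota$, is anchor-preserving, and $\widehat\nabla=\widehat g\circ\nabla\circ\iota$, i.e. $\widehat\nabla_V=\widehat g(\nabla_{\iota(V)})$ for $V\in\Gamma(\ker\#)$. (3) The off-diagonal entries are $C^\infty(B)$-linear and hence define vector bundle maps $\omega\circ D\circ\gamma:TB\to\ker\#$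 and $\#\circ D\circ\iota:\ker\#\to TB$. (4) These maps are negative fibrewise adjoints: for $S\in TB$ and $V\in\ker\#$ (over the same point), $$\langle\omega\circ D\circ\gamma(S),V\rangle_{\ker\#}=-\langle S,\#\circ D\circ\iota(V)\rangle_{TB}.$$
   Context: A Lie algebroid over $B$ is a vector bundle $\mathcal A\to B$ with an anchor $\#:\mathcal A\to TB$ and a Lie bracket on $\Gamma\mathcal A$ with $[X,fY]=f[X,Y]+(\#X\cdot f)Y$ and $\#[X,Y]=[\#X,\#Y]$; transitive means $\#$ fibrewise surjective. Then $\ker\#$ is a Lie algebroid with zero anchor, with inclusion $\iota$. Riemannian submersion Lie algebroid: a transitive Lie algebroid with a smooth bundle metric $\langle\cdot,\cdot\rangle$, with the orthogonal right splitting $\gamma:TB\to\mathcal A$ ($\gamma(S)$ is the unique element with $\gamma(S)\perp\ker\#$, $\#\gamma(S)=S$) and the induced metrics $\langle S_1,S_2\rangle_{TB}=\langle\gamma(S_1),\gamma(S_2)\rangle$, $\langle V_1,V_2\rangle_{\ker\#}=\langle\iota(V_1),\iota(V_2)\rangle$. The vertical projection $\omega$ is determined by $\iota\circ\omega+\gamma\circ\#=\mathrm{Id}_{\mathcal A}$. Derivations: for a vector bundle $E$, $\mathfrak D(E)$ is the Lie algebroid whose sections are pairs $(S,D)$ (written $D$) with $S\in\Gamma(TB)$ and $D:\Gamma E\to\Gamma E$ $\mathbb R$-linear, $D(fs)=(S\cdot f)s+fD(s)$; bracket the commutator, anchor $(S,D)\mapsto S$. $\mathfrak D_{\mathfrak{so}}(E)$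 is the subalgebroid of metric derivations: $S\cdot\langle Y,Z\rangle=\langle DY,Z\rangle+\langle Y,DZ\rangle$. A vector bundle map $\varphi:\mathcal A_1\to\mathcal A_2$ of Lie algebroids over $B$ is anchor-preserving if $\#_2\circ\varphi=\#_1$. The Levi-Civita connection of a Lie algebroid with metric is the unique anchor-preserving bundle map $\nabla:\mathcal A\to\mathfrak D_{\mathfrak{so}}(\mathcal A)$ with $\nabla_XY-\nabla_YX=[X,Y]$ for all sections $X,Y$. *)

theory Defs
  imports "HOL-Analysis.Analysis"
begin

section \<open>Smooth manifolds\<close>

primrec Ck_on :: "nat \<Rightarrow> 'x::real_normed_vector set \<Rightarrow> ('x \<Rightarrow> 'y::real_normed_vector) \<Rightarrow> bool" where
  "Ck_on 0 S f \<longleftrightarrow> continuous_on S f"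
| "Ck_on (Suc k) S f \<longleftrightarrow> (\<forall>x\<in>S. f differentiable (at x)) \<and>
     (\<forall>v. Ck_on k S (\<lambda>x. frechet_derivative f (at x) v))"

text \<open>Only used for open sets \<open>S\<close> in finite-dimensional spaces.\<close>
definition smooth_on :: "'x::real_normed_vector set \<Rightarrow> ('x \<Rightarrow> 'y::real_normed_vector) \<Rightarrow> bool" where
  "smooth_on S f \<longleftrightarrow> (\<forall>k. Ck_on k S f)"

text \<open>
  The manifold is the whole type \<open>'b\<close>, modelled on the inner product space \<open>'e\<close>.  The model space
  is required to be finite-dimensional in \<open>smooth_manifold\<close>, rather than to be of class
  \<open>euclidean_space\<close>, in order not to exclude dimension zero.
\<close>
type_synonym ('b, 'e) chart = "'b set \<times> ('b \<Rightarrow> 'e)"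
type_synonym ('b, 'e) atlas = "('b, 'e) chart set"

definition smooth_manifold ::
  "('b::{t2_space,second_countable_topology}, 'e::real_inner) atlas \<Rightarrow> bool" where
  "smooth_manifold M \<longleftrightarrow>
     (\<exists>B::'e set. finite B \<and> span B = UNIV) \<and>
     (\<forall>(U, \<phi>)\<in>M. open U \<and> open (\<phi> ` U) \<and> homeomorphism U (\<phi> ` U) \<phi> (inv_into U \<phi>)) \<and>
     (\<Union>(U, \<phi>)\<in>M. U) = UNIV \<and>
     (\<forall>(U, \<phi>)\<in>M. \<forall>(V, \<psi>)\<in>M. smooth_on (\<phi> ` (U \<inter> V)) (\<psi> \<circ> inv_into U \<phi>))"

definition smooth_fun_on :: "('b, 'e::real_inner) atlas \<Rightarrow> 'b set \<Rightarrow> ('b \<Rightarrow> real) \<Rightarrow> bool" where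
  "smooth_fun_on M W f \<longleftrightarrow> (\<forall>(U, \<phi>)\<in>M. smooth_on (\<phi> ` (U \<inter> W)) (f \<circ> inv_into U \<phi>))"

definition Cinf :: "('b, 'e::real_inner) atlas \<Rightarrow> ('b \<Rightarrow> real) set" where
  "Cinf M = {f. smooth_fun_on M UNIV f}"


section \<open>Vector bundles\<close>

text \<open>
  The fibres of a vector bundle are linear subspaces of one ambient real vector space \<open>'v\<close>
  (for an abstract bundle one may take the direct sum of all fibres).  The local trivializations are
  given as local frames: \<open>(U, k, e)\<close> stands for the trivialization over \<open>U\<close> with values in
  \<open>U \<times> \<real>\<^sup>k\<close> under which \<open>e 0, \<dots>, e (k - 1)\<close> are the standard basis sections.
\<close>
type_synonym ('b, 'v) local_frame = "'b set \<times> nat \<times> (nat \<Rightarrow> 'b \<Rightarrow> 'v)"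

record ('b, 'v) vbundle =
  fib :: "'b \<Rightarrow> 'v set"
  frames :: "('b, 'v) local_frame set"

definition basis_family :: "nat \<Rightarrow> (nat \<Rightarrow> 'v::real_vector) \<Rightarrow> 'v set \<Rightarrow> bool" where
  "basis_family k u F \<longleftrightarrow>
     inj_on u {..<k} \<and> independent (u ` {..<k}) \<and> span (u ` {..<k}) = F"

definition smooth_section_on ::
  "('b, 'e::real_inner) atlas \<Rightarrow> ('b, 'v::real_vector, 'z) vbundle_scheme \<Rightarrow> 'b set \<Rightarrow> ('b \<Rightarrow> 'v) \<Rightarrow> bool"
where
  "smooth_section_on M E W s \<longleftrightarrow>
     (\<forall>p\<in>W. s p \<in> fib E p) \<and>
     (\<forall>(U, k, e)\<in>frames E. \<exists>c. (\<forall>i<k. smooth_fun_on M (U \<inter> W) (c i)) \<and>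
        (\<forall>p\<in>U \<inter> W. s p = (\<Sum>i<k. c i p *\<^sub>R e i p)))"

definition sections ::
  "('b, 'e::real_inner) atlas \<Rightarrow> ('b, 'v::real_vector, 'z) vbundle_scheme \<Rightarrow> ('b \<Rightarrow> 'v) set" where
  "sections M E = {s. smooth_section_on M E UNIV s}"

text \<open>The last conjunct says that the transition matrices between frames are smooth.\<close>
definition vector_bundle ::
  "('b::topological_space, 'e::real_inner) atlas \<Rightarrow> ('b, 'v::real_vector, 'z) vbundle_scheme \<Rightarrow> bool"
where
  "vector_bundle M E \<longleftrightarrow>
     (\<forall>p. subspace (fib E p)) \<and>
     (\<Union>(U, k, e)\<in>frames E. U) = UNIV \<and>
     (\<forall>(U, k, e)\<in>frames E. open U \<and> (\<forall>p\<in>U. basis_family k (\<lambda>i. e i p) (fib E p)) \<and>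
        (\<forall>i<k. smooth_section_on M E U (e i)))"

definition bundle_map ::
  "('b, 'e::real_inner) atlas \<Rightarrow> ('b, 'v::real_vector, 'y) vbundle_scheme \<Rightarrow>
   ('b, 'w::real_vector, 'z) vbundle_scheme \<Rightarrow> ('b \<Rightarrow> 'v \<Rightarrow> 'w) \<Rightarrow> bool" where
  "bundle_map M E F \<Phi> \<longleftrightarrow>
     (\<forall>p. \<forall>a\<in>fib E p. \<Phi> p a \<in> fib F p) \<and>
     (\<forall>p. \<forall>a\<in>fib E p. \<forall>b\<in>fib E p. \<Phi> p (a + b) = \<Phi> p a + \<Phi> p b) \<and>
     (\<forall>p r. \<forall>a\<in>fib E p. \<Phi> p (r *\<^sub>R a) = r *\<^sub>R \<Phi> p a) \<and>
     (\<forall>(U, k, e)\<in>frames E. \<forall>i<k. smooth_section_on M F U (\<lambda>p. \<Phi> p (e i p)))"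

definition bundle_metric ::
  "('b, 'e::real_inner) atlas \<Rightarrow> ('b, 'v::real_vector, 'z) vbundle_scheme \<Rightarrow>
   ('b \<Rightarrow> 'v \<Rightarrow> 'v \<Rightarrow> real) \<Rightarrow> bool" where
  "bundle_metric M E g \<longleftrightarrow>
     (\<forall>p. \<forall>a\<in>fib E p. \<forall>b\<in>fib E p. g p a b = g p b a) \<and>
     (\<forall>p. \<forall>a\<in>fib E p. \<forall>b\<in>fib E p. \<forall>c\<in>fib E p. g p (a + b) c = g p a c + g p b c) \<and>
     (\<forall>p r. \<forall>a\<in>fib E p. \<forall>b\<in>fib E p. g p (r *\<^sub>R a) b = r * g p a b) \<and>
     (\<forall>p. \<forall>a\<in>fib E p. a \<noteq> 0 \<longrightarrow> g p a a > 0) \<and>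
     (\<forall>(U, k, e)\<in>frames E. \<forall>i<k. \<forall>j<k. smooth_fun_on M U (\<lambda>p. g p (e i p) (e j p)))"


section \<open>The tangent bundle\<close>

text \<open>
  Tangent vectors are directional derivatives, acting on functions on \<open>'b\<close>; they are extended by
  \<open>0\<close> to functions that are not smooth.  The type below is their ambient vector space.
\<close>
typedef 'b functional = "UNIV :: (('b \<Rightarrow> real) \<Rightarrow> real) set"
  morphisms act Functional by simp

instantiation functional :: (type) real_vector
begin

definition "0 = Functional (\<lambda>f. 0)"
definition "X + Y = Functional (\<lambda>f. act X f + act Y f)"
definition "X - Y = Functional (\<lambda>f. act X f - act Y f)"
definition "- X = Functional (\<lambda>f. - act X f)"
definition "r *\<^sub>R X = Functional (\<lambda>f. r * act X f)"

instance
  by standard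
    (simp_all add: zero_functional_def plus_functional_def minus_functional_def
       uminus_functional_def scaleR_functional_def Functional_inverse Functional_inject
       act_inverse algebra_simps)

end

text \<open>The tangent vector at \<open>p\<close> with coordinate vector \<open>v\<close> in the chart \<open>(U, \<phi>)\<close>.\<close>
definition coord_vector ::
  "('b, 'e::real_inner) atlas \<Rightarrow> ('b, 'e) chart \<Rightarrow> 'e \<Rightarrow> 'b \<Rightarrow> 'b functional" where
  "coord_vector M = (\<lambda>(U, \<phi>) v p. Functional (\<lambda>f. if f \<in> Cinf M
     then frechet_derivative (f \<circ> inv_into U \<phi>) (at (\<phi> p)) v else 0))"

definition deriv_along :: "('b \<Rightarrow> 'b functional) \<Rightarrow> ('b \<Rightarrow> real) \<Rightarrow> 'b \<Rightarrow> real" where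
  "deriv_along S f = (\<lambda>p. act (S p) f)"

definition vf_bracket ::
  "('b \<Rightarrow> 'b functional) \<Rightarrow> ('b \<Rightarrow> 'b functional) \<Rightarrow> 'b \<Rightarrow> 'b functional" where
  "vf_bracket S T = (\<lambda>p. Functional (\<lambda>f.
     act (S p) (deriv_along T f) - act (T p) (deriv_along S f)))"


section \<open>Lie algebroids\<close>

text \<open>The bracket is only meaningful on smooth sections.\<close>
record ('b, 'v) algebroid = "('b, 'v) vbundle" +
  anchor :: "'b \<Rightarrow> 'v \<Rightarrow> 'b functional"
  brkt :: "('b \<Rightarrow> 'v) \<Rightarrow> ('b \<Rightarrow> 'v) \<Rightarrow> 'b \<Rightarrow> 'v"

text \<open>The tangent bundle, with the frames \<open>\<partial>/\<partial>x\<^sub>i\<close> of the charts, as a Lie algebroid.\<close>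
definition TB :: "('b, 'e::real_inner) atlas \<Rightarrow> ('b, 'b functional) algebroid" where
  "TB M = \<lparr>
     fib = (\<lambda>p. {coord_vector M c v p | c v. c \<in> M \<and> p \<in> fst c}),
     frames = {(fst c, k, \<lambda>i. coord_vector M c (u i)) | c k u. c \<in> M \<and> basis_family k u UNIV},
     anchor = (\<lambda>p S. S),
     brkt = vf_bracket\<rparr>"

definition lie_algebroid ::
  "('b::topological_space, 'e::real_inner) atlas \<Rightarrow> ('b, 'v::real_vector) algebroid \<Rightarrow> bool" where
  "lie_algebroid M A \<longleftrightarrow>
     vector_bundle M A \<and>
     bundle_map M A (TB M) (anchor A) \<and>
     (\<forall>X\<in>sections M A. \<forall>Y\<in>sections M A. brkt A X Y \<in> sections M A) \<and>
     (\<forall>X\<in>sections M A. \<forall>Y\<in>sections M A. \<forall>Z\<in>sections M A. \<forall>r t.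
        brkt A (\<lambda>p. r *\<^sub>R X p + t *\<^sub>R Y p) Z = (\<lambda>p. r *\<^sub>R brkt A X Z p + t *\<^sub>R brkt A Y Z p)) \<and>
     (\<forall>X\<in>sections M A. \<forall>Y\<in>sections M A. brkt A X Y = (\<lambda>p. - brkt A Y X p)) \<and>
     (\<forall>X\<in>sections M A. \<forall>Y\<in>sections M A. \<forall>Z\<in>sections M A. \<forall>p.
        brkt A X (brkt A Y Z) p + brkt A Y (brkt A Z X) p + brkt A Z (brkt A X Y) p = 0) \<and>
     (\<forall>X\<in>sections M A. \<forall>Y\<in>sections M A. \<forall>f\<in>Cinf M.
        brkt A X (\<lambda>p. f p *\<^sub>R Y p) =
          (\<lambda>p. f p *\<^sub>R brkt A X Y p + act (anchor A p (X p)) f *\<^sub>R Y p)) \<and>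
     (\<forall>X\<in>sections M A. \<forall>Y\<in>sections M A.
        (\<lambda>p. anchor A p (brkt A X Y p)) =
          vf_bracket (\<lambda>p. anchor A p (X p)) (\<lambda>p. anchor A p (Y p)))"

definition transitive ::
  "('b, 'e::real_inner) atlas \<Rightarrow> ('b, 'v::real_vector) algebroid \<Rightarrow> bool" where
  "transitive M A \<longleftrightarrow> (\<forall>p. anchor A p ` fib A p = fib (TB M) p)"

text \<open>
  \<open>ker #\<close> has the same ambient space as \<open>A\<close>, so that the inclusion \<open>\<iota>\<close> is the identity on vectors
  and does not appear in the formulas below.  Its trivializations are all the local frames of
  \<open>ker #\<close> that are smooth as local sections of \<open>A\<close>.
\<close>
definition ker_anchor ::
  "('b::topological_space, 'e::real_inner) atlas \<Rightarrow> ('b, 'v::real_vector) algebroid \<Rightarrow>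
   ('b, 'v) algebroid" where
  "ker_anchor M A = (let K = (\<lambda>p. {a \<in> fib A p. anchor A p a = 0}) in \<lparr>
     fib = K,
     frames = {(U, k, e). open U \<and> (\<forall>p\<in>U. basis_family k (\<lambda>i. e i p) (K p)) \<and>
        (\<forall>i<k. smooth_section_on M A U (e i))},
     anchor = (\<lambda>p a. 0),
     brkt = brkt A\<rparr>)"


section \<open>Riemannian submersion Lie algebroids\<close>

definition riemannian_submersion_algebroid ::
  "('b::topological_space, 'e::real_inner) atlas \<Rightarrow> ('b, 'v::real_vector) algebroid \<Rightarrow>
   ('b \<Rightarrow> 'v \<Rightarrow> 'v \<Rightarrow> real) \<Rightarrow> bool" where
  "riemannian_submersion_algebroid M A g \<longleftrightarrow>
     lie_algebroid M A \<and> transitive M A \<and> bundle_metric M A g"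

definition hlift ::
  "('b, 'v::real_vector) algebroid \<Rightarrow> ('b \<Rightarrow> 'v \<Rightarrow> 'v \<Rightarrow> real) \<Rightarrow> 'b \<Rightarrow> 'b functional \<Rightarrow> 'v" where
  "hlift A g p S = (THE a. a \<in> fib A p \<and>
     (\<forall>v\<in>fib A p. anchor A p v = 0 \<longrightarrow> g p a v = 0) \<and> anchor A p a = S)"

definition vproj ::
  "('b, 'v::real_vector) algebroid \<Rightarrow> ('b \<Rightarrow> 'v \<Rightarrow> 'v \<Rightarrow> real) \<Rightarrow> 'b \<Rightarrow> 'v \<Rightarrow> 'v" where
  "vproj A g p a = a - hlift A g p (anchor A p a)"

definition metric_TB ::
  "('b, 'v::real_vector) algebroid \<Rightarrow> ('b \<Rightarrow> 'v \<Rightarrow> 'v \<Rightarrow> real) \<Rightarrow>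
   'b \<Rightarrow> 'b functional \<Rightarrow> 'b functional \<Rightarrow> real" where
  "metric_TB A g p S T = g p (hlift A g p S) (hlift A g p T)"

definition metric_ker :: "('b \<Rightarrow> 'v \<Rightarrow> 'v \<Rightarrow> real) \<Rightarrow> 'b \<Rightarrow> 'v \<Rightarrow> 'v \<Rightarrow> real" where
  "metric_ker g p V W = g p V W"


section \<open>Derivations and Levi-Civita connections\<close>

text \<open>
  The bundle of (metric) derivations is given through its sections, so that a Lie algebroid enters
  here only through the \<open>C\<^sup>\<infinity>(B)\<close>-module of its sections together with the anchor on sections.
\<close>
record ('b, 's) section_module =
  secs :: "'s set"
  sadd :: "'s \<Rightarrow> 's \<Rightarrow> 's"
  smul :: "('b \<Rightarrow> real) \<Rightarrow> 's \<Rightarrow> 's"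
  sanchor :: "'s \<Rightarrow> 'b \<Rightarrow> 'b functional"

definition section_module_of ::
  "('b, 'e::real_inner) atlas \<Rightarrow> ('b, 'v::real_vector) algebroid \<Rightarrow> ('b, 'b \<Rightarrow> 'v) section_module" where
  "section_module_of M A = \<lparr>
     secs = sections M A,
     sadd = (\<lambda>X Y p. X p + Y p),
     smul = (\<lambda>f X p. f p *\<^sub>R X p),
     sanchor = (\<lambda>X p. anchor A p (X p))\<rparr>"

text \<open>Bundle maps covering the identity are the \<open>C\<^sup>\<infinity>(B)\<close>-linear maps of sections.\<close>
definition anchored_map ::
  "('b, 'e::real_inner) atlas \<Rightarrow> ('b, 's) section_module \<Rightarrow> ('b, 't) section_module \<Rightarrow>
   ('s \<Rightarrow> 't) \<Rightarrow> bool" where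
  "anchored_map M P Q \<Phi> \<longleftrightarrow>
     (\<forall>x\<in>secs P. \<Phi> x \<in> secs Q) \<and>
     (\<forall>x\<in>secs P. \<forall>y\<in>secs P. \<Phi> (sadd P x y) = sadd Q (\<Phi> x) (\<Phi> y)) \<and>
     (\<forall>x\<in>secs P. \<forall>f\<in>Cinf M. \<Phi> (smul P f x) = smul Q f (\<Phi> x)) \<and>
     (\<forall>x\<in>secs P. sanchor Q (\<Phi> x) = sanchor P x)"

text \<open>
  The vector field \<open>S\<close> is kept in \<open>(S, D)\<close> because \<open>D\<close> does not determine it when \<open>E\<close> has rank
  zero.  The operator \<open>D\<close> is \<open>undefined\<close> off the smooth sections, so that equality of pairs is
  equality of derivations.
\<close>
type_synonym ('b, 'v) derivation = "('b \<Rightarrow> 'b functional) \<times> (('b \<Rightarrow> 'v) \<Rightarrow> 'b \<Rightarrow> 'v)"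

definition derivations ::
  "('b, 'e::real_inner) atlas \<Rightarrow> ('b, 'v::real_vector) algebroid \<Rightarrow> ('b, 'v) derivation set" where
  "derivations M E = {(S, D).
     S \<in> sections M (TB M) \<and>
     D \<in> sections M E \<rightarrow>\<^sub>E sections M E \<and>
     (\<forall>X\<in>sections M E. \<forall>Y\<in>sections M E. D (\<lambda>p. X p + Y p) = (\<lambda>p. D X p + D Y p)) \<and>
     (\<forall>X\<in>sections M E. \<forall>r. D (\<lambda>p. r *\<^sub>R X p) = (\<lambda>p. r *\<^sub>R D X p)) \<and>
     (\<forall>X\<in>sections M E. \<forall>f\<in>Cinf M.
        D (\<lambda>p. f p *\<^sub>R X p) = (\<lambda>p. act (S p) f *\<^sub>R X p + f p *\<^sub>R D X p))}"

definition so_derivations ::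
  "('b, 'e::real_inner) atlas \<Rightarrow> ('b, 'v::real_vector) algebroid \<Rightarrow>
   ('b \<Rightarrow> 'v \<Rightarrow> 'v \<Rightarrow> real) \<Rightarrow> ('b, ('b, 'v) derivation) section_module" where
  "so_derivations M E g = \<lparr>
     secs = {(S, D) \<in> derivations M E. \<forall>Y\<in>sections M E. \<forall>Z\<in>sections M E. \<forall>p.
        act (S p) (\<lambda>q. g q (Y q) (Z q)) = g p (D Y p) (Z p) + g p (Y p) (D Z p)},
     sadd = (\<lambda>(S, D) (S', D'). (\<lambda>p. S p + S' p, \<lambda>Y\<in>sections M E. \<lambda>p. D Y p + D' Y p)),
     smul = (\<lambda>f (S, D). (\<lambda>p. f p *\<^sub>R S p, \<lambda>Y\<in>sections M E. \<lambda>p. f p *\<^sub>R D Y p)),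
     sanchor = fst\<rparr>"

definition levi_civita ::
  "('b, 'e::real_inner) atlas \<Rightarrow> ('b, 'v::real_vector) algebroid \<Rightarrow>
   ('b \<Rightarrow> 'v \<Rightarrow> 'v \<Rightarrow> real) \<Rightarrow> (('b \<Rightarrow> 'v) \<Rightarrow> ('b, 'v) derivation) \<Rightarrow> bool" where
  "levi_civita M A g nabla \<longleftrightarrow>
     anchored_map M (section_module_of M A) (so_derivations M A g) nabla \<and>
     (\<forall>X\<in>sections M A. \<forall>Y\<in>sections M A.
        (\<lambda>p. snd (nabla X) Y p - snd (nabla Y) X p) = brkt A X Y)"


section \<open>The blocks of a derivation\<close>

definition block_TB ::
  "('b, 'e::real_inner) atlas \<Rightarrow> ('b, 'v::real_vector) algebroid \<Rightarrow> ('b \<Rightarrow> 'v \<Rightarrow> 'v \<Rightarrow> real) \<Rightarrow>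
   ('b, 'v) derivation \<Rightarrow> ('b, 'b functional) derivation" where
  "block_TB M A g = (\<lambda>(S, D). (S,
     \<lambda>T\<in>sections M (TB M). \<lambda>p. anchor A p (D (\<lambda>q. hlift A g q (T q)) p)))"

definition block_ker ::
  "('b::topological_space, 'e::real_inner) atlas \<Rightarrow> ('b, 'v::real_vector) algebroid \<Rightarrow>
   ('b \<Rightarrow> 'v \<Rightarrow> 'v \<Rightarrow> real) \<Rightarrow> ('b, 'v) derivation \<Rightarrow> ('b, 'v) derivation" where
  "block_ker M A g = (\<lambda>(S, D). (S,
     \<lambda>V\<in>sections M (ker_anchor M A). \<lambda>p. vproj A g p (D V p)))"

definition block_TB_ker ::
  "('b, 'v::real_vector) algebroid \<Rightarrow> ('b \<Rightarrow> 'v \<Rightarrow> 'v \<Rightarrow> real) \<Rightarrow> ('b, 'v) derivation \<Rightarrow>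
   ('b \<Rightarrow> 'b functional) \<Rightarrow> 'b \<Rightarrow> 'v" where
  "block_TB_ker A g = (\<lambda>(S, D) T p. vproj A g p (D (\<lambda>q. hlift A g q (T q)) p))"

definition block_ker_TB ::
  "('b, 'v::real_vector) algebroid \<Rightarrow> ('b, 'v) derivation \<Rightarrow> ('b \<Rightarrow> 'v) \<Rightarrow> 'b \<Rightarrow> 'b functional" where
  "block_ker_TB A = (\<lambda>(S, D) V p. anchor A p (D V p))"

definition Cinf_linear ::
  "('b, 'e::real_inner) atlas \<Rightarrow> ('b, 'v::real_vector) algebroid \<Rightarrow> ('b, 'w::real_vector) algebroid \<Rightarrow>
   (('b \<Rightarrow> 'v) \<Rightarrow> 'b \<Rightarrow> 'w) \<Rightarrow> bool" where
  "Cinf_linear M E F L \<longleftrightarrow>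
     (\<forall>X\<in>sections M E. L X \<in> sections M F) \<and>
     (\<forall>X\<in>sections M E. \<forall>Y\<in>sections M E. L (\<lambda>p. X p + Y p) = (\<lambda>p. L X p + L Y p)) \<and>
     (\<forall>X\<in>sections M E. \<forall>f\<in>Cinf M. L (\<lambda>p. f p *\<^sub>R X p) = (\<lambda>p. f p *\<^sub>R L X p))"

text \<open>The fibrewise map \<open>X p \<mapsto> L X p\<close> defined by an operator \<open>L\<close> on sections.\<close>
definition fibre_map ::
  "('b, 'e::real_inner) atlas \<Rightarrow> ('b, 'v::real_vector) algebroid \<Rightarrow>
   (('b \<Rightarrow> 'v) \<Rightarrow> 'b \<Rightarrow> 'w) \<Rightarrow> 'b \<Rightarrow> 'v \<Rightarrow> 'w" where
  "fibre_map M E L p a = (THE w. \<exists>X\<in>sections M E. X p = a \<and> w = L X p)"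

end

theory Submission
  imports Defs
begin

text \<open>
  Each block of a metric derivation is again a metric derivation because \<open>\<gamma>\<close> and \<open>\<iota>\<close> are isometric
  with orthogonal images.  The diagonal blocks of \<open>\<nabla>\<close> are torsion free because \<open>#\<close> and \<open>\<omega>\<close> map the
  bracket of horizontal (vertical) sections to the bracket of \<open>TB\<close> (of \<open>ker #\<close>), so they are the
  Levi-Civita connections by uniqueness.  Differentiating \<open>\<langle>\<gamma> S, V\<rangle> = 0\<close> gives the adjointness of the
  off-diagonal blocks, and adjointness makes their values depend only on the point values of the
  arguments.  The analytic content is that \<open>\<gamma>\<close> preserves smoothness and that \<open>ker #\<close> has smooth local
  frames; both come from a smooth local Gram-Schmidt process.
\<close>

section \<open>Smooth maps on finite-dimensional spaces\<close>

text \<open>Derivations and connections are operators on global sections, whereas the claims about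
  the off-diagonal blocks concern single fibres. The passage between the two rests on bump
  functions: every vector extends to a global section, and a local frame agrees near each point with
  global sections. Since the model space may have dimension zero, boundedness of linear maps, the
  chain rule of every order and compactness of balls are derived from one finite expansion formula.
  The obstacle for \<open>ker #\<close> is constancy of rank: a basis of one kernel extends to
  independent vertical sections, but these might fail to span the neighbouring kernels. Surjectivity
  of \<open>#\<close> supplies so many horizontal vectors that a further vertical one is excluded by
  counting dimensions. Gram-Schmidt is run without normalisation, so that only quotients of smooth
  functions occur. It is recorded together with its coefficients and with a clause on orthogonality
  to the original family; this replaces the inversion of matrices throughout.\<close>

lemma frechet_derivative_eq: "(f has_derivative f') (at x) \<Longrightarrow> frechet_derivative f (at x) = f'"
  using frechet_derivative_at by metis

section \<open>Closure properties of C^k maps\<close>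

text \<open>\<open>Ck_on\<close> takes derivatives in the ambient space; agreement on
  \<open>S\<close> passes to them because \<open>S\<close> is a neighbourhood of each of its
  points.\<close>

lemma Ck_on_cong:
  assumes "open S" "\<And>x. x \<in> S \<Longrightarrow> f x = g x" "Ck_on k S f"
  shows "Ck_on k S g"
  using assms(2,3)
proof (induction k arbitrary: f g)
  case 0
  then show ?case by (simp cong: continuous_on_cong)
next
  case (Suc k)
  have d: "(g has_derivative frechet_derivative f (at x)) (at x)" if "x \<in> S" for x
  proof (rule has_derivative_transform_within_open[OF _ assms(1) that])
    show "(f has_derivative frechet_derivative f (at x)) (at x)"
      using Suc.prems that frechet_derivative_works by auto
  qed (use Suc.prems in auto)
  have "Ck_on k S (\<lambda>x. frechet_derivative g (at x) v)" for v
    by (rule Suc.IH[of "\<lambda>x. frechet_derivative f (at x) v"])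
      (use Suc.prems in \<open>auto simp: frechet_derivative_eq[OF d]\<close>)
  with d show ?case by (auto simp: differentiable_def)
qed

text \<open>Trades the chosen \<open>frechet_derivative\<close> for an explicit formula, so that
  each closure property below amounts to differentiating once and applying the induction
  hypothesis.\<close>

lemma Ck_on_SucI:
  assumes "open S" "\<And>x. x \<in> S \<Longrightarrow> (f has_derivative f' x) (at x)"
    "\<And>v. Ck_on k S (\<lambda>x. f' x v)"
  shows "Ck_on (Suc k) S f"
proof -
  have "Ck_on k S (\<lambda>x. frechet_derivative f (at x) v)" for v
    by (rule Ck_on_cong[OF assms(1) _ assms(3)[of v]]) (simp add: frechet_derivative_eq[OF assms(2)])
  with assms(2) show ?thesis by (auto simp: differentiable_def)
qed

lemma Ck_on_SucD:
  assumes "Ck_on (Suc k) S f"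
  shows "x \<in> S \<Longrightarrow> (f has_derivative frechet_derivative f (at x)) (at x)"
    and "Ck_on k S (\<lambda>x. frechet_derivative f (at x) v)"
  using assms frechet_derivative_works by auto

lemma Ck_on_Suc_imp: "Ck_on (Suc k) S f \<Longrightarrow> Ck_on k S f"
proof (induction k arbitrary: f)
  case 0
  then show ?case
    by (auto intro!: differentiable_imp_continuous_on simp: differentiable_on_def differentiable_at_withinI)
next
  case (Suc k)
  then show ?case by (metis Ck_on.simps(2))
qed

lemma Ck_on_subset: "Ck_on k S f \<Longrightarrow> T \<subseteq> S \<Longrightarrow> Ck_on k T f"
proof (induction k arbitrary: f)
  case (Suc k)
  then show ?case by (simp add: subset_iff)
qed (auto intro: continuous_on_subset)

lemma Ck_on_local:
  assumes "\<And>x. x \<in> S \<Longrightarrow> \<exists>T. open T \<and> x \<in> T \<and> Ck_on k T f"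
  shows "Ck_on k S f"
  using assms
proof (induction k arbitrary: f)
  case 0
  have "isCont f x" if "x \<in> S" for x
    using 0[OF that] by (auto simp: continuous_on_eq_continuous_at)
  then show ?case by (simp add: continuous_at_imp_continuous_on)
next
  case (Suc k)
  have "f differentiable at x" if "x \<in> S" for x
    using Suc.prems[OF that] by auto
  moreover have "Ck_on k S (\<lambda>x. frechet_derivative f (at x) v)" for v
    by (rule Suc.IH) (use Suc.prems in fastforce)
  ultimately show ?case by simp
qed

lemma Ck_on_const: "Ck_on k S (\<lambda>x. c)"
  by (induction k arbitrary: c) (auto simp: frechet_derivative_const)

lemma Ck_on_add:
  assumes "open S" "Ck_on k S f" "Ck_on k S g"
  shows "Ck_on k S (\<lambda>x. f x + g x)"
  using assms(2,3)
proof (induction k arbitrary: f g)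
  case (Suc k)
  show ?case
    by (rule Ck_on_SucI[OF assms(1) has_derivative_add[OF Ck_on_SucD(1) Ck_on_SucD(1)]])
      (use Suc in \<open>auto intro!: Suc.IH\<close>)
qed (auto intro: continuous_intros)

lemma Ck_on_linear:
  assumes "open S" "bounded_linear L" "Ck_on k S f"
  shows "Ck_on k S (\<lambda>x. L (f x))"
  using assms(3)
proof (induction k arbitrary: f)
  case (Suc k)
  show ?case
    by (rule Ck_on_SucI[OF assms(1) bounded_linear.has_derivative[OF assms(2) Ck_on_SucD(1)]])
      (use Suc in \<open>auto intro!: Suc.IH\<close>)
qed (auto intro: bounded_linear.continuous_on assms)

text \<open>One product rule serves multiplication of functions, scaling of vectors and the inner
  product. The derivative is a sum of two products of the same kind, whose undifferentiated factors
  enter one order below what is assumed.\<close>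

lemma Ck_on_bilinear:
  assumes "open S" "bounded_bilinear P" "Ck_on k S f" "Ck_on k S g"
  shows "Ck_on k S (\<lambda>x. P (f x) (g x))"
  using assms(3,4)
proof (induction k arbitrary: f g)
  case 0
  then show ?case by (auto intro: bounded_bilinear.continuous_on assms)
next
  case (Suc k)
  show ?case
  proof (rule Ck_on_SucI[OF assms(1) bounded_bilinear.FDERIV[OF assms(2) Ck_on_SucD(1) Ck_on_SucD(1)]])
    show "Ck_on k S (\<lambda>x. P (f x) (frechet_derivative g (at x) v) + P (frechet_derivative f (at x) v) (g x))"
      for v
      by (intro Ck_on_add[OF assms(1)] Suc.IH Ck_on_Suc_imp[OF Suc.prems(1)]
          Ck_on_Suc_imp[OF Suc.prems(2)] Ck_on_SucD(2)[OF Suc.prems(1)] Ck_on_SucD(2)[OF Suc.prems(2)])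
  qed (use Suc.prems in auto)
qed

lemma Ck_on_id:
  assumes "open S"
  shows "Ck_on k S (\<lambda>x. x)"
proof (cases k)
  case (Suc j)
  then show ?thesis
    using Ck_on_SucI[OF assms has_derivative_ident, of j] Ck_on_const by blast
qed simp

text \<open>The derivative of \<open>1/f\<close> contains \<open>1/f\<close> undifferentiated. The
  induction closes because this factor is then required only one order lower.\<close>

lemma Ck_on_inverse:
  fixes f :: "_ \<Rightarrow> real"
  assumes "open S" "\<And>x. x \<in> S \<Longrightarrow> f x \<noteq> 0" "Ck_on k S f"
  shows "Ck_on k S (\<lambda>x. inverse (f x))"
  using assms(3)
proof (induction k)
  case 0
  then show ?case using assms by (auto intro!: continuous_intros)
next
  case (Suc k)
  \<comment> \<open>The sign is written as a product with a constant, so that closure under bilinear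
    maps covers it.\<close>
  have "Ck_on k S (\<lambda>x. (- 1) * (inverse (f x) * frechet_derivative f (at x) v * inverse (f x)))" for v
    by (intro Ck_on_bilinear[OF assms(1) bounded_bilinear_mult] Ck_on_const
        Suc.IH[OF Ck_on_Suc_imp[OF Suc.prems]] Ck_on_SucD(2)[OF Suc.prems])
  then show ?case
    by (intro Ck_on_SucI[OF assms(1) Deriv.has_derivative_inverse[OF assms(2) Ck_on_SucD(1)[OF Suc.prems]]])
     auto
qed

lemma Ck_on_sum:
  assumes "open S" "finite I" "\<And>i. i \<in> I \<Longrightarrow> Ck_on k S (f i)"
  shows "Ck_on k S (\<lambda>x. \<Sum>i\<in>I. f i x)"
  using assms(2,3) by (induction I rule: finite_induct) (auto simp: Ck_on_const intro!: Ck_on_add assms(1))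

section \<open>Finite-dimensional inner product spaces and the chain rule\<close>

text \<open>Only the reproducing formula is demanded, which makes \<open>B\<close> a finite Parseval
  frame; this is what expansions use. In dimension zero the empty set qualifies.\<close>

definition orthonormal_basis :: "'e::real_inner set \<Rightarrow> bool" where
  "orthonormal_basis B \<longleftrightarrow> finite B \<and> (\<forall>x. (\<Sum>b\<in>B. (x \<bullet> b) *\<^sub>R b) = x)"

lemma orthonormal_basis_exists:
  assumes "finite C" "span C = (UNIV :: 'e::real_inner set)"
  shows "\<exists>B :: 'e set. orthonormal_basis B"
proof -
  obtain D :: "'e set" where D: "finite D" "span D = UNIV" "pairwise orthogonal D"
    using basis_orthogonal[OF assms(1)] assms(2) by auto
  define B where "B = (\<lambda>x. x /\<^sub>R norm x) ` (D - {0})"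
  have fin: "finite B" using D by (simp add: B_def)
  have nrm: "b \<bullet> b = 1" if "b \<in> B" for b
    using that by (auto simp: B_def dot_square_norm power2_eq_square field_simps split: if_splits)
  have orth: "b \<bullet> c = 0" if "b \<in> B" "c \<in> B" "b \<noteq> c" for b c
    using that D(3) by (auto simp: B_def pairwise_def orthogonal_def) metis
  have "D \<subseteq> span B"
  proof
    fix d assume d: "d \<in> D"
    show "d \<in> span B"
    proof (cases "d = 0")
      case False
      then have "d = norm d *\<^sub>R (d /\<^sub>R norm d)" by simp
      moreover have "d /\<^sub>R norm d \<in> B" using False d by (auto simp: B_def)
      ultimately show ?thesis by (metis span_base span_scale)
    qed (simp add: span_zero)
  qed
  then have spanB: "span B = UNIV" using D(2) by (metis span_mono span_span top.extremum_uniqueI)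
  have "(\<Sum>b\<in>B. (x \<bullet> b) *\<^sub>R b) = x" for x
  proof -
    have "x \<in> span B" using spanB by simp
    then show ?thesis
    proof (induction rule: span_induct_alt)
      case (step c u y)
      have "(\<Sum>b\<in>B. (u \<bullet> b) *\<^sub>R b) = (\<Sum>b\<in>B. if b = u then u else 0)"
        using step(1) nrm orth by (intro sum.cong) (auto simp: inner_commute)
      also have "\<dots> = u" using step(1) fin by simp
      finally have "(\<Sum>b\<in>B. (c * (u \<bullet> b)) *\<^sub>R b) = c *\<^sub>R u"
        by (simp flip: scaleR_scaleR scaleR_sum_right)
      moreover have "(\<Sum>b\<in>B. (y \<bullet> b) *\<^sub>R b) = y" by (rule step(2))
      moreover have "(\<Sum>b\<in>B. ((c *\<^sub>R u + y) \<bullet> b) *\<^sub>R b)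
          = (\<Sum>b\<in>B. (c * (u \<bullet> b)) *\<^sub>R b) + (\<Sum>b\<in>B. (y \<bullet> b) *\<^sub>R b)"
        by (simp add: inner_add_left scaleR_add_left sum.distrib)
      ultimately show ?case by simp
    qed simp
  qed
  with fin show ?thesis unfolding orthonormal_basis_def by blast
qed

lemma orthonormal_basisD:
  assumes "orthonormal_basis B"
  shows "finite B" "(\<Sum>b\<in>B. (x \<bullet> b) *\<^sub>R b) = x"
  using assms unfolding orthonormal_basis_def by simp_all

text \<open>Expanding the argument turns \<open>L\<close> into a finite sum of inner products times
  fixed vectors, hence a bounded map. The same expansion reduces derivatives in moving directions to
  derivatives in the finitely many directions of \<open>B\<close>.\<close>

lemma linear_finite_dim:
  fixes L :: "'e::real_inner \<Rightarrow> 'y::real_normed_vector"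
  assumes "orthonormal_basis B" "linear L"
  shows "L x = (\<Sum>b\<in>B. (x \<bullet> b) *\<^sub>R L b)" "bounded_linear L"
proof -
  have eq: "L x = (\<Sum>b\<in>B. (x \<bullet> b) *\<^sub>R L b)" for x
  proof -
    have "L x = L (\<Sum>b\<in>B. (x \<bullet> b) *\<^sub>R b)" by (simp only: orthonormal_basisD(2)[OF assms(1)])
    then show ?thesis by (simp only: linear_sum[OF assms(2)] linear_scale[OF assms(2)])
  qed
  then show "L x = (\<Sum>b\<in>B. (x \<bullet> b) *\<^sub>R L b)" .
  have "bounded_linear (\<lambda>x. \<Sum>b\<in>B. (x \<bullet> b) *\<^sub>R L b)"
    by (intro bounded_linear_sum bounded_linear_scaleR_const bounded_linear_inner_left)
  moreover have "L = (\<lambda>x. \<Sum>b\<in>B. (x \<bullet> b) *\<^sub>R L b)" using eq by blast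
  ultimately show "bounded_linear L" by simp
qed

text \<open>The chain rule applies the derivative of \<open>h\<close> to a direction that varies
  with \<open>x\<close>, but \<open>Ck_on\<close> controls it in fixed directions only. Expanding
  the moving direction in \<open>B\<close> leaves products of a smooth coefficient with a composite
  to which the induction hypothesis applies.\<close>

lemma Ck_on_compose:
  fixes f :: "'x::real_normed_vector \<Rightarrow> 'e::real_inner" and h :: "'e \<Rightarrow> 'y::real_normed_vector"
  assumes B: "orthonormal_basis (B :: 'e set)" and "open S" "f ` S \<subseteq> T"
    and "Ck_on k T h" "Ck_on k S f"
  shows "Ck_on k S (\<lambda>x. h (f x))"
  using assms(4,5)
proof (induction k arbitrary: h)
  case 0
  then show ?case using assms(3) by (auto intro: continuous_on_compose2)
next
  case (Suc k)
  have chain: "((\<lambda>x. h (f x)) has_derivative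
      (\<lambda>v. frechet_derivative h (at (f x)) (frechet_derivative f (at x) v))) (at x)" if "x \<in> S" for x
    using diff_chain_at[OF Ck_on_SucD(1)[OF Suc.prems(2) that], of h] assms(3) that
      Ck_on_SucD(1)[OF Suc.prems(1), of "f x"] by (auto simp: o_def)
  have d: "((\<lambda>x. h (f x)) has_derivative (\<lambda>v. \<Sum>b\<in>B.
      (frechet_derivative f (at x) v \<bullet> b) *\<^sub>R frechet_derivative h (at (f x)) b)) (at x)" if "x \<in> S" for x
  proof -
    have lin: "linear (frechet_derivative h (at (f x)))"
      using Suc.prems(1) that assms(3) by (auto intro: linear_frechet_derivative)
    show ?thesis
      by (rule has_derivative_eq_rhs[OF chain[OF that]], rule ext, rule linear_finite_dim(1)[OF B lin])
  qed
  show ?case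
  proof (rule Ck_on_SucI[where f' = "\<lambda>x v. \<Sum>b\<in>B.
      (frechet_derivative f (at x) v \<bullet> b) *\<^sub>R frechet_derivative h (at (f x)) b", OF assms(2)])
    show "((\<lambda>x. h (f x)) has_derivative (\<lambda>v. \<Sum>b\<in>B.
      (frechet_derivative f (at x) v \<bullet> b) *\<^sub>R frechet_derivative h (at (f x)) b)) (at x)"
      if "x \<in> S" for x by (rule d[OF that])
    fix v
    show "Ck_on k S (\<lambda>x. \<Sum>b\<in>B.
      (frechet_derivative f (at x) v \<bullet> b) *\<^sub>R frechet_derivative h (at (f x)) b)"
    proof (rule Ck_on_sum[OF assms(2) orthonormal_basisD(1)[OF B]])
      fix b
      have "Ck_on k S (\<lambda>x. frechet_derivative f (at x) v \<bullet> b)"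
        using Ck_on_linear[OF assms(2) bounded_linear_inner_left Ck_on_SucD(2)[OF Suc.prems(2)]] .
      moreover have "Ck_on k S (\<lambda>x. frechet_derivative h (at (f x)) b)"
        using Suc.IH[OF Ck_on_SucD(2)[OF Suc.prems(1)] Ck_on_Suc_imp[OF Suc.prems(2)]] .
      ultimately show "Ck_on k S (\<lambda>x.
          (frechet_derivative f (at x) v \<bullet> b) *\<^sub>R frechet_derivative h (at (f x)) b)"
        by (rule Ck_on_bilinear[OF assms(2) bounded_bilinear_scaleR])
    qed
  qed
qed

section \<open>Smooth maps\<close>

lemma smooth_on_cong:
  assumes "open S" "\<And>x. x \<in> S \<Longrightarrow> f x = g x" "smooth_on S f"
  shows "smooth_on S g"
  using assms Ck_on_cong unfolding smooth_on_def by metis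

lemma smooth_on_subset: "smooth_on S f \<Longrightarrow> T \<subseteq> S \<Longrightarrow> smooth_on T f"
  unfolding smooth_on_def using Ck_on_subset by blast

lemma smooth_on_local:
  assumes "\<And>x. x \<in> S \<Longrightarrow> \<exists>T. open T \<and> x \<in> T \<and> smooth_on T f"
  shows "smooth_on S f"
  unfolding smooth_on_def
proof (intro allI Ck_on_local)
  fix k x assume "x \<in> S"
  from assms[OF this] show "\<exists>T. open T \<and> x \<in> T \<and> Ck_on k T f"
    unfolding smooth_on_def by fast
qed

lemma smooth_on_const: "smooth_on S (\<lambda>x. c)"
  by (simp add: smooth_on_def Ck_on_const)

lemma smooth_on_id: "open S \<Longrightarrow> smooth_on S (\<lambda>x. x)"
  by (simp add: smooth_on_def Ck_on_id)

lemma smooth_on_add: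
  "open S \<Longrightarrow> smooth_on S f \<Longrightarrow> smooth_on S g \<Longrightarrow> smooth_on S (\<lambda>x. f x + g x)"
  by (simp add: smooth_on_def Ck_on_add)

lemma smooth_on_linear:
  "open S \<Longrightarrow> bounded_linear L \<Longrightarrow> smooth_on S f \<Longrightarrow> smooth_on S (\<lambda>x. L (f x))"
  by (simp add: smooth_on_def Ck_on_linear)

lemma smooth_on_bilinear:
  "open S \<Longrightarrow> bounded_bilinear P \<Longrightarrow> smooth_on S f \<Longrightarrow> smooth_on S g \<Longrightarrow> smooth_on S (\<lambda>x. P (f x) (g x))"
  by (simp add: smooth_on_def Ck_on_bilinear)

lemma smooth_on_inverse:
  fixes f :: "_ \<Rightarrow> real"
  shows "open S \<Longrightarrow> (\<And>x. x \<in> S \<Longrightarrow> f x \<noteq> 0) \<Longrightarrow> smooth_on S f \<Longrightarrow> smooth_on S (\<lambda>x. inverse (f x))"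
  by (simp add: smooth_on_def Ck_on_inverse)

lemma smooth_on_compose:
  fixes f :: "_ \<Rightarrow> 'e::real_inner"
  assumes "orthonormal_basis (B :: 'e set)" "open S" "f ` S \<subseteq> T" "smooth_on T h" "smooth_on S f"
  shows "smooth_on S (\<lambda>x. h (f x))"
  unfolding smooth_on_def
  by (rule allI, rule Ck_on_compose[OF assms(1,2,3)])
    (use assms(4,5) in \<open>simp_all add: smooth_on_def\<close>)

lemma smooth_on_frechet_derivative:
  assumes "smooth_on S f"
  shows "smooth_on S (\<lambda>x. frechet_derivative f (at x) v)"
  unfolding smooth_on_def
proof
  fix k
  have "Ck_on (Suc k) S f" using assms unfolding smooth_on_def ..
  then show "Ck_on k S (\<lambda>x. frechet_derivative f (at x) v)" by (rule Ck_on_SucD(2))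
qed

lemma smooth_on_has_derivative:
  assumes "smooth_on S f" "x \<in> S"
  shows "(f has_derivative frechet_derivative f (at x)) (at x)"
proof -
  have "Ck_on (Suc 0) S f" using assms(1) unfolding smooth_on_def ..
  then show ?thesis using assms(2) by (rule Ck_on_SucD(1))
qed

lemma smooth_on_imp_continuous_on:
  assumes "smooth_on S f"
  shows "continuous_on S f"
proof -
  have "Ck_on 0 S f" using assms unfolding smooth_on_def ..
  then show ?thesis by simp
qed

section \<open>Bump functions and compact balls\<close>

text \<open>The classical \<open>exp (-1/t)\<close>, multiplied by inverse powers of
  \<open>t\<close>: the whole family is needed because differentiation leads from one member to
  combinations of others.\<close>

definition flat :: "nat \<Rightarrow> real \<Rightarrow> real" where
  "flat n t = (if t \<le> 0 then 0 else exp (- inverse t) * inverse t ^ n)"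

text \<open>Substituting the inverse of \<open>t\<close>, this says that the exponential beats every
  power.\<close>

lemma flat_tendsto: "(flat n \<longlongrightarrow> 0) (at 0)"
proof -
  have "((\<lambda>x::real. x ^ n / exp x) \<longlongrightarrow> 0) at_top" by (rule tendsto_power_div_exp_0)
  then have "((\<lambda>t. inverse t ^ n / exp (inverse t)) \<longlongrightarrow> 0) (at_right (0::real))"
    using filterlim_compose filterlim_inverse_at_top_right by blast
  then have "((\<lambda>t. exp (- inverse t) * inverse t ^ n) \<longlongrightarrow> 0) (at_right (0::real))"
    by (simp add: exp_minus divide_inverse mult.commute)
  then have "(flat n \<longlongrightarrow> 0) (at_right 0)"
    by (rule Lim_transform_eventually)
      (use eventually_at_right_less[of "0::real"] in eventually_elim, simp add: flat_def)
  moreover have "(flat n \<longlongrightarrow> 0) (at_left 0)"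
    by (rule tendsto_eventually) (auto simp: flat_def eventually_at_filter)
  ultimately show ?thesis using filterlim_split_at by blast
qed

lemma flat_deriv: "(flat n has_real_derivative (flat (n + 2) t - n * flat (n + 1) t)) (at t)"
proof -
  consider "t < 0" | "t = 0" | "t > 0" by linarith
  then show ?thesis
  proof cases
    case 1
    have "(flat n has_real_derivative 0) (at t)"
      by (rule has_field_derivative_transform_within_open[of "\<lambda>_. 0" _ _ "{..<0}"])
        (use 1 in \<open>auto simp: flat_def\<close>)
    then show ?thesis using 1 by (simp add: flat_def)
  next
    case 2
    \<comment> \<open>At 0 the difference quotient is literally the next member of the family,
      \<open>h = 0\<close> included because division by zero gives 0. So the derivative is the limit
      found in \<open>flat_tendsto\<close>.\<close>
    have "(\<lambda>h. (flat n (0 + h) - flat n 0) / h) = flat (n + 1)"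
      by (auto simp: flat_def divide_inverse)
    then have "(flat n has_real_derivative 0) (at 0)"
      using flat_tendsto[of "n + 1"] by (simp add: DERIV_def)
    then show ?thesis using 2 by (simp add: flat_def)
  next
    case 3
    define i where "i = inverse t"
    have inv: "(inverse has_real_derivative - (i * i)) (at t)"
      using DERIV_inverse[of t] 3 by (simp add: i_def power2_eq_square power_inverse)
    have "((\<lambda>t. exp (- inverse t) * inverse t ^ n) has_real_derivative
      exp (- i) * (real n * i ^ (n - 1) * - (i * i)) + exp (- i) * - (- (i * i)) * i ^ n) (at t)"
      unfolding i_def by (rule DERIV_cong, rule DERIV_mult[OF DERIV_chain2[OF DERIV_exp DERIV_minus] DERIV_power],
        rule inv, rule inv) (simp add: i_def algebra_simps)
    \<comment> \<open>For \<open>n = 0\<close> the truncated exponent \<open>n - 1\<close> does not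
      fit, but the factor \<open>n\<close> removes the term.\<close>
    moreover have "real n * i ^ (n - 1) * (i * i) = real n * i ^ (n + 1)"
      by (cases n) auto
    then have "exp (- i) * (real n * i ^ (n - 1) * - (i * i)) + exp (- i) * - (- (i * i)) * i ^ n
        = flat (n + 2) t - n * flat (n + 1) t"
      using 3 by (simp add: flat_def i_def[symmetric] power_add power2_eq_square algebra_simps) auto
    ultimately have "((\<lambda>t. exp (- inverse t) * inverse t ^ n) has_real_derivative
      flat (n + 2) t - n * flat (n + 1) t) (at t)" by simp
    then show ?thesis
      by (rule has_field_derivative_transform_within_open[of _ _ _ "{0<..}"])
        (use 3 in \<open>auto simp: flat_def\<close>)
  qed
qed

lemma smooth_on_flat: "smooth_on UNIV (flat n)"
proof -
  have "Ck_on k UNIV (flat n)" for k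
  proof (induction k arbitrary: n)
    case 0
    then show ?case
      by (simp add: continuous_at_imp_continuous_on DERIV_isCont[OF flat_deriv])
  next
    case (Suc k)
    have "Ck_on k UNIV (\<lambda>t. (flat (n + 2) t + (- real n) * flat (n + 1) t) * v)" for v :: real
      by (intro Ck_on_bilinear[OF _ bounded_bilinear_mult] Ck_on_add Ck_on_const Suc) auto
    then show ?case
      by (intro Ck_on_SucI[where f' = "\<lambda>t v. (flat (n + 2) t + (- real n) * flat (n + 1) t) * v"])
        (use flat_deriv in \<open>auto simp: has_field_derivative_def\<close>)
  qed
  then show ?thesis by (simp add: smooth_on_def)
qed

text \<open>The quotient \<open>u / (u + w)\<close>, where \<open>u\<close> is positive exactly
  inside radius \<open>2 * r\<close> and \<open>w\<close> exactly outside radius \<open>r\<close>.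
  They never vanish together, so the denominator is nonzero. Squared distances are used because they
  are smooth also at the centre.\<close>

lemma smooth_bump:
  fixes a :: "'e::real_inner"
  assumes "r > 0"
  shows "\<exists>\<beta> :: 'e \<Rightarrow> real. smooth_on UNIV \<beta> \<and> (\<forall>x\<in>ball a r. \<beta> x = 1) \<and> (\<forall>x. x \<notin> cball a (2 * r) \<longrightarrow> \<beta> x = 0)"
proof -
  define d where "d x = (x - a) \<bullet> (x - a)" for x
  define u where "u x = flat 0 (4 * r\<^sup>2 + (- 1) * d x)" for x
  define w where "w x = flat 0 (d x + - (r\<^sup>2))" for x
  have d: "d x = (dist a x)\<^sup>2" for x
    by (simp add: d_def dist_norm dot_square_norm norm_minus_commute)
  have "{1::real} = Basis" by simp
  then have B: "orthonormal_basis {1::real}"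
    by (simp add: orthonormal_basis_def)
  have "smooth_on UNIV (\<lambda>x. x + (- a))" by (intro smooth_on_add smooth_on_id smooth_on_const) auto
  then have sd: "smooth_on UNIV d"
    unfolding d_def by (intro smooth_on_bilinear[OF _ bounded_bilinear_inner]) auto
  have su: "smooth_on UNIV u" unfolding u_def
    by (rule smooth_on_compose[OF B, where h = "flat 0" and T = UNIV])
     (intro open_UNIV subset_UNIV smooth_on_flat smooth_on_add smooth_on_const sd
        smooth_on_bilinear[OF _ bounded_bilinear_mult])+
  have sw: "smooth_on UNIV w" unfolding w_def
    by (rule smooth_on_compose[OF B, where h = "flat 0" and T = UNIV])
     (intro open_UNIV subset_UNIV smooth_on_flat smooth_on_add[OF _ sd] smooth_on_const)+
  have pos: "u x + w x \<noteq> 0" for x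
  proof -
    have "u x \<ge> 0" "w x \<ge> 0" by (auto simp: u_def w_def flat_def)
    moreover have "u x > 0 \<or> w x > 0"
    proof (cases "d x < 4 * r\<^sup>2")
      case False
      moreover have "r\<^sup>2 > 0" using assms by simp
      ultimately have "r\<^sup>2 < d x" by linarith
      then show ?thesis by (simp add: w_def flat_def)
    qed (simp add: u_def flat_def)
    ultimately show ?thesis by linarith
  qed
  have "smooth_on UNIV (\<lambda>x. u x * inverse (u x + w x))"
    by (intro smooth_on_bilinear[OF _ bounded_bilinear_mult] smooth_on_inverse smooth_on_add su sw pos) auto
  moreover have "u x * inverse (u x + w x) = 1" if "x \<in> ball a r" for x
  proof -
    have "d x < r\<^sup>2" using that assms unfolding d by (simp add: power_strict_mono)
    then have "w x = 0" by (simp add: w_def flat_def)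
    then show ?thesis using pos[of x] by simp
  qed
  moreover have "u x * inverse (u x + w x) = 0" if "x \<notin> cball a (2 * r)" for x
  proof -
    have "(2 * r)\<^sup>2 \<le> d x" using that assms unfolding d by (intro power_mono) auto
    then have "u x = 0" by (simp add: u_def flat_def)
    then show ?thesis by simp
  qed
  ultimately show ?thesis by blast
qed

text \<open>The ball is a closed subset of a set of linear combinations with bounded coefficients,
  and such a set is a finite sum of compact segments.\<close>

lemma compact_cball_finite_dim:
  fixes a :: "'e::real_inner"
  assumes "orthonormal_basis (B :: 'e set)"
  shows "compact (cball a r)"
proof -
  \<comment> \<open>\<open>R\<close> bounds the norm on the ball, so by Cauchy-Schwarz the
    coefficient at \<open>b\<close> is at most \<open>R * norm b\<close>.\<close>
  define R where "R = norm a + \<bar>r\<bar>"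
  have c: "compact {x. \<exists>c. x = (\<Sum>b\<in>C. c b *\<^sub>R b) \<and> (\<forall>b\<in>C. \<bar>c b\<bar> \<le> R * norm b)}" if "finite C" for C :: "'e set"
    using that
  proof induction
    case (insert b C)
    have "{x. \<exists>c. x = (\<Sum>b\<in>insert b C. c b *\<^sub>R b) \<and> (\<forall>b\<in>insert b C. \<bar>c b\<bar> \<le> R * norm b)}
      = {x + y |x y. x \<in> (\<lambda>t. t *\<^sub>R b) ` {- (R * norm b)..R * norm b} \<and>
          y \<in> {x. \<exists>c. x = (\<Sum>b\<in>C. c b *\<^sub>R b) \<and> (\<forall>b\<in>C. \<bar>c b\<bar> \<le> R * norm b)}}" (is "?l = ?r")
    proof (intro equalityI subsetI)
      fix x assume "x \<in> ?l"
      then obtain c where c: "x = (\<Sum>b\<in>insert b C. c b *\<^sub>R b)" "\<forall>b\<in>insert b C. \<bar>c b\<bar> \<le> R * norm b"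
        by blast
      have "c b \<in> {- (R * norm b)..R * norm b}" using c(2) by auto
      then have "c b *\<^sub>R b \<in> (\<lambda>t. t *\<^sub>R b) ` {- (R * norm b)..R * norm b}" by (rule imageI)
      moreover have "x = c b *\<^sub>R b + (\<Sum>b\<in>C. c b *\<^sub>R b)" using c(1) insert.hyps by simp
      moreover have "\<forall>b\<in>C. \<bar>c b\<bar> \<le> R * norm b" using c(2) by simp
      ultimately show "x \<in> ?r" by blast
    next
      fix x assume "x \<in> ?r"
      then obtain t c where tc: "x = t *\<^sub>R b + (\<Sum>b\<in>C. c b *\<^sub>R b)" "\<bar>t\<bar> \<le> R * norm b"
        "\<forall>b\<in>C. \<bar>c b\<bar> \<le> R * norm b" by (auto simp: abs_le_iff)
      have "(\<Sum>x\<in>C. (c(b := t)) x *\<^sub>R x) = (\<Sum>x\<in>C. c x *\<^sub>R x)"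
        using insert.hyps by (intro sum.cong) auto
      then show "x \<in> ?l" using tc insert.hyps by (auto intro!: exI[of _ "c(b := t)"])
    qed
    then show ?case
      using compact_sums[OF compact_continuous_image[of "{- (R * norm b)..R * norm b}" "\<lambda>t. t *\<^sub>R b"] insert.IH]
      by (simp add: continuous_intros)
  qed simp
  have "cball a r \<subseteq> {x. \<exists>c. x = (\<Sum>b\<in>B. c b *\<^sub>R b) \<and> (\<forall>b\<in>B. \<bar>c b\<bar> \<le> R * norm b)}"
  proof
    fix x assume "x \<in> cball a r"
    then have "norm (x - a) \<le> r" by (simp add: dist_norm norm_minus_commute)
    then have "norm x \<le> R" unfolding R_def using norm_triangle_sub[of x a] by linarith
    then have "\<bar>x \<bullet> b\<bar> \<le> R * norm b" for b
      using Cauchy_Schwarz_ineq2[of x b] by (meson mult_right_mono norm_ge_zero order_trans)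
    then show "x \<in> {x. \<exists>c. x = (\<Sum>b\<in>B. c b *\<^sub>R b) \<and> (\<forall>b\<in>B. \<bar>c b\<bar> \<le> R * norm b)}"
      using orthonormal_basisD(2)[OF assms, of x] by force
  qed
  then show ?thesis
    using compact_Int_closed[OF c[OF orthonormal_basisD(1)[OF assms]] closed_cball[of a r]]
    by (simp only: Int_absorb1)
qed

section \<open>Smooth functions on manifolds\<close>

locale manifold =
  fixes M :: "('b::{t2_space,second_countable_topology}, 'e::real_inner) atlas"
  assumes smooth_manifold: "smooth_manifold M"
begin

lemma orthonormal_basis: "\<exists>B :: 'e set. orthonormal_basis B"
  using smooth_manifold orthonormal_basis_exists unfolding smooth_manifold_def by blast

lemma chart_at: obtains U \<phi> where "(U, \<phi>) \<in> M" "p \<in> U"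
proof -
  have "p \<in> (\<Union>(U, \<phi>)\<in>M. U)" using smooth_manifold unfolding smooth_manifold_def by blast
  then show thesis using that by auto
qed

lemma chart:
  assumes "(U, \<phi>) \<in> M"
  shows "open U" "open (\<phi> ` U)" "continuous_on U \<phi>" "continuous_on (\<phi> ` U) (inv_into U \<phi>)"
    "inj_on \<phi> U"
proof -
  have *: "open U \<and> open (\<phi> ` U) \<and> homeomorphism U (\<phi> ` U) \<phi> (inv_into U \<phi>)"
    using smooth_manifold assms unfolding smooth_manifold_def by blast
  then show "open U" "open (\<phi> ` U)" "continuous_on U \<phi>" "continuous_on (\<phi> ` U) (inv_into U \<phi>)"
    by (auto simp: homeomorphism_def)
  show "inj_on \<phi> U" using * by (metis homeomorphism_def inj_on_inverseI)
qed

lemma chart_inv: "(U, \<phi>) \<in> M \<Longrightarrow> p \<in> U \<Longrightarrow> inv_into U \<phi> (\<phi> p) = p"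
  using chart(5) by simp

lemma transition:
  "(U, \<phi>) \<in> M \<Longrightarrow> (V, \<psi>) \<in> M \<Longrightarrow> smooth_on (\<phi> ` (U \<inter> V)) (\<lambda>x. \<psi> (inv_into U \<phi> x))"
  using smooth_manifold unfolding smooth_manifold_def o_def by blast

lemma open_chart_image:
  assumes "(U, \<phi>) \<in> M" "open W"
  shows "open (\<phi> ` (U \<inter> W))"
proof -
  have "\<phi> ` (U \<inter> W) = \<phi> ` U \<inter> inv_into U \<phi> -` W"
    using chart_inv[OF assms(1)] by force
  then show ?thesis
    using continuous_open_preimage[OF chart(4)[OF assms(1)] chart(2)[OF assms(1)] assms(2)] by simp
qed

lemma smooth_fun_onI:
  assumes "\<And>U \<phi>. (U, \<phi>) \<in> M \<Longrightarrow> smooth_on (\<phi> ` (U \<inter> W)) (\<lambda>x. f (inv_into U \<phi> x))"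
  shows "smooth_fun_on M W f"
  using assms by (auto simp: smooth_fun_on_def o_def)

lemma smooth_fun_onD:
  "smooth_fun_on M W f \<Longrightarrow> (U, \<phi>) \<in> M \<Longrightarrow> smooth_on (\<phi> ` (U \<inter> W)) (\<lambda>x. f (inv_into U \<phi> x))"
  by (auto simp: smooth_fun_on_def o_def)

lemma smooth_fun_on_subset:
  assumes "smooth_fun_on M W f" "W' \<subseteq> W"
  shows "smooth_fun_on M W' f"
proof (rule smooth_fun_onI)
  fix U \<phi> assume "(U, \<phi>) \<in> M"
  from smooth_fun_onD[OF assms(1) this]
  show "smooth_on (\<phi> ` (U \<inter> W')) (\<lambda>x. f (inv_into U \<phi> x))"
    by (rule smooth_on_subset) (use assms(2) in blast)
qed

lemma smooth_fun_on_cong: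
  assumes "open W" "smooth_fun_on M W f" "\<And>p. p \<in> W \<Longrightarrow> f p = h p"
  shows "smooth_fun_on M W h"
proof (rule smooth_fun_onI)
  fix U \<phi> assume c: "(U, \<phi>) \<in> M"
  show "smooth_on (\<phi> ` (U \<inter> W)) (\<lambda>x. h (inv_into U \<phi> x))"
    by (rule smooth_on_cong[OF open_chart_image[OF c assms(1)] _ smooth_fun_onD[OF assms(2) c]])
      (use assms(3) chart_inv[OF c] in auto)
qed

lemma smooth_fun_on_local:
  assumes "\<And>p. p \<in> W \<Longrightarrow> \<exists>W'. open W' \<and> p \<in> W' \<and> smooth_fun_on M W' f"
  shows "smooth_fun_on M W f"
proof (rule smooth_fun_onI)
  fix U \<phi> assume c: "(U, \<phi>) \<in> M"
  show "smooth_on (\<phi> ` (U \<inter> W)) (\<lambda>x. f (inv_into U \<phi> x))"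
  proof (rule smooth_on_local)
    fix x assume "x \<in> \<phi> ` (U \<inter> W)"
    then obtain p where p: "p \<in> U" "p \<in> W" "x = \<phi> p" by blast
    obtain W' where "open W'" "p \<in> W'" "smooth_fun_on M W' f" using assms[OF p(2)] by blast
    then show "\<exists>T. open T \<and> x \<in> T \<and> smooth_on T (\<lambda>x. f (inv_into U \<phi> x))"
      using p open_chart_image[OF c] smooth_fun_onD[OF _ c]
      by (intro exI[of _ "\<phi> ` (U \<inter> W')"]) auto
  qed
qed

lemma smooth_fun_on_const: "smooth_fun_on M W (\<lambda>p. c)"
  by (rule smooth_fun_onI) (rule smooth_on_const)

lemma smooth_fun_on_add:
  assumes "open W" "smooth_fun_on M W f" "smooth_fun_on M W h"
  shows "smooth_fun_on M W (\<lambda>p. f p + h p)"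
  by (rule smooth_fun_onI, rule smooth_on_add[OF open_chart_image[OF _ assms(1)]
      smooth_fun_onD[OF assms(2)] smooth_fun_onD[OF assms(3)]])

lemma smooth_fun_on_mult:
  assumes "open W" "smooth_fun_on M W f" "smooth_fun_on M W h"
  shows "smooth_fun_on M W (\<lambda>p. f p * h p)"
  by (rule smooth_fun_onI, rule smooth_on_bilinear[OF open_chart_image[OF _ assms(1)] bounded_bilinear_mult
      smooth_fun_onD[OF assms(2)] smooth_fun_onD[OF assms(3)]])

lemma smooth_fun_on_minus:
  "open W \<Longrightarrow> smooth_fun_on M W f \<Longrightarrow> smooth_fun_on M W (\<lambda>p. - f p)"
  using smooth_fun_on_mult[of W "\<lambda>p. - 1" f] smooth_fun_on_const by simp

lemma smooth_fun_on_inverse: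
  assumes "open W" "\<And>p. p \<in> W \<Longrightarrow> f p \<noteq> 0" "smooth_fun_on M W f"
  shows "smooth_fun_on M W (\<lambda>p. inverse (f p))"
proof (rule smooth_fun_onI)
  fix U \<phi> assume c: "(U, \<phi>) \<in> M"
  show "smooth_on (\<phi> ` (U \<inter> W)) (\<lambda>x. inverse (f (inv_into U \<phi> x)))"
    by (rule smooth_on_inverse[OF open_chart_image[OF c assms(1)] _ smooth_fun_onD[OF assms(3) c]])
      (use assms(2) chart_inv[OF c] in auto)
qed

lemma smooth_fun_on_divide:
  assumes "open W" "smooth_fun_on M W h" "smooth_fun_on M W f" "\<And>p. p \<in> W \<Longrightarrow> f p \<noteq> 0"
  shows "smooth_fun_on M W (\<lambda>p. h p / f p)"
  unfolding divide_inverse using assms by (intro smooth_fun_on_mult smooth_fun_on_inverse) auto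

lemma smooth_fun_on_sum:
  assumes "open W"
  shows "(\<And>i. i \<in> I \<Longrightarrow> smooth_fun_on M W (f i)) \<Longrightarrow> smooth_fun_on M W (\<lambda>p. \<Sum>i\<in>I. f i p)"
proof (induction I rule: infinite_finite_induct)
  case (insert i I)
  then have "smooth_fun_on M W (\<lambda>p. f i p + (\<Sum>i\<in>I. f i p))"
    by (intro smooth_fun_on_add[OF assms]) auto
  then show ?case using insert.hyps by simp
qed (simp_all add: smooth_fun_on_const)

text \<open>Composing with transition maps carries smoothness from one chart to all others. This is
  how coordinate formulas become smooth functions on the manifold.\<close>

lemma smooth_fun_on_chart:
  assumes "(U, \<phi>) \<in> M" "open W" "smooth_on (\<phi> ` (U \<inter> W)) G"
  shows "smooth_fun_on M (U \<inter> W) (\<lambda>p. G (\<phi> p))"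
proof (rule smooth_fun_onI)
  fix V \<psi> assume c: "(V, \<psi>) \<in> M"
  obtain B :: "'e set" where B: "orthonormal_basis B" using orthonormal_basis by blast
  show "smooth_on (\<psi> ` (V \<inter> (U \<inter> W))) (\<lambda>x. G (\<phi> (inv_into V \<psi> x)))"
  proof (rule smooth_on_compose[OF B _ _ assms(3)])
    show "open (\<psi> ` (V \<inter> (U \<inter> W)))"
      using open_chart_image[OF c] chart(1)[OF assms(1)] assms(2) by blast
    show "(\<lambda>x. \<phi> (inv_into V \<psi> x)) ` \<psi> ` (V \<inter> (U \<inter> W)) \<subseteq> \<phi> ` (U \<inter> W)"
      using chart_inv[OF c] by auto
    show "smooth_on (\<psi> ` (V \<inter> (U \<inter> W))) (\<lambda>x. \<phi> (inv_into V \<psi> x))"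
      by (rule smooth_on_subset[OF transition[OF c assms(1)]]) blast
  qed
qed

lemma smooth_fun_on_imp_isCont:
  assumes "open W" "smooth_fun_on M W f" "p \<in> W"
  shows "isCont f p"
proof -
  obtain U \<phi> where c: "(U, \<phi>) \<in> M" "p \<in> U" using chart_at .
  have "continuous_on (\<phi> ` (U \<inter> W)) (\<lambda>x. f (inv_into U \<phi> x))"
    by (rule smooth_on_imp_continuous_on[OF smooth_fun_onD[OF assms(2) c(1)]])
  then have "continuous_on (U \<inter> W) (\<lambda>q. f (inv_into U \<phi> (\<phi> q)))"
    by (rule continuous_on_compose2[OF _ continuous_on_subset[OF chart(3)[OF c(1)]]]) auto
  then have "continuous_on (U \<inter> W) f"
    by (rule continuous_on_eq) (use chart_inv[OF c(1)] in auto)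
  then show ?thesis
    using assms c chart(1)[OF c(1)] by (simp add: continuous_on_eq_continuous_at open_Int)
qed

lemma nonzero_nbhd:
  assumes "open W" "smooth_fun_on M W f" "p \<in> W" "f p \<noteq> (0::real)"
  obtains W' where "open W'" "p \<in> W'" "W' \<subseteq> W" "\<forall>q\<in>W'. f q \<noteq> 0"
proof -
  have "continuous_on W f"
    using smooth_fun_on_imp_isCont[OF assms(1,2)] by (simp add: continuous_at_imp_continuous_on)
  then have "open (W \<inter> f -` (- {0}))" by (rule continuous_open_preimage) (use assms(1) in auto)
  then show thesis using that[of "W \<inter> f -` (- {0})"] assms by auto
qed

section \<open>Cut-off functions on the manifold\<close>

text \<open>The closed set \<open>C\<close> is part of the conclusion because gluing with 0 needs
  two open sets, \<open>U\<close> and the complement of \<open>C\<close>. Vanishing outside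
  \<open>U\<close> alone would not control the behaviour at the boundary of
  \<open>U\<close>.\<close>

lemma manifold_bump:
  assumes "open U" "p \<in> U"
  obtains f W C where "f \<in> Cinf M" "open W" "p \<in> W" "W \<subseteq> U" "\<forall>q\<in>W. f q = 1"
    "closed C" "C \<subseteq> U" "\<forall>q. q \<notin> C \<longrightarrow> f q = 0"
proof -
  obtain V \<phi> where c: "(V, \<phi>) \<in> M" "p \<in> V" using chart_at .
  have op: "open (\<phi> ` (V \<inter> U))" using open_chart_image[OF c(1) assms(1)] .
  obtain s where s: "s > 0" "cball (\<phi> p) s \<subseteq> \<phi> ` (V \<inter> U)"
    using op c(2) assms(2) open_contains_cball by (metis IntI image_eqI)
  define r where "r = s / 2"
  have r: "r > 0" "cball (\<phi> p) (2 * r) \<subseteq> \<phi> ` (V \<inter> U)" using s by (auto simp: r_def)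
  obtain \<beta> where \<beta>: "smooth_on UNIV \<beta>" "\<forall>x\<in>ball (\<phi> p) r. \<beta> x = (1::real)"
    "\<forall>x. x \<notin> cball (\<phi> p) (2 * r) \<longrightarrow> \<beta> x = 0"
    using smooth_bump[OF r(1)] by blast
  define f where "f q = (if q \<in> V then \<beta> (\<phi> q) else 0)" for q
  define C where "C = inv_into V \<phi> ` cball (\<phi> p) (2 * r)"
  define W where "W = V \<inter> \<phi> -` ball (\<phi> p) r"
  obtain B :: "'e set" where B: "orthonormal_basis B" using orthonormal_basis by blast
  have "compact C" unfolding C_def
    by (intro compact_continuous_image compact_cball_finite_dim[OF B] continuous_on_subset[OF chart(4)[OF c(1)]])
      (use r(2) in auto)
  \<comment> \<open>The Hausdorff property enters here: the compact preimage of a coordinate ball is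
    closed in the whole manifold and not merely in the chart domain.\<close>
  then have C: "closed C" by (rule compact_imp_closed)
  have CU: "C \<subseteq> V \<inter> U"
    unfolding C_def using r(2) chart_inv[OF c(1)] by fastforce
  have f0: "f q = 0" if "q \<notin> C" for q
  proof (cases "q \<in> V")
    case True
    have "\<phi> q \<notin> cball (\<phi> p) (2 * r)"
      using that chart_inv[OF c(1) True] unfolding C_def by (metis image_eqI)
    then show ?thesis using \<beta>(3) by (simp add: f_def)
  qed (simp add: f_def)
  have "smooth_fun_on M UNIV f"
  proof (rule smooth_fun_on_local)
    fix q
    have "smooth_fun_on M V (\<lambda>p. \<beta> (\<phi> p))"
      using smooth_fun_on_chart[OF c(1) open_UNIV smooth_on_subset[OF \<beta>(1)]] by simp
    then have 1: "smooth_fun_on M V f"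
      by (rule smooth_fun_on_cong[OF chart(1)[OF c(1)]]) (simp add: f_def)
    have 2: "smooth_fun_on M (- C) f"
      by (rule smooth_fun_on_cong[OF _ smooth_fun_on_const[of _ 0]]) (use C f0 in auto)
    show "\<exists>W'. open W' \<and> q \<in> W' \<and> smooth_fun_on M W' f"
    proof (cases "q \<in> V")
      case True
      then show ?thesis using 1 chart(1)[OF c(1)] by blast
    next
      case False
      then show ?thesis using 2 C CU by (intro exI[of _ "- C"]) auto
    qed
  qed
  then have "f \<in> Cinf M" by (simp add: Cinf_def)
  moreover have "open W" unfolding W_def
    by (rule continuous_open_preimage[OF chart(3)[OF c(1)] chart(1)[OF c(1)]]) simp
  moreover have "p \<in> W" using c r(1) by (simp add: W_def)
  moreover have "W \<subseteq> U"
  proof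
    fix q assume q: "q \<in> W"
    then have "\<phi> q \<in> cball (\<phi> p) (2 * r)" using r(1) by (auto simp: W_def)
    then have "q \<in> C" using chart_inv[OF c(1), of q] q unfolding C_def W_def
      by (metis IntD1 image_eqI)
    then show "q \<in> U" using CU by blast
  qed
  moreover have "f q = 1" if "q \<in> W" for q
    using that \<beta>(2) by (auto simp: f_def W_def)
  ultimately show thesis using that[of f W C] C CU f0 by blast
qed

end

section \<open>Smooth sections of vector bundles\<close>

text \<open>Canonical coordinates, determined pointwise. They replace the existentially quantified
  coefficients of \<open>smooth_section_on\<close> wherever local information has to be
  glued.\<close>

definition frame_coef :: "nat \<Rightarrow> (nat \<Rightarrow> 'v::real_vector) \<Rightarrow> 'v \<Rightarrow> nat \<Rightarrow> real" where
  "frame_coef k u x i = representation (u ` {..<k}) x (u i)"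

lemma basis_family_subspace: "basis_family k u F \<Longrightarrow> subspace F"
  unfolding basis_family_def by (auto intro: subspace_span)

lemma basis_family_mem: "basis_family k u F \<Longrightarrow> i < k \<Longrightarrow> u i \<in> F"
  unfolding basis_family_def by (auto intro: span_base)

lemma frame_coef_expand:
  assumes "basis_family k u F" "x \<in> F"
  shows "(\<Sum>i<k. frame_coef k u x i *\<^sub>R u i) = x"
proof -
  have "(\<Sum>b\<in>u ` {..<k}. representation (u ` {..<k}) x b *\<^sub>R b) = x"
    using assms unfolding basis_family_def by (intro sum_representation_eq) auto
  then show ?thesis
    using assms(1) unfolding basis_family_def frame_coef_def by (simp add: sum.reindex o_def)
qed

lemma basis_family_zero:
  assumes "basis_family k u F" "(\<Sum>i<k. c i *\<^sub>R u i) = 0" "j < k"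
  shows "c j = 0"
proof -
  have inj: "inj_on u {..<k}" and ind: "independent (u ` {..<k})"
    using assms(1) by (auto simp: basis_family_def)
  \<comment> \<open>Independence is a statement about sets of vectors; \<open>the_inv_into\<close>
    moves the coefficients from indices to vectors.\<close>
  have "(\<Sum>v\<in>u ` {..<k}. c (the_inv_into {..<k} u v) *\<^sub>R v) = (\<Sum>i<k. c i *\<^sub>R u i)"
    unfolding sum.reindex[OF inj] by (intro sum.cong) (auto simp: the_inv_into_f_f[OF inj])
  then have "c (the_inv_into {..<k} u (u j)) = 0"
    using independentD[OF ind _ subset_refl, of "\<lambda>v. c (the_inv_into {..<k} u v)"] assms(2,3) by simp
  then show ?thesis using assms(3) by (simp add: the_inv_into_f_f[OF inj])
qed

lemma frame_coef_unique:
  assumes "basis_family k u F" "(\<Sum>i<k. c i *\<^sub>R u i) = x" "x \<in> F" "j < k"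
  shows "frame_coef k u x j = c j"
proof -
  have "(\<Sum>i<k. (frame_coef k u x i - c i) *\<^sub>R u i) = 0"
    using frame_coef_expand[OF assms(1,3)] assms(2) by (simp add: scaleR_diff_left sum_subtractf)
  then show ?thesis using basis_family_zero[OF assms(1) _ assms(4)] by fastforce
qed

lemma frame_coef_add:
  assumes "basis_family k u F" "x \<in> F" "y \<in> F" "j < k"
  shows "frame_coef k u (x + y) j = frame_coef k u x j + frame_coef k u y j"
  using assms frame_coef_expand[OF assms(1,2)] frame_coef_expand[OF assms(1,3)]
    subspace_add[OF basis_family_subspace]
  by (intro frame_coef_unique[OF assms(1)]) (auto simp: scaleR_add_left sum.distrib)

lemma frame_coef_scale:
  assumes "basis_family k u F" "x \<in> F" "j < k"
  shows "frame_coef k u (r *\<^sub>R x) j = r * frame_coef k u x j"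
proof (rule frame_coef_unique[OF assms(1) _ _ assms(3)])
  show "(\<Sum>i<k. (r * frame_coef k u x i) *\<^sub>R u i) = r *\<^sub>R x"
    using frame_coef_expand[OF assms(1,2)] by (simp flip: scaleR_scaleR scaleR_sum_right)
  show "r *\<^sub>R x \<in> F" using assms(2) basis_family_subspace[OF assms(1)] by (simp add: subspace_scale)
qed

section \<open>Inner products on a fibre and orthogonal families\<close>

text \<open>The pointwise content of a bundle metric, restricted to \<open>F\<close> because
  \<open>G\<close> is arbitrary off the fibre. The induced metrics on \<open>TB\<close> and
  \<open>ker #\<close> enter the proof through these laws.\<close>

locale inner_fibre =
  fixes F :: "'v::real_vector set" and G :: "'v \<Rightarrow> 'v \<Rightarrow> real"
  assumes subspace: "subspace F"
    and sym: "a \<in> F \<Longrightarrow> b \<in> F \<Longrightarrow> G a b = G b a"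
    and add_left: "a \<in> F \<Longrightarrow> b \<in> F \<Longrightarrow> c \<in> F \<Longrightarrow> G (a + b) c = G a c + G b c"
    and scale_left: "a \<in> F \<Longrightarrow> b \<in> F \<Longrightarrow> G (r *\<^sub>R a) b = r * G a b"
    and pos: "a \<in> F \<Longrightarrow> a \<noteq> 0 \<Longrightarrow> G a a > 0"
begin

lemma zero_mem: "0 \<in> F" and add_mem: "a \<in> F \<Longrightarrow> b \<in> F \<Longrightarrow> a + b \<in> F"
  and diff_mem: "a \<in> F \<Longrightarrow> b \<in> F \<Longrightarrow> a - b \<in> F"
  and scale_mem: "a \<in> F \<Longrightarrow> r *\<^sub>R a \<in> F"
  and sum_mem: "(\<And>i. i \<in> I \<Longrightarrow> h i \<in> F) \<Longrightarrow> sum h I \<in> F"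
  using subspace by (auto simp: subspace_0 subspace_add subspace_diff subspace_scale subspace_sum)

lemma zero_left: "b \<in> F \<Longrightarrow> G 0 b = 0"
  using scale_left[of 0 b 0] zero_mem by simp

lemma zero_right: "b \<in> F \<Longrightarrow> G b 0 = 0"
  using zero_left sym zero_mem by metis

lemma diff_left: "a \<in> F \<Longrightarrow> b \<in> F \<Longrightarrow> c \<in> F \<Longrightarrow> G (a - b) c = G a c - G b c"
  using add_left[of a "(-1) *\<^sub>R b" c] scale_left[of b c "-1"] scale_mem[of b "-1"] by simp

lemma diff_right: "a \<in> F \<Longrightarrow> b \<in> F \<Longrightarrow> c \<in> F \<Longrightarrow> G c (a - b) = G c a - G c b"
  using diff_left[of a b c] sym diff_mem by metis

lemma eq_zero: "a \<in> F \<Longrightarrow> G a a = 0 \<Longrightarrow> a = 0"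
  using pos by force

lemma lincomb_left:
  "finite I \<Longrightarrow> (\<And>i. i \<in> I \<Longrightarrow> h i \<in> F) \<Longrightarrow> b \<in> F \<Longrightarrow> G (\<Sum>i\<in>I. c i *\<^sub>R h i) b = (\<Sum>i\<in>I. c i * G (h i) b)"
proof (induction I rule: finite_induct)
  case (insert i I)
  then have "(\<Sum>i\<in>I. c i *\<^sub>R h i) \<in> F" by (intro sum_mem scale_mem) auto
  with insert show ?case by (simp add: add_left scale_left scale_mem)
qed (simp add: zero_left)

lemma lincomb_right:
  assumes "finite I" "\<And>i. i \<in> I \<Longrightarrow> h i \<in> F" "b \<in> F"
  shows "G b (\<Sum>i\<in>I. c i *\<^sub>R h i) = (\<Sum>i\<in>I. c i * G b (h i))"
proof -
  have "(\<Sum>i\<in>I. c i *\<^sub>R h i) \<in> F" using assms by (intro sum_mem scale_mem) auto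
  then have "G b (\<Sum>i\<in>I. c i *\<^sub>R h i) = (\<Sum>i\<in>I. c i * G (h i) b)"
    using lincomb_left[OF assms] sym[OF assms(3)] by simp
  also have "\<dots> = (\<Sum>i\<in>I. c i * G b (h i))"
    using assms by (intro sum.cong) (auto simp: sym)
  finally show ?thesis .
qed

text \<open>Orthogonal projection onto the span of a nonzero orthogonal family. Dividing by the
  squared lengths instead of normalising keeps square roots out of the smoothness arguments.\<close>

definition proj :: "nat \<Rightarrow> (nat \<Rightarrow> 'v) \<Rightarrow> 'v \<Rightarrow> 'v" where
  "proj k w a = (\<Sum>i<k. (G a (w i) / G (w i) (w i)) *\<^sub>R w i)"

lemma proj_mem: "(\<And>i. i < k \<Longrightarrow> w i \<in> F) \<Longrightarrow> proj k w a \<in> F"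
  unfolding proj_def by (intro sum_mem scale_mem) auto

lemma proj_orthogonal:
  assumes "\<And>i. i < k \<Longrightarrow> w i \<in> F" "\<And>i. i < k \<Longrightarrow> w i \<noteq> 0"
    "\<And>i j. i < k \<Longrightarrow> j < k \<Longrightarrow> i \<noteq> j \<Longrightarrow> G (w i) (w j) = 0" "a \<in> F" "j < k"
  shows "G (a - proj k w a) (w j) = 0"
proof -
  have "G (proj k w a) (w j) = (\<Sum>i<k. G a (w i) / G (w i) (w i) * G (w i) (w j))"
    unfolding proj_def by (rule lincomb_left) (use assms in auto)
  also have "\<dots> = (\<Sum>i<k. if i = j then G a (w j) else 0)"
    using assms pos[of "w j"] by (intro sum.cong) auto
  also have "\<dots> = G a (w j)" using assms(5) by simp
  finally show ?thesis using assms proj_mem[of k w a] by (simp add: diff_left)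
qed

lemma orthogonal_independent:
  fixes k :: nat
  assumes "\<And>i. i < k \<Longrightarrow> w i \<in> F" "\<And>i. i < k \<Longrightarrow> w i \<noteq> 0"
    "\<And>i j. i < k \<Longrightarrow> j < k \<Longrightarrow> i \<noteq> j \<Longrightarrow> G (w i) (w j) = 0"
  shows "inj_on w {..<k}" "independent (w ` {..<k})"
proof -
  show inj: "inj_on w {..<k}"
    by (rule inj_onI) (metis assms eq_zero lessThan_iff)
  show "independent (w ` {..<k})"
  proof (rule independent_if_scalars_zero)
    fix f v assume f: "(\<Sum>x\<in>w ` {..<k}. f x *\<^sub>R x) = 0" and "v \<in> w ` {..<k}"
    then obtain j where j: "j < k" "v = w j" by auto
    have "0 = G (\<Sum>i<k. f (w i) *\<^sub>R w i) (w j)"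
      using f zero_left[OF assms(1)[OF j(1)]] by (simp add: sum.reindex[OF inj])
    also have "\<dots> = (\<Sum>i<k. f (w i) * G (w i) (w j))"
      by (rule lincomb_left) (use assms j in auto)
    also have "\<dots> = (\<Sum>i<k. if i = j then f (w j) * G (w j) (w j) else 0)"
      using assms j by (intro sum.cong) auto
    also have "\<dots> = f (w j) * G (w j) (w j)" using j by simp
    finally show "f v = 0" using pos[OF assms(1,2)[OF j(1)]] j by simp
  qed simp
qed

end

section \<open>First consequences of the bundle axioms\<close>

lemma inner_fibre_bundle:
  assumes "vector_bundle M E" "bundle_metric M E g"
  shows "inner_fibre (fib E p) (g p)"
  using assms by unfold_locales (simp_all add: vector_bundle_def bundle_metric_def)

lemma vector_bundle_frame:
  assumes "vector_bundle M E" "(U, k, e) \<in> frames E"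
  shows "open U" "p \<in> U \<Longrightarrow> basis_family k (\<lambda>i. e i p) (fib E p)"
    "i < k \<Longrightarrow> smooth_section_on M E U (e i)"
proof -
  have "\<forall>(U, k, e)\<in>frames E. open U \<and> (\<forall>p\<in>U. basis_family k (\<lambda>i. e i p) (fib E p)) \<and>
      (\<forall>i<k. smooth_section_on M E U (e i))"
    using assms(1) unfolding vector_bundle_def by (elim conjE)
  from bspec[OF this assms(2)]
  show "open U" "p \<in> U \<Longrightarrow> basis_family k (\<lambda>i. e i p) (fib E p)"
    "i < k \<Longrightarrow> smooth_section_on M E U (e i)" by simp_all
qed

lemma vector_bundle_frame_at:
  assumes "vector_bundle M E"
  obtains U k e where "(U, k, e) \<in> frames E" "p \<in> U"
proof -
  have "(\<Union>(U, k, e)\<in>frames E. U) = UNIV" using assms unfolding vector_bundle_def by (elim conjE)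
  then have "p \<in> (\<Union>(U, k, e)\<in>frames E. U)" by simp
  then show thesis using that by auto
qed

lemma vector_bundle_subspace: "vector_bundle M E \<Longrightarrow> subspace (fib E p)"
  unfolding vector_bundle_def by blast

lemma section_mem: "smooth_section_on M E W s \<Longrightarrow> p \<in> W \<Longrightarrow> s p \<in> fib E p"
  unfolding smooth_section_on_def by blast

lemma section_coefs:
  assumes "smooth_section_on M E W s" "(U, k, e) \<in> frames E"
  obtains c where "\<forall>i<k. smooth_fun_on M (U \<inter> W) (c i)"
    "\<forall>p\<in>U \<inter> W. s p = (\<Sum>i<k. c i p *\<^sub>R e i p)"
proof -
  have "\<forall>(U, k, e)\<in>frames E. \<exists>c. (\<forall>i<k. smooth_fun_on M (U \<inter> W) (c i)) \<and>
     (\<forall>p\<in>U \<inter> W. s p = (\<Sum>i<k. c i p *\<^sub>R e i p))"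
    using assms(1) unfolding smooth_section_on_def by (elim conjE)
  from bspec[OF this assms(2)]
  have "\<exists>c. (\<forall>i<k. smooth_fun_on M (U \<inter> W) (c i)) \<and> (\<forall>p\<in>U \<inter> W. s p = (\<Sum>i<k. c i p *\<^sub>R e i p))"
    by (simp only: prod.case)
  then obtain c where "\<forall>i<k. smooth_fun_on M (U \<inter> W) (c i)" "\<forall>p\<in>U \<inter> W. s p = (\<Sum>i<k. c i p *\<^sub>R e i p)"
    by (elim exE conjE)
  then show thesis by (rule that)
qed

lemma smooth_section_onI:
  assumes "\<And>p. p \<in> W \<Longrightarrow> s p \<in> fib E p"
    "\<And>U k e. (U, k, e) \<in> frames E \<Longrightarrow> \<exists>c. (\<forall>i<k. smooth_fun_on M (U \<inter> W) (c i)) \<and>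
      (\<forall>p\<in>U \<inter> W. s p = (\<Sum>i<k. c i p *\<^sub>R e i p))"
  shows "smooth_section_on M E W s"
  unfolding smooth_section_on_def
proof (intro conjI ballI)
  fix x assume "x \<in> frames E"
  then show "case x of (U, k, e) \<Rightarrow> \<exists>c. (\<forall>i<k. smooth_fun_on M (U \<inter> W) (c i)) \<and>
      (\<forall>p\<in>U \<inter> W. s p = (\<Sum>i<k. c i p *\<^sub>R e i p))"
    by (cases x) (simp only: prod.case assms(2))
qed (rule assms(1))

lemma sectionsD: "X \<in> sections M E \<Longrightarrow> smooth_section_on M E UNIV X" "X \<in> sections M E \<Longrightarrow> X p \<in> fib E p"
  by (auto simp: sections_def section_mem)

lemma bundle_mapD:
  assumes "bundle_map M E F \<Phi>"
  shows "a \<in> fib E p \<Longrightarrow> \<Phi> p a \<in> fib F p"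
    "a \<in> fib E p \<Longrightarrow> b \<in> fib E p \<Longrightarrow> \<Phi> p (a + b) = \<Phi> p a + \<Phi> p b"
    "a \<in> fib E p \<Longrightarrow> \<Phi> p (r *\<^sub>R a) = r *\<^sub>R \<Phi> p a"
    "(U, k, e) \<in> frames E \<Longrightarrow> i < k \<Longrightarrow> smooth_section_on M F U (\<lambda>p. \<Phi> p (e i p))"
proof -
  show "a \<in> fib E p \<Longrightarrow> \<Phi> p a \<in> fib F p"
    "a \<in> fib E p \<Longrightarrow> b \<in> fib E p \<Longrightarrow> \<Phi> p (a + b) = \<Phi> p a + \<Phi> p b"
    "a \<in> fib E p \<Longrightarrow> \<Phi> p (r *\<^sub>R a) = r *\<^sub>R \<Phi> p a"
    using assms by (simp_all add: bundle_map_def)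
  have "\<forall>(U, k, e)\<in>frames E. \<forall>i<k. smooth_section_on M F U (\<lambda>p. \<Phi> p (e i p))"
    using assms unfolding bundle_map_def by (elim conjE)
  then show "(U, k, e) \<in> frames E \<Longrightarrow> i < k \<Longrightarrow> smooth_section_on M F U (\<lambda>p. \<Phi> p (e i p))"
    by (auto dest: bspec)
qed

lemma bundle_map_lincomb:
  assumes "vector_bundle M E" "bundle_map M E F \<Phi>" "finite I" "\<And>i. i \<in> I \<Longrightarrow> h i \<in> fib E p"
  shows "\<Phi> p (\<Sum>i\<in>I. c i *\<^sub>R h i) = (\<Sum>i\<in>I. c i *\<^sub>R \<Phi> p (h i))"
  using assms(3,4)
proof (induction I rule: finite_induct)
  case empty
  show ?case
    using bundle_mapD(3)[OF assms(2), of 0 p 0] subspace_0[OF vector_bundle_subspace[OF assms(1)]] by simp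
next
  case (insert i I)
  have "(\<Sum>i\<in>I. c i *\<^sub>R h i) \<in> fib E p"
    using insert.prems vector_bundle_subspace[OF assms(1)]
    by (intro subspace_sum subspace_scale) auto
  moreover have "c i *\<^sub>R h i \<in> fib E p"
    using insert.prems vector_bundle_subspace[OF assms(1)] by (intro subspace_scale) auto
  ultimately show ?case
    using insert bundle_mapD(2,3)[OF assms(2)] by simp
qed

section \<open>Calculus of smooth sections\<close>

context manifold
begin

lemma smooth_sectionI:
  assumes "vector_bundle M E" "\<And>p. p \<in> W \<Longrightarrow> s p \<in> fib E p"
    "\<And>U k e i. (U, k, e) \<in> frames E \<Longrightarrow> i < k \<Longrightarrow>
      smooth_fun_on M (U \<inter> W) (\<lambda>p. frame_coef k (\<lambda>i. e i p) (s p) i)"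
  shows "smooth_section_on M E W s"
proof (rule smooth_section_onI[OF assms(2)])
  fix U k e assume f: "(U, k, e) \<in> frames E"
  show "\<exists>c. (\<forall>i<k. smooth_fun_on M (U \<inter> W) (c i)) \<and> (\<forall>p\<in>U \<inter> W. s p = (\<Sum>i<k. c i p *\<^sub>R e i p))"
    using assms(3)[OF f] frame_coef_expand[OF vector_bundle_frame(2)[OF assms(1) f] assms(2)]
    by (intro exI[of _ "\<lambda>i p. frame_coef k (\<lambda>i. e i p) (s p) i"]) simp
qed

text \<open>Uniqueness of coordinates identifies the coefficients supplied by the definition with
  the canonical ones.\<close>

lemma smooth_sectionD:
  assumes "vector_bundle M E" "smooth_section_on M E W s" "open W" "(U, k, e) \<in> frames E" "i < k"
  shows "smooth_fun_on M (U \<inter> W) (\<lambda>p. frame_coef k (\<lambda>i. e i p) (s p) i)"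
proof -
  obtain c where c: "\<forall>i<k. smooth_fun_on M (U \<inter> W) (c i)"
      "\<forall>p\<in>U \<inter> W. s p = (\<Sum>i<k. c i p *\<^sub>R e i p)"
    using section_coefs[OF assms(2,4)] .
  show ?thesis
  proof (rule smooth_fun_on_cong)
    show "open (U \<inter> W)" using vector_bundle_frame(1)[OF assms(1,4)] assms(3) by blast
    show "smooth_fun_on M (U \<inter> W) (c i)" using c(1) assms(5) by simp
    show "c i p = frame_coef k (\<lambda>i. e i p) (s p) i" if p: "p \<in> U \<inter> W" for p
    proof -
      have "(\<Sum>i<k. c i p *\<^sub>R e i p) = s p" using c(2) p by simp
      then show ?thesis
        using frame_coef_unique[OF vector_bundle_frame(2)[OF assms(1,4)] _ section_mem[OF assms(2)] assms(5)] p
        by simp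
    qed
  qed
qed

lemma section_subset:
  assumes "smooth_section_on M E W s" "W' \<subseteq> W"
  shows "smooth_section_on M E W' s"
proof (rule smooth_section_onI)
  show "s p \<in> fib E p" if "p \<in> W'" for p
    using section_mem[OF assms(1)] that assms(2) by blast
next
  fix U k e assume f: "(U, k, e) \<in> frames E"
  obtain c where c: "\<forall>i<k. smooth_fun_on M (U \<inter> W) (c i)"
      "\<forall>p\<in>U \<inter> W. s p = (\<Sum>i<k. c i p *\<^sub>R e i p)"
    using section_coefs[OF assms(1) f] .
  have "smooth_fun_on M (U \<inter> W') (c i)" if "i < k" for i
    by (rule smooth_fun_on_subset[OF c(1)[rule_format, OF that]]) (use assms(2) in blast)
  moreover have "\<forall>p\<in>U \<inter> W'. s p = (\<Sum>i<k. c i p *\<^sub>R e i p)" using c(2) assms(2) by blast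
  ultimately show "\<exists>c. (\<forall>i<k. smooth_fun_on M (U \<inter> W') (c i)) \<and>
      (\<forall>p\<in>U \<inter> W'. s p = (\<Sum>i<k. c i p *\<^sub>R e i p))"
    by (intro exI[of _ c]) simp
qed

lemma section_cong:
  assumes "smooth_section_on M E W s" "\<And>p. p \<in> W \<Longrightarrow> s p = t p"
  shows "smooth_section_on M E W t"
proof (rule smooth_section_onI)
  show "t p \<in> fib E p" if "p \<in> W" for p
    using section_mem[OF assms(1) that] assms(2)[OF that] by simp
next
  fix U k e assume f: "(U, k, e) \<in> frames E"
  obtain c where c: "\<forall>i<k. smooth_fun_on M (U \<inter> W) (c i)"
      "\<forall>p\<in>U \<inter> W. s p = (\<Sum>i<k. c i p *\<^sub>R e i p)"
    using section_coefs[OF assms(1) f] .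
  then show "\<exists>c. (\<forall>i<k. smooth_fun_on M (U \<inter> W) (c i)) \<and>
      (\<forall>p\<in>U \<inter> W. t p = (\<Sum>i<k. c i p *\<^sub>R e i p))"
    using assms(2) by (intro exI[of _ c]) simp
qed

text \<open>Coefficients chosen on different neighbourhoods need not visibly fit together. The
  canonical \<open>frame_coef\<close> do, and for functions smoothness is local.\<close>

lemma section_local:
  assumes "vector_bundle M E"
    "\<And>p. p \<in> W \<Longrightarrow> \<exists>W'. open W' \<and> p \<in> W' \<and> smooth_section_on M E W' s"
  shows "smooth_section_on M E W s"
proof (rule smooth_sectionI[OF assms(1)])
  fix p assume "p \<in> W"
  from assms(2)[OF this] obtain W' where "p \<in> W'" "smooth_section_on M E W' s" by (elim exE conjE)
  then show "s p \<in> fib E p" by (rule section_mem[rotated])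
next
  fix U k e i assume f: "(U, k, e) \<in> frames E" "i < (k::nat)"
  show "smooth_fun_on M (U \<inter> W) (\<lambda>p. frame_coef k (\<lambda>i. e i p) (s p) i)"
  proof (rule smooth_fun_on_local)
    fix p assume p: "p \<in> U \<inter> W"
    then obtain W' where W': "open W'" "p \<in> W'" "smooth_section_on M E W' s" using assms(2) by blast
    have "smooth_fun_on M (U \<inter> W') (\<lambda>p. frame_coef k (\<lambda>i. e i p) (s p) i)"
      by (rule smooth_sectionD[OF assms(1) W'(3,1) f])
    moreover have "open (U \<inter> W')" using W'(1) vector_bundle_frame(1)[OF assms(1) f(1)] by blast
    ultimately show "\<exists>V. open V \<and> p \<in> V \<and> smooth_fun_on M V (\<lambda>p. frame_coef k (\<lambda>i. e i p) (s p) i)"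
      using p W'(2) by blast
  qed
qed

lemma section_add:
  assumes "vector_bundle M E" "open W" "smooth_section_on M E W s" "smooth_section_on M E W t"
  shows "smooth_section_on M E W (\<lambda>p. s p + t p)"
proof (rule smooth_sectionI[OF assms(1)])
  show "s p + t p \<in> fib E p" if "p \<in> W" for p
    using section_mem[OF assms(3) that] section_mem[OF assms(4) that]
      vector_bundle_subspace[OF assms(1)] by (simp add: subspace_add)
next
  fix U k e i assume f: "(U, k, e) \<in> frames E" "i < (k::nat)"
  have o: "open (U \<inter> W)" using vector_bundle_frame(1)[OF assms(1) f(1)] assms(2) by blast
  show "smooth_fun_on M (U \<inter> W) (\<lambda>p. frame_coef k (\<lambda>i. e i p) (s p + t p) i)"
    by (rule smooth_fun_on_cong[OF o smooth_fun_on_add[OF o smooth_sectionD[OF assms(1,3,2) f]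
            smooth_sectionD[OF assms(1,4,2) f]]])
      (use frame_coef_add[OF vector_bundle_frame(2)[OF assms(1) f(1)]] f(2)
        section_mem[OF assms(3)] section_mem[OF assms(4)] in auto)
qed

lemma section_scale:
  assumes "vector_bundle M E" "open W" "smooth_fun_on M W f" "smooth_section_on M E W s"
  shows "smooth_section_on M E W (\<lambda>p. f p *\<^sub>R s p)"
proof (rule smooth_sectionI[OF assms(1)])
  show "f p *\<^sub>R s p \<in> fib E p" if "p \<in> W" for p
    using section_mem[OF assms(4) that] vector_bundle_subspace[OF assms(1)] by (simp add: subspace_scale)
next
  fix U k e i assume fr: "(U, k, e) \<in> frames E" "i < (k::nat)"
  have o: "open (U \<inter> W)" using vector_bundle_frame(1)[OF assms(1) fr(1)] assms(2) by blast
  show "smooth_fun_on M (U \<inter> W) (\<lambda>p. frame_coef k (\<lambda>i. e i p) (f p *\<^sub>R s p) i)"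
    by (rule smooth_fun_on_cong[OF o smooth_fun_on_mult[OF o smooth_fun_on_subset[OF assms(3)]
          smooth_sectionD[OF assms(1,4,2) fr]]])
      (use frame_coef_scale[OF vector_bundle_frame(2)[OF assms(1) fr(1)]] fr(2)
        section_mem[OF assms(4)] in auto)
qed

lemma section_zero:
  assumes "vector_bundle M E"
  shows "smooth_section_on M E W (\<lambda>p. 0)"
proof (rule smooth_section_onI)
  show "0 \<in> fib E p" for p using subspace_0[OF vector_bundle_subspace[OF assms]] .
next
  fix U k e assume "(U, k, e) \<in> frames E"
  show "\<exists>c. (\<forall>i<k. smooth_fun_on M (U \<inter> W) (c i)) \<and> (\<forall>p\<in>U \<inter> W. 0 = (\<Sum>i<k. c i p *\<^sub>R e i p))"
    by (intro exI[of _ "\<lambda>i p. 0"]) (simp add: smooth_fun_on_const)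
qed

lemma section_lincomb:
  assumes "vector_bundle M E" "open W"
  shows "(\<And>i. i \<in> I \<Longrightarrow> smooth_fun_on M W (c i)) \<Longrightarrow> (\<And>i. i \<in> I \<Longrightarrow> smooth_section_on M E W (t i)) \<Longrightarrow>
    smooth_section_on M E W (\<lambda>p. \<Sum>i\<in>I. c i p *\<^sub>R t i p)"
proof (induction I rule: infinite_finite_induct)
  case (insert i I)
  have "smooth_section_on M E W (\<lambda>p. c i p *\<^sub>R t i p + (\<Sum>i\<in>I. c i p *\<^sub>R t i p))"
    by (intro section_add[OF assms] section_scale[OF assms] insert.IH insert.prems) auto
  then show ?case using insert.hyps by simp
qed (simp_all add: section_zero[OF assms(1)])

lemma section_diff:
  assumes "vector_bundle M E" "open W" "smooth_section_on M E W s" "smooth_section_on M E W t"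
  shows "smooth_section_on M E W (\<lambda>p. s p - t p)"
  using section_add[OF assms(1,2,3) section_scale[OF assms(1,2) smooth_fun_on_const[of _ "-1"] assms(4)]]
  by simp

text \<open>In a local frame the function is a double sum of coordinates times entries of the Gram
  matrix, and these entries are smooth by definition of a bundle metric.\<close>

lemma metric_smooth:
  assumes "vector_bundle M E" "bundle_metric M E g" "open W"
    "smooth_section_on M E W s" "smooth_section_on M E W t"
  shows "smooth_fun_on M W (\<lambda>p. g p (s p) (t p))"
proof (rule smooth_fun_on_local)
  fix p assume p: "p \<in> W"
  obtain U k e where f: "(U, k, e) \<in> frames E" "p \<in> U" using vector_bundle_frame_at[OF assms(1)] .
  have o: "open (U \<inter> W)" using vector_bundle_frame(1)[OF assms(1) f(1)] assms(3) by blast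
  define c where "c i q = frame_coef k (\<lambda>i. e i q) (s q) i" for i q
  define d where "d i q = frame_coef k (\<lambda>i. e i q) (t q) i" for i q
  have "smooth_fun_on M (U \<inter> W) (\<lambda>q. \<Sum>i<k. c i q * (\<Sum>j<k. d j q * g q (e i q) (e j q)))"
  proof (rule smooth_fun_on_sum[OF o], rule smooth_fun_on_mult[OF o _ smooth_fun_on_sum[OF o]],
      goal_cases)
    case (1 i)
    then show ?case unfolding c_def using smooth_sectionD[OF assms(1,4,3) f(1)] by simp
  next
    case (2 i j)
    have "smooth_fun_on M U (\<lambda>q. g q (e i q) (e j q))"
      using assms(2) f(1) 2 unfolding bundle_metric_def by fast
    then show ?case unfolding d_def
      using smooth_sectionD[OF assms(1,5,3) f(1)] 2 smooth_fun_on_subset[of U]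
      by (intro smooth_fun_on_mult[OF o]) auto
  qed
  then have "smooth_fun_on M (U \<inter> W) (\<lambda>p. g p (s p) (t p))"
  proof (rule smooth_fun_on_cong[OF o])
    fix q assume q: "q \<in> U \<inter> W"
    interpret inner_fibre "fib E q" "g q" by (rule inner_fibre_bundle[OF assms(1,2)])
    have b: "basis_family k (\<lambda>i. e i q) (fib E q)" using vector_bundle_frame(2)[OF assms(1) f(1)] q by blast
    have s: "s q = (\<Sum>i<k. c i q *\<^sub>R e i q)" and t: "t q = (\<Sum>i<k. d i q *\<^sub>R e i q)"
      unfolding c_def d_def using frame_coef_expand[OF b] section_mem[OF assms(4)] section_mem[OF assms(5)] q
      by auto
    have m: "e i q \<in> fib E q" if "i < k" for i using basis_family_mem[OF b that] .
    have tm: "t q \<in> fib E q" using section_mem[OF assms(5)] q by blast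
    have "g q (s q) (t q) = (\<Sum>i<k. c i q * g q (e i q) (t q))"
      unfolding s by (rule lincomb_left) (use m tm in auto)
    also have "\<dots> = (\<Sum>i<k. c i q * (\<Sum>j<k. d j q * g q (e i q) (e j q)))"
      unfolding t by (intro sum.cong arg_cong[of _ _ "(*) _"] lincomb_right) (use m in auto)
    finally show "(\<Sum>i<k. c i q * (\<Sum>j<k. d j q * g q (e i q) (e j q))) = g q (s q) (t q)" by simp
  qed
  then show "\<exists>W'. open W' \<and> p \<in> W' \<and> smooth_fun_on M W' (\<lambda>p. g p (s p) (t p))" using o f(2) p by blast
qed

lemma bundle_map_section:
  assumes "vector_bundle M E" "vector_bundle M F" "bundle_map M E F \<Phi>" "open W"
    "smooth_section_on M E W s"
  shows "smooth_section_on M F W (\<lambda>p. \<Phi> p (s p))"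
proof (rule section_local[OF assms(2)])
  fix p assume p: "p \<in> W"
  obtain U k e where f: "(U, k, e) \<in> frames E" "p \<in> U" using vector_bundle_frame_at[OF assms(1)] .
  have o: "open (U \<inter> W)" using vector_bundle_frame(1)[OF assms(1) f(1)] assms(4) by blast
  have "smooth_section_on M F (U \<inter> W)
    (\<lambda>q. \<Sum>i<k. frame_coef k (\<lambda>i. e i q) (s q) i *\<^sub>R \<Phi> q (e i q))"
  proof (rule section_lincomb[OF assms(2) o], goal_cases)
    case (1 i)
    then show ?case using smooth_sectionD[OF assms(1,5,4) f(1)] by simp
  next
    case (2 i)
    then show ?case using section_subset[OF bundle_mapD(4)[OF assms(3) f(1)]] by simp
  qed
  then have "smooth_section_on M F (U \<inter> W) (\<lambda>p. \<Phi> p (s p))"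
  proof (rule section_cong)
    fix q assume q: "q \<in> U \<inter> W"
    have b: "basis_family k (\<lambda>i. e i q) (fib E q)" using vector_bundle_frame(2)[OF assms(1) f(1)] q by blast
    have "\<Phi> q (\<Sum>i<k. frame_coef k (\<lambda>i. e i q) (s q) i *\<^sub>R e i q)
      = (\<Sum>i<k. frame_coef k (\<lambda>i. e i q) (s q) i *\<^sub>R \<Phi> q (e i q))"
      by (rule bundle_map_lincomb[OF assms(1,3)]) (use basis_family_mem[OF b] in auto)
    then show "(\<Sum>i<k. frame_coef k (\<lambda>i. e i q) (s q) i *\<^sub>R \<Phi> q (e i q)) = \<Phi> q (s q)"
      using frame_coef_expand[OF b] section_mem[OF assms(5)] q by simp
  qed
  then show "\<exists>W'. open W' \<and> p \<in> W' \<and> smooth_section_on M F W' (\<lambda>p. \<Phi> p (s p))" using o f(2) p by blast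
qed

section \<open>Extension to global sections\<close>

text \<open>The section is multiplied by a cut-off function and continued by 0; \<open>W\<close> and
  the complement of \<open>C\<close> are open, cover everything, and the result is smooth on each.
  Agreement with \<open>s\<close> survives only near \<open>p\<close>.\<close>

lemma section_extend:
  assumes "vector_bundle M E" "open W" "p \<in> W" "smooth_section_on M E W s"
  obtains X V where "X \<in> sections M E" "open V" "p \<in> V" "V \<subseteq> W" "\<forall>q\<in>V. X q = s q"
proof -
  obtain f V C where f: "f \<in> Cinf M" "open V" "p \<in> V" "V \<subseteq> W" "\<forall>q\<in>V. f q = 1"
    "closed C" "C \<subseteq> W" "\<forall>q. q \<notin> C \<longrightarrow> f q = 0"
    using manifold_bump[OF assms(2,3)] .
  define X where "X q = (if q \<in> W then f q *\<^sub>R s q else 0)" for q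
  have "smooth_section_on M E UNIV X"
  proof (rule section_local[OF assms(1)])
    fix q
    have "smooth_fun_on M W f" using f(1) smooth_fun_on_subset unfolding Cinf_def by blast
    then have 1: "smooth_section_on M E W X"
      by (rule section_cong[OF section_scale[OF assms(1,2) _ assms(4)]]) (simp add: X_def)
    have 2: "smooth_section_on M E (- C) X"
      by (rule section_cong[OF section_zero[OF assms(1)]]) (use f(8) in \<open>simp add: X_def\<close>)
    show "\<exists>W'. open W' \<and> q \<in> W' \<and> smooth_section_on M E W' X"
      using 1 2 assms(2) f(6,7) by (cases "q \<in> W") auto
  qed
  then have "X \<in> sections M E" by (simp add: sections_def)
  moreover have "\<forall>q\<in>V. X q = s q" using f(4,5) by (auto simp: X_def)
  ultimately show thesis using that f(2,3,4) by blast
qed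

text \<open>Keep the coordinates of \<open>a\<close> constant in a local frame.\<close>

lemma section_through:
  assumes "vector_bundle M E" "a \<in> fib E p"
  obtains W s where "open W" "p \<in> W" "smooth_section_on M E W s" "s p = a"
proof -
  obtain U k e where f: "(U, k, e) \<in> frames E" "p \<in> U" using vector_bundle_frame_at[OF assms(1)] .
  note fr = vector_bundle_frame[OF assms(1) f(1)]
  have "smooth_section_on M E U (\<lambda>q. \<Sum>i<k. frame_coef k (\<lambda>i. e i p) a i *\<^sub>R e i q)"
    by (rule section_lincomb[OF assms(1) fr(1)]) (use fr(3) in \<open>auto simp: smooth_fun_on_const\<close>)
  then show thesis using that fr(1) f(2) frame_coef_expand[OF fr(2)[OF f(2)] assms(2)] by blast
qed

lemma global_section_through:
  assumes "vector_bundle M E" "a \<in> fib E p"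
  obtains X where "X \<in> sections M E" "X p = a"
proof -
  obtain W s where s: "open W" "p \<in> W" "smooth_section_on M E W s" "s p = a"
    using section_through[OF assms] .
  obtain X V where X: "X \<in> sections M E" "open V" "p \<in> V" "V \<subseteq> W" "\<forall>q\<in>V. X q = s q"
    using section_extend[OF assms(1) s(1,2,3)] .
  have "X p = a" using X(3,5) s(4) by simp
  with X(1) show thesis by (rule that)
qed

section \<open>Gram-Schmidt for smooth sections\<close>

text \<open>Independence is assumed at \<open>p\<close> alone; the neighbourhood comes from
  continuity of the squared lengths. The functions \<open>b\<close> express the new family in the
  old one. The last clause is the converse direction in dual form: orthogonality to the
  \<open>w i\<close> gives orthogonality to the \<open>t i\<close>, without a formula for the
  inverse of \<open>b\<close>.\<close>

lemma gram_schmidt_exists: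
  fixes k :: nat
  assumes "vector_bundle M E" "bundle_metric M E g" "open W" "p \<in> W"
    "\<And>i. i < k \<Longrightarrow> smooth_section_on M E W (t i)"
    "\<And>x. (\<Sum>i<k. x i *\<^sub>R t i p) = 0 \<Longrightarrow> \<forall>i<k. x i = (0::real)"
  shows "\<exists>V w b. open V \<and> p \<in> V \<and> V \<subseteq> W \<and> (\<forall>i<k. smooth_section_on M E V (w i)) \<and>
    (\<forall>i<k. \<forall>j<k. smooth_fun_on M V (b i j)) \<and>
    (\<forall>q\<in>V. (\<forall>i<k. w i q = (\<Sum>j<k. b i j q *\<^sub>R t j q)) \<and> (\<forall>i<k. w i q \<noteq> 0) \<and>
      (\<forall>i<k. \<forall>j<k. i \<noteq> j \<longrightarrow> g q (w i q) (w j q) = 0) \<and>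
      (\<forall>a\<in>fib E q. (\<forall>i<k. g q a (w i q) = 0) \<longrightarrow> (\<forall>i<k. g q a (t i q) = 0)))"
  using assms(5,6)
proof (induction k)
  case 0
  then show ?case using assms(3,4) by auto
next
  case (Suc k)
  have "\<exists>V w b. open V \<and> p \<in> V \<and> V \<subseteq> W \<and> (\<forall>i<k. smooth_section_on M E V (w i)) \<and>
    (\<forall>i<k. \<forall>j<k. smooth_fun_on M V (b i j)) \<and>
    (\<forall>q\<in>V. (\<forall>i<k. w i q = (\<Sum>j<k. b i j q *\<^sub>R t j q)) \<and> (\<forall>i<k. w i q \<noteq> 0) \<and>
      (\<forall>i<k. \<forall>j<k. i \<noteq> j \<longrightarrow> g q (w i q) (w j q) = 0) \<and>
      (\<forall>a\<in>fib E q. (\<forall>i<k. g q a (w i q) = 0) \<longrightarrow> (\<forall>i<k. g q a (t i q) = 0)))"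
  proof (rule Suc.IH)
    fix x assume "(\<Sum>i<k. x i *\<^sub>R t i p) = 0"
    \<comment> \<open>A relation among the first \<open>k\<close> sections is padded with a zero
      coefficient to fit the hypothesis on \<open>Suc k\<close> sections.\<close>
    moreover have "(\<Sum>i<k. (x(k := 0)) i *\<^sub>R t i p) = (\<Sum>i<k. x i *\<^sub>R t i p)"
      by (intro sum.cong) auto
    ultimately have "\<forall>i<Suc k. (x(k := 0)) i = 0" by (intro Suc.prems(2)) simp
    then show "\<forall>i<k. x i = 0" by (metis fun_upd_apply less_SucI less_irrefl)
  qed (use Suc.prems(1) in simp)
  then obtain V w b where V: "open V" "p \<in> V" "V \<subseteq> W"
    and w': "\<forall>i<k. smooth_section_on M E V (w i)"
    and b': "\<forall>i<k. \<forall>j<k. smooth_fun_on M V (b i j)"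
    and *: "\<forall>q\<in>V. (\<forall>i<k. w i q = (\<Sum>j<k. b i j q *\<^sub>R t j q)) \<and> (\<forall>i<k. w i q \<noteq> 0) \<and>
      (\<forall>i<k. \<forall>j<k. i \<noteq> j \<longrightarrow> g q (w i q) (w j q) = 0) \<and>
      (\<forall>a\<in>fib E q. (\<forall>i<k. g q a (w i q) = 0) \<longrightarrow> (\<forall>i<k. g q a (t i q) = 0))"
    by (elim exE conjE)
  note w = w'[rule_format] and b = b'[rule_format]
  have wb: "w i q = (\<Sum>j<k. b i j q *\<^sub>R t j q)" and w0: "w i q \<noteq> 0" if "q \<in> V" "i < k" for q i
    using bspec[OF * that(1)] that(2) by blast+
  have orth: "g q (w i q) (w j q) = 0" if "q \<in> V" "i < k" "j < k" "i \<noteq> j" for q i j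
    using bspec[OF * that(1)] that(2-) by blast
  have perp: "g q a (t i q) = 0" if "q \<in> V" "a \<in> fib E q" "\<forall>i<k. g q a (w i q) = 0" "i < k" for q a i
    using bspec[OF * that(1)] that(2-) by blast
  have t: "smooth_section_on M E V (t i)" if "i < Suc k" for i
    using section_subset[OF Suc.prems(1)[OF that] V(3)] .
  define c where "c j q = g q (t k q) (w j q) / g q (w j q) (w j q)" for j q
  define u where "u q = t k q - (\<Sum>j<k. c j q *\<^sub>R w j q)" for q
  have c: "smooth_fun_on M V (c j)" if "j < k" for j
    unfolding c_def
  proof (rule smooth_fun_on_divide[OF V(1)])
    show "smooth_fun_on M V (\<lambda>q. g q (t k q) (w j q))" "smooth_fun_on M V (\<lambda>q. g q (w j q) (w j q))"
      by (intro metric_smooth[OF assms(1,2) V(1)] w t that lessI)+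
    fix q assume q: "q \<in> V"
    interpret inner_fibre "fib E q" "g q" by (rule inner_fibre_bundle[OF assms(1,2)])
    show "g q (w j q) (w j q) \<noteq> 0" using eq_zero[OF section_mem[OF w[OF that] q]] w0[OF q that] by blast
  qed
  have u: "smooth_section_on M E V u"
    unfolding u_def by (intro section_diff[OF assms(1) V(1)] section_lincomb[OF assms(1) V(1)])
      (use c w t in auto)
  \<comment> \<open>The coefficients of \<open>u\<close> in terms of the \<open>t i\<close>, found
    by inserting the expansions of the \<open>w j\<close>. Since these involve only earlier
    sections, \<open>t k\<close> keeps coefficient 1.\<close>
  define d where "d i q = (if i < k then - (\<Sum>j<k. c j q * b j i q) else 1)" for i q
  have d: "smooth_fun_on M V (d i)" for i
  proof (cases "i < k")
    case True
    have "smooth_fun_on M V (\<lambda>q. - (\<Sum>j<k. c j q * b j i q))"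
      by (intro smooth_fun_on_minus[OF V(1)] smooth_fun_on_sum[OF V(1)] smooth_fun_on_mult[OF V(1)])
        (use c b True in auto)
    then show ?thesis using True unfolding d_def by simp
  next
    case False
    then show ?thesis unfolding d_def by (simp add: smooth_fun_on_const)
  qed
  have ud: "u q = (\<Sum>i<Suc k. d i q *\<^sub>R t i q)" if q: "q \<in> V" for q
  proof -
    have "(\<Sum>j<k. c j q *\<^sub>R w j q) = (\<Sum>j<k. \<Sum>i<k. (c j q * b j i q) *\<^sub>R t i q)"
      using wb[OF q] by (simp add: scaleR_sum_right)
    also have "\<dots> = (\<Sum>i<k. (\<Sum>j<k. c j q * b j i q) *\<^sub>R t i q)"
      unfolding scaleR_sum_left by (rule sum.swap)
    finally have "u q = t k q + (\<Sum>i<k. (- (\<Sum>j<k. c j q * b j i q)) *\<^sub>R t i q)"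
      by (simp add: u_def sum_negf)
    also have "(\<Sum>i<k. (- (\<Sum>j<k. c j q * b j i q)) *\<^sub>R t i q) = (\<Sum>i<k. d i q *\<^sub>R t i q)"
      by (intro sum.cong) (auto simp: d_def)
    finally show ?thesis by (simp add: d_def)
  qed
  \<comment> \<open>If \<open>u\<close> vanished at \<open>p\<close>, its expansion would be a
    relation among the \<open>t i\<close> in which \<open>t k\<close> has coefficient 1.\<close>
  have "u p \<noteq> 0"
  proof
    assume "u p = 0"
    then have "(\<Sum>i<Suc k. d i p *\<^sub>R t i p) = 0" by (simp only: ud[OF V(2), symmetric])
    from Suc.prems(2)[OF this] have "d k p = 0" by blast
    then show False by (simp add: d_def)
  qed
  have n0: "g p (u p) (u p) \<noteq> 0"
  proof -
    interpret inner_fibre "fib E p" "g p" by (rule inner_fibre_bundle[OF assms(1,2)])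
    show ?thesis using eq_zero[OF section_mem[OF u V(2)]] \<open>u p \<noteq> 0\<close> by blast
  qed
  obtain V' where V': "open V'" "p \<in> V'" "V' \<subseteq> V" "\<forall>q\<in>V'. g q (u q) (u q) \<noteq> 0"
    using nonzero_nbhd[OF V(1) metric_smooth[OF assms(1,2) V(1) u u] V(2) n0] .
  define w' where "w' i = (if i < k then w i else u)" for i
  \<comment> \<open>Old rows get a zero in the new column \<open>k\<close>; the new row is
    \<open>d\<close>.\<close>
  define b' where "b' i j = (if i < k then if j < k then b i j else (\<lambda>_. 0) else d j)" for i j
  have 1: "smooth_section_on M E V' (w' i)" for i
    by (rule section_subset[OF _ V'(3)]) (use w u in \<open>simp add: w'_def\<close>)
  have 2: "smooth_fun_on M V' (b' i j)" for i j
    by (rule smooth_fun_on_subset[OF _ V'(3)]) (use b d in \<open>simp add: b'_def smooth_fun_on_const\<close>)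
  have 3: "(\<forall>i<Suc k. w' i q = (\<Sum>j<Suc k. b' i j q *\<^sub>R t j q)) \<and> (\<forall>i<Suc k. w' i q \<noteq> 0) \<and>
      (\<forall>i<Suc k. \<forall>j<Suc k. i \<noteq> j \<longrightarrow> g q (w' i q) (w' j q) = 0) \<and>
      (\<forall>a\<in>fib E q. (\<forall>i<Suc k. g q a (w' i q) = 0) \<longrightarrow> (\<forall>i<Suc k. g q a (t i q) = 0))"
    if q': "q \<in> V'" for q
  proof -
    have q: "q \<in> V" using q' V'(3) by blast
    interpret inner_fibre "fib E q" "g q" by (rule inner_fibre_bundle[OF assms(1,2)])
    have wm: "w i q \<in> fib E q" if "i < k" for i using section_mem[OF w[OF that] q] .
    have um: "u q \<in> fib E q" using section_mem[OF u q] .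
    have tm: "t k q \<in> fib E q" using section_mem[OF t q] by simp
    have u_proj: "u q = t k q - proj k (\<lambda>i. w i q) (t k q)" by (simp add: u_def c_def proj_def)
    have uw: "g q (u q) (w j q) = 0" if "j < k" for j
      unfolding u_proj by (rule proj_orthogonal) (use wm w0[OF q] orth[OF q] tm that in auto)
    have A: "w' i q = (\<Sum>j<Suc k. b' i j q *\<^sub>R t j q)" for i
    proof (cases "i < k")
      case True
      have "(\<Sum>j<k. b' i j q *\<^sub>R t j q) = (\<Sum>j<k. b i j q *\<^sub>R t j q)"
        using True by (intro sum.cong) (auto simp: b'_def)
      then show ?thesis using True wb[OF q True] by (simp add: w'_def b'_def)
    next
      case False
      then show ?thesis using ud[OF q] by (simp add: w'_def b'_def)
    qed
    have "u q \<noteq> 0" using bspec[OF V'(4) q'] zero_left zero_mem by fastforce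
    then have B: "w' i q \<noteq> 0" if "i < Suc k" for i using w0[OF q] by (simp add: w'_def)
    have C: "g q (w' i q) (w' j q) = 0" if "i < Suc k" "j < Suc k" "i \<noteq> j" for i j
      using that orth[OF q] uw sym[OF wm um] by (auto simp: w'_def)
    have D: "g q a (t i q) = 0" if a: "a \<in> fib E q" "\<forall>i<Suc k. g q a (w' i q) = 0" "i < Suc k" for a i
    proof (cases "i < k")
      case True
      have "g q a (w j q) = 0" if "j < k" for j
        using a(2)[rule_format, of j] that by (simp add: w'_def)
      then show ?thesis using perp[OF q a(1)] True by blast
    next
      case False
      \<comment> \<open>\<open>t k\<close> is \<open>u\<close> plus a combination of the earlier
        \<open>w j\<close>, and \<open>a\<close> is orthogonal to all of these.\<close>
      then have "i = k" using a(3) by simp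
      have aw: "g q a (w i q) = 0" if "i < k" for i
        using a(2)[rule_format, of i] that by (simp add: w'_def)
      have "g q a (\<Sum>j<k. c j q *\<^sub>R w j q) = (\<Sum>j<k. c j q * g q a (w j q))"
        by (rule lincomb_right) (use wm a in auto)
      also have "\<dots> = 0" using aw by simp
      finally have 0: "g q a (\<Sum>j<k. c j q *\<^sub>R w j q) = 0" .
      have "g q a (u q) = 0" using a(2)[rule_format, of k] by (simp add: w'_def)
      moreover have "(\<Sum>j<k. c j q *\<^sub>R w j q) \<in> fib E q" using wm by (intro sum_mem scale_mem) auto
      then have "g q a (u q) = g q a (t k q) - g q a (\<Sum>j<k. c j q *\<^sub>R w j q)"
        unfolding u_def using diff_right tm a(1) by blast
      ultimately show ?thesis using 0 \<open>i = k\<close> by simp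
    qed
    show ?thesis using A B C D by blast
  qed
  show ?case
  proof (intro exI conjI)
    show "open V'" "p \<in> V'" "V' \<subseteq> W" using V' V(3) by auto
    show "\<forall>i<Suc k. smooth_section_on M E V' (w' i)" using 1 by simp
    show "\<forall>i<Suc k. \<forall>j<Suc k. smooth_fun_on M V' (b' i j)" using 2 by simp
  qed (rule ballI, erule 3)
qed

end

section \<open>The tangent bundle\<close>

lemma act_functional:
  "act 0 f = 0" "act (X + Y) f = act X f + act Y f" "act (r *\<^sub>R X) f = r * act X f"
  by (simp_all add: zero_functional_def plus_functional_def scaleR_functional_def Functional_inverse)

lemma functional_eqI: "(\<And>f. act X f = act Y f) \<Longrightarrow> X = Y"
  by (simp add: act_inject[symmetric] ext)

lemma act_coord_vector:
  "act (coord_vector M (U, \<phi>) v p) f =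
    (if f \<in> Cinf M then frechet_derivative (\<lambda>x. f (inv_into U \<phi> x)) (at (\<phi> p)) v else 0)"
  by (simp add: coord_vector_def Functional_inverse o_def)

lemma TB_simps:
  "fib (TB M) = (\<lambda>p. {coord_vector M c v p | c v. c \<in> M \<and> p \<in> fst c})"
  "frames (TB M) = {(fst c, k, \<lambda>i. coord_vector M c (u i)) | c k u. c \<in> M \<and> basis_family k u UNIV}"
  "anchor (TB M) = (\<lambda>p S. S)" "brkt (TB M) = vf_bracket"
  by (simp_all add: TB_def)

lemma basis_family_image:
  assumes "basis_family k u UNIV" "linear L" "inj L"
  shows "basis_family k (\<lambda>i. L (u i)) (range L)"
proof -
  have u: "inj_on u {..<k}" "independent (u ` {..<k})" "span (u ` {..<k}) = UNIV"
    using assms(1) by (auto simp: basis_family_def)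
  have "inj_on (\<lambda>i. L (u i)) {..<k}"
    using u(1) assms(3) by (auto simp: inj_on_def)
  moreover have "independent (L ` u ` {..<k})"
    using linear_independent_injective_image[OF assms(2) u(2)] assms(3) by (simp add: inj_on_subset)
  moreover have "span (L ` u ` {..<k}) = range L"
    using linear_span_image[OF assms(2)] u(3) by simp
  ultimately show ?thesis by (simp add: basis_family_def image_image)
qed

lemma finite_independent_family:
  assumes "finite B" "independent (B :: 'v::real_vector set)"
  obtains k u where "u ` {..<k::nat} = B" "basis_family k u (span B)"
proof -
  obtain u where "bij_betw u {0..<card B} B" using ex_bij_betw_nat_finite[OF assms(1)] by blast
  then have u: "inj_on u {..<card B}" "u ` {..<card B} = B"
    by (auto simp: bij_betw_def atLeast0LessThan)
  then show thesis using that[of u "card B"] assms(2) by (simp add: basis_family_def)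
qed

lemma basis_family_exists:
  assumes "subspace (F :: 'v::real_vector set)" "finite C" "F \<subseteq> span C"
  obtains k u where "basis_family k u F"
proof -
  obtain B where B: "B \<subseteq> F" "independent B" "F \<subseteq> span B"
    using maximal_independent_subset by blast
  have "finite B" using independent_span_bound[OF assms(2) B(2)] B(1) assms(3) by blast
  moreover have "span B = F" using B assms(1) by (metis span_minimal subset_antisym)
  ultimately show thesis using finite_independent_family[OF _ B(2)] that by metis
qed

section \<open>Charts and tangent vectors\<close>

context manifold
begin

lemma Cinf_smooth:
  assumes "f \<in> Cinf M" "(U, \<phi>) \<in> M"
  shows "smooth_on (\<phi> ` U) (\<lambda>x. f (inv_into U \<phi> x))"
  using smooth_fun_onD[of UNIV f, OF _ assms(2)] assms(1) by (simp add: Cinf_def)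

lemma Cinf_has_derivative:
  assumes "f \<in> Cinf M" "(U, \<phi>) \<in> M" "p \<in> U"
  shows "((\<lambda>x. f (inv_into U \<phi> x)) has_derivative
    frechet_derivative (\<lambda>x. f (inv_into U \<phi> x)) (at (\<phi> p))) (at (\<phi> p))"
  by (rule smooth_on_has_derivative[OF Cinf_smooth[OF assms(1,2)]]) (use assms(3) in simp)

text \<open>Tangent vectors act nontrivially only on globally smooth functions, so local test
  functions such as coordinates must first be made global.\<close>

lemma smooth_fun_extend:
  assumes "open W" "p \<in> W" "smooth_fun_on M W h"
  obtains f V where "f \<in> Cinf M" "open V" "p \<in> V" "V \<subseteq> W" "\<forall>q\<in>V. f q = h q"
proof -
  obtain f V C where f: "f \<in> Cinf M" "open V" "p \<in> V" "V \<subseteq> W" "\<forall>q\<in>V. f q = 1"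
    "closed C" "C \<subseteq> W" "\<forall>q. q \<notin> C \<longrightarrow> f q = 0"
    using manifold_bump[OF assms(1,2)] .
  define X where "X q = (if q \<in> W then f q * h q else 0)" for q
  have "smooth_fun_on M UNIV X"
  proof (rule smooth_fun_on_local)
    fix q
    have "smooth_fun_on M UNIV f" using f(1) by (simp add: Cinf_def)
    then have "smooth_fun_on M W f" by (rule smooth_fun_on_subset) simp
    then have 1: "smooth_fun_on M W X"
      by (rule smooth_fun_on_cong[OF assms(1) smooth_fun_on_mult[OF assms(1) _ assms(3)]]) (simp add: X_def)
    have 2: "smooth_fun_on M (- C) X"
      by (rule smooth_fun_on_cong[OF _ smooth_fun_on_const[of _ 0]]) (use f(6,8) in \<open>auto simp: X_def\<close>)
    show "\<exists>W'. open W' \<and> q \<in> W' \<and> smooth_fun_on M W' X"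
    proof (cases "q \<in> W")
      case True
      then show ?thesis using 1 assms(1) by blast
    next
      case False
      then show ?thesis using 2 f(6,7) by (intro exI[of _ "- C"]) auto
    qed
  qed
  then have "X \<in> Cinf M" by (simp add: Cinf_def)
  moreover have "\<forall>q\<in>V. X q = h q" using f(4,5) by (auto simp: X_def)
  ultimately show thesis using that f(2,3,4) by blast
qed

lemma coord_vector_linear:
  assumes "(U, \<phi>) \<in> M" "p \<in> U"
  shows "linear (\<lambda>v. coord_vector M (U, \<phi>) v p)"
proof (rule linearI)
  have lin: "linear (frechet_derivative (\<lambda>x. f (inv_into U \<phi> x)) (at (\<phi> p)))" if "f \<in> Cinf M" for f
    by (rule has_derivative_linear[OF Cinf_has_derivative[OF that assms]])
  show "coord_vector M (U, \<phi>) (v + w) p = coord_vector M (U, \<phi>) v p + coord_vector M (U, \<phi>) w p" for v w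
    by (rule functional_eqI) (simp add: act_coord_vector act_functional linear_add[OF lin])
  show "coord_vector M (U, \<phi>) (r *\<^sub>R v) p = r *\<^sub>R coord_vector M (U, \<phi>) v p" for r v
    by (rule functional_eqI) (simp add: act_coord_vector act_functional linear_scale[OF lin])
qed

text \<open>The chain rule for the transition map. On functions outside \<open>Cinf M\<close> both
  sides give 0 by convention.\<close>

lemma coord_vector_change:
  assumes "(U, \<phi>) \<in> M" "(V, \<psi>) \<in> M" "p \<in> U" "p \<in> V"
  shows "coord_vector M (V, \<psi>) v p =
    coord_vector M (U, \<phi>) (frechet_derivative (\<lambda>x. \<phi> (inv_into V \<psi> x)) (at (\<psi> p)) v) p"
proof (rule functional_eqI)
  fix f
  let ?\<tau> = "\<lambda>x. \<phi> (inv_into V \<psi> x)"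
  show "act (coord_vector M (V, \<psi>) v p) f =
    act (coord_vector M (U, \<phi>) (frechet_derivative ?\<tau> (at (\<psi> p)) v) p) f"
  proof (cases "f \<in> Cinf M")
    case True
    have \<tau>p: "?\<tau> (\<psi> p) = \<phi> p" using chart_inv[OF assms(2,4)] by simp
    have "(?\<tau> has_derivative frechet_derivative ?\<tau> (at (\<psi> p))) (at (\<psi> p))"
      by (rule smooth_on_has_derivative[OF transition[OF assms(2,1)]]) (use assms(3,4) in simp)
    from diff_chain_at[OF this] Cinf_has_derivative[OF True assms(1,3)]
    have "((\<lambda>x. f (inv_into U \<phi> (?\<tau> x))) has_derivative
      (\<lambda>v. frechet_derivative (\<lambda>x. f (inv_into U \<phi> x)) (at (\<phi> p)) (frechet_derivative ?\<tau> (at (\<psi> p)) v)))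
      (at (\<psi> p))"
      unfolding \<tau>p o_def by blast
    then have "((\<lambda>x. f (inv_into V \<psi> x)) has_derivative
      (\<lambda>v. frechet_derivative (\<lambda>x. f (inv_into U \<phi> x)) (at (\<phi> p)) (frechet_derivative ?\<tau> (at (\<psi> p)) v)))
      (at (\<psi> p))"
    proof (rule has_derivative_transform_within_open)
      show "open (\<psi> ` (V \<inter> U))" by (rule open_chart_image[OF assms(2) chart(1)[OF assms(1)]])
      show "\<psi> p \<in> \<psi> ` (V \<inter> U)" using assms(3,4) by simp
      show "f (inv_into U \<phi> (?\<tau> x)) = f (inv_into V \<psi> x)" if "x \<in> \<psi> ` (V \<inter> U)" for x
        using that chart_inv[OF assms(1)] chart_inv[OF assms(2)] by auto
    qed
    from frechet_derivative_eq[OF this] show ?thesis using True by (simp add: act_coord_vector)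
  qed (simp add: act_coord_vector)
qed

text \<open>With \<open>b = v - w\<close>, the coordinate function given by inner product with
  \<open>b\<close> is extended to a global test function. Its derivatives along \<open>v\<close> and
  \<open>w\<close> are the inner products of these with \<open>b\<close>, and equality makes
  \<open>b\<close> orthogonal to itself.\<close>

lemma coord_vector_inj:
  assumes "(U, \<phi>) \<in> M" "p \<in> U"
  shows "inj (\<lambda>v. coord_vector M (U, \<phi>) v p)"
proof (rule injI)
  fix v w assume eq: "coord_vector M (U, \<phi>) v p = coord_vector M (U, \<phi>) w p"
  define b where "b = v - w"
  have "smooth_on (\<phi> ` (U \<inter> UNIV)) (\<lambda>x. x \<bullet> b)"
    by (rule smooth_on_linear[OF _ bounded_linear_inner_left smooth_on_id]) (simp_all add: chart(2)[OF assms(1)])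
  from smooth_fun_on_chart[OF assms(1) open_UNIV this]
  have sm: "smooth_fun_on M U (\<lambda>q. \<phi> q \<bullet> b)" by simp
  obtain f V where f: "f \<in> Cinf M" "open V" "p \<in> V" "V \<subseteq> U" "\<forall>q\<in>V. f q = \<phi> q \<bullet> b"
    using smooth_fun_extend[OF chart(1)[OF assms(1)] assms(2) sm] .
  have "((\<lambda>x. f (inv_into U \<phi> x)) has_derivative (\<lambda>v. v \<bullet> b)) (at (\<phi> p))"
  proof (rule has_derivative_transform_within_open)
    show "((\<lambda>x. x \<bullet> b) has_derivative (\<lambda>v. v \<bullet> b)) (at (\<phi> p))"
      by (rule bounded_linear_imp_has_derivative[OF bounded_linear_inner_left])
    show "open (\<phi> ` (U \<inter> V))" by (rule open_chart_image[OF assms(1) f(2)])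
    show "\<phi> p \<in> \<phi> ` (U \<inter> V)" using f(3) assms(2) by simp
    show "x \<bullet> b = f (inv_into U \<phi> x)" if "x \<in> \<phi> ` (U \<inter> V)" for x
      using that f(5) chart_inv[OF assms(1)] by auto
  qed
  from frechet_derivative_eq[OF this]
  have "act (coord_vector M (U, \<phi>) v p) f = v \<bullet> b" for v using f(1) by (simp add: act_coord_vector)
  then have "v \<bullet> b = w \<bullet> b" using eq by metis
  then have "b \<bullet> b = 0" by (simp add: b_def inner_diff_left)
  then show "v = w" by (simp add: b_def)
qed

lemma fib_TB:
  assumes "(U, \<phi>) \<in> M" "p \<in> U"
  shows "fib (TB M) p = range (\<lambda>v. coord_vector M (U, \<phi>) v p)"
proof (intro equalityI subsetI)
  fix S assume "S \<in> fib (TB M) p"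
  then obtain V \<psi> v where "(V, \<psi>) \<in> M" "p \<in> V" "S = coord_vector M (V, \<psi>) v p"
    by (auto simp: TB_simps)
  then show "S \<in> range (\<lambda>v. coord_vector M (U, \<phi>) v p)"
    using coord_vector_change[OF assms(1) _ assms(2)] by blast
next
  fix S assume "S \<in> range (\<lambda>v. coord_vector M (U, \<phi>) v p)"
  then obtain v where "S = coord_vector M (U, \<phi>) v p" by blast
  then show "S \<in> fib (TB M) p"
    using assms unfolding TB_simps mem_Collect_eq by (intro exI[of _ "(U, \<phi>)"] exI[of _ v]) simp
qed

lemma coord_frame:
  assumes "(U, \<phi>) \<in> M" "p \<in> U" "basis_family k u UNIV"
  shows "basis_family k (\<lambda>i. coord_vector M (U, \<phi>) (u i) p) (fib (TB M) p)"
  unfolding fib_TB[OF assms(1,2)]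
  by (rule basis_family_image[OF assms(3) coord_vector_linear[OF assms(1,2)] coord_vector_inj[OF assms(1,2)]])

lemma frame_coef_bounded_linear:
  assumes "basis_family k u (UNIV :: 'e set)" "i < k"
  shows "bounded_linear (\<lambda>x. frame_coef k u x i)"
proof -
  obtain B :: "'e set" where B: "orthonormal_basis B" using orthonormal_basis by blast
  have "linear (\<lambda>x. frame_coef k u x i)"
    by (rule linearI) (simp_all add: frame_coef_add[OF assms(1) _ _ assms(2)]
        frame_coef_scale[OF assms(1) _ assms(2)])
  then show ?thesis by (rule linear_finite_dim(2)[OF B])
qed

text \<open>A coordinate field of one chart has, in the frame of another, the coordinates of the
  derivative of the transition map in a fixed direction; these are smooth because the transition map
  is.\<close>

lemma vector_bundle_TB: "vector_bundle M (TB M)"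
  unfolding vector_bundle_def
proof (intro conjI allI ballI)
  fix p
  obtain U \<phi> where c: "(U, \<phi>) \<in> M" "p \<in> U" using chart_at .
  show "subspace (fib (TB M) p)"
    unfolding fib_TB[OF c] by (rule linear_subspace_image[OF coord_vector_linear[OF c] subspace_UNIV])
next
  obtain B :: "'e set" where "finite B" "span B = UNIV"
    using smooth_manifold unfolding smooth_manifold_def by blast
  then obtain k and u :: "nat \<Rightarrow> 'e" where u: "basis_family k u UNIV"
    using basis_family_exists[OF subspace_UNIV, of B] by auto
  show "(\<Union>(U, k, e)\<in>frames (TB M). U) = UNIV"
  proof (intro equalityI subset_UNIV subsetI)
    fix p
    obtain U \<phi> where c: "(U, \<phi>) \<in> M" "p \<in> U" using chart_at .
    then have "(U, k, \<lambda>i. coord_vector M (U, \<phi>) (u i)) \<in> frames (TB M)"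
      unfolding TB_simps mem_Collect_eq using u
      by (intro exI[of _ "(U, \<phi>)"] exI[of _ k] exI[of _ u]) simp
    then show "p \<in> (\<Union>(U, k, e)\<in>frames (TB M). U)" using c(2) by blast
  qed
next
  fix fr assume "fr \<in> frames (TB M)"
  then obtain U \<phi> k u where c: "(U, \<phi>) \<in> M" and u: "basis_family k u (UNIV :: 'e set)"
    and fr: "fr = (U, k, \<lambda>i. coord_vector M (U, \<phi>) (u i))"
    unfolding TB_simps by fastforce
  have sec: "smooth_section_on M (TB M) U (coord_vector M (U, \<phi>) v)" for v
  proof (rule smooth_section_onI)
    show "coord_vector M (U, \<phi>) v p \<in> fib (TB M) p" if "p \<in> U" for p
      using fib_TB[OF c that] by blast
  next
    fix V l e assume "(V, l, e) \<in> frames (TB M)"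
    then obtain \<psi> w where d: "(V, \<psi>) \<in> M" and w: "basis_family l w (UNIV :: 'e set)"
      and e: "e = (\<lambda>i. coord_vector M (V, \<psi>) (w i))"
      unfolding TB_simps by fastforce
    let ?D = "\<lambda>x. frechet_derivative (\<lambda>x. \<psi> (inv_into U \<phi> x)) (at x) v"
    have oVU: "open (V \<inter> U)" using chart(1)[OF c] chart(1)[OF d] by blast
    have "smooth_fun_on M (V \<inter> U) (\<lambda>p. frame_coef l w (?D (\<phi> p)) i)" if "i < l" for i
    proof -
      have "smooth_on (\<phi> ` (U \<inter> V)) (\<lambda>x. frame_coef l w (?D x) i)"
        by (rule smooth_on_linear[OF open_chart_image[OF c chart(1)[OF d]]
              frame_coef_bounded_linear[OF w that]
              smooth_on_frechet_derivative[OF transition[OF c d]]])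
      from smooth_fun_on_chart[OF c chart(1)[OF d] this] show ?thesis by (simp add: Int_commute)
    qed
    moreover have "coord_vector M (U, \<phi>) v p = (\<Sum>i<l. frame_coef l w (?D (\<phi> p)) i *\<^sub>R e i p)"
      if p: "p \<in> V \<inter> U" for p
    proof -
      have L: "linear (\<lambda>v. coord_vector M (V, \<psi>) v p)" using coord_vector_linear[OF d] p by blast
      have "coord_vector M (U, \<phi>) v p = coord_vector M (V, \<psi>) (?D (\<phi> p)) p"
        using coord_vector_change[OF d c] p by blast
      also have "?D (\<phi> p) = (\<Sum>i<l. frame_coef l w (?D (\<phi> p)) i *\<^sub>R w i)"
        using frame_coef_expand[OF w] by simp
      also have "coord_vector M (V, \<psi>) (\<Sum>i<l. frame_coef l w (?D (\<phi> p)) i *\<^sub>R w i) p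
          = (\<Sum>i<l. frame_coef l w (?D (\<phi> p)) i *\<^sub>R e i p)"
        by (simp add: e linear_sum[OF L] linear_scale[OF L])
      finally show ?thesis .
    qed
    ultimately show "\<exists>c. (\<forall>i<l. smooth_fun_on M (V \<inter> U) (c i)) \<and>
        (\<forall>p\<in>V \<inter> U. coord_vector M (U, \<phi>) v p = (\<Sum>i<l. c i p *\<^sub>R e i p))"
      by (intro exI[of _ "\<lambda>i p. frame_coef l w (?D (\<phi> p)) i"]) blast
  qed
  show "case fr of (U, k, e) \<Rightarrow> open U \<and> (\<forall>p\<in>U. basis_family k (\<lambda>i. e i p) (fib (TB M) p)) \<and>
        (\<forall>i<k. smooth_section_on M (TB M) U (e i))"
    unfolding fr prod.case using chart(1)[OF c] coord_frame[OF c _ u] sec by blast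
qed

lemma act_zero_fun: "S \<in> fib (TB M) p \<Longrightarrow> act S (\<lambda>q. 0) = 0"
  by (auto simp: TB_simps act_coord_vector frechet_derivative_const)

end

section \<open>Horizontal lifts\<close>

lemma frame_coef_lincomb:
  assumes "basis_family k u F" "finite I" "\<And>i. i \<in> I \<Longrightarrow> h i \<in> F" "j < k"
  shows "frame_coef k u (\<Sum>i\<in>I. c i *\<^sub>R h i) j = (\<Sum>i\<in>I. c i * frame_coef k u (h i) j)"
  using assms(2,3)
proof (induction I rule: finite_induct)
  case empty
  show ?case
    using frame_coef_scale[OF assms(1) subspace_0[OF basis_family_subspace[OF assms(1)]] assms(4), of 0] by simp
next
  case (insert i I)
  have "(\<Sum>i\<in>I. c i *\<^sub>R h i) \<in> F"
    using insert.prems by (intro subspace_sum subspace_scale basis_family_subspace[OF assms(1)]) auto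
  moreover have "c i *\<^sub>R h i \<in> F"
    using insert.prems by (intro subspace_scale basis_family_subspace[OF assms(1)]) auto
  ultimately show ?case
    using insert frame_coef_add[OF assms(1) _ _ assms(4)] frame_coef_scale[OF assms(1) _ assms(4)] by simp
qed

lemma frame_coef_basis:
  assumes "basis_family k u F" "d < k" "j < k"
  shows "frame_coef k u (u d) j = (if j = d then 1 else 0)"
proof (rule frame_coef_unique[OF assms(1) _ basis_family_mem[OF assms(1,2)] assms(3)])
  have "(\<Sum>i<k. (if i = d then 1 else 0) *\<^sub>R u i) = (\<Sum>i<k. if i = d then u d else 0)"
    by (intro sum.cong) auto
  then show "(\<Sum>i<k. (if i = d then 1 else 0) *\<^sub>R u i) = u d" using assms(2) by simp
qed

section \<open>Orthogonal and horizontal local frames\<close>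

context manifold
begin

lemma gram_schmidt_frame:
  fixes k :: nat
  assumes "vector_bundle M E" "bundle_metric M E g" "open W" "p \<in> W"
    "\<forall>i<k. smooth_section_on M E W (t i)"
    "\<forall>x. (\<Sum>i<k. x i *\<^sub>R t i p) = 0 \<longrightarrow> (\<forall>i<k. x i = (0::real))"
  obtains V w b where "open V" "p \<in> V" "V \<subseteq> W" "\<forall>i<k. smooth_section_on M E V (w i)"
    "\<forall>i<k. \<forall>j<k. smooth_fun_on M V (b i j)"
    "\<forall>q\<in>V. (\<forall>i<k. w i q = (\<Sum>j<k. b i j q *\<^sub>R t j q)) \<and> (\<forall>i<k. w i q \<noteq> 0) \<and>
      (\<forall>i<k. \<forall>j<k. i \<noteq> j \<longrightarrow> g q (w i q) (w j q) = 0) \<and>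
      (\<forall>a\<in>fib E q. (\<forall>i<k. g q a (w i q) = 0) \<longrightarrow> (\<forall>i<k. g q a (t i q) = 0))"
proof -
  have "\<exists>V w b. open V \<and> p \<in> V \<and> V \<subseteq> W \<and> (\<forall>i<k. smooth_section_on M E V (w i)) \<and>
    (\<forall>i<k. \<forall>j<k. smooth_fun_on M V (b i j)) \<and>
    (\<forall>q\<in>V. (\<forall>i<k. w i q = (\<Sum>j<k. b i j q *\<^sub>R t j q)) \<and> (\<forall>i<k. w i q \<noteq> 0) \<and>
      (\<forall>i<k. \<forall>j<k. i \<noteq> j \<longrightarrow> g q (w i q) (w j q) = 0) \<and>
      (\<forall>a\<in>fib E q. (\<forall>i<k. g q a (w i q) = 0) \<longrightarrow> (\<forall>i<k. g q a (t i q) = 0)))"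
    by (rule gram_schmidt_exists[OF assms(1-4)]) (use assms(5,6) in simp_all)
  then show thesis by (elim exE conjE) (rule that)
qed

text \<open>Gram-Schmidt applied to a frame of \<open>E\<close>. By its last clause a vector
  orthogonal to all \<open>w i\<close> is orthogonal to the original frame, hence to itself, so the
  orthogonal family is complete.\<close>

lemma orthogonal_frame:
  assumes "vector_bundle M E" "bundle_metric M E g"
  obtains V and l :: nat and w where "open V" "p \<in> V" "\<forall>i<l. smooth_section_on M E V (w i)"
    "\<forall>q\<in>V. (\<forall>i<l. w i q \<noteq> 0) \<and> (\<forall>i<l. \<forall>j<l. i \<noteq> j \<longrightarrow> g q (w i q) (w j q) = 0) \<and>
      (\<forall>a\<in>fib E q. (\<forall>i<l. g q a (w i q) = 0) \<longrightarrow> a = 0)"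
    "\<forall>q\<in>V. \<exists>u. basis_family l u (fib E q)"
proof -
  obtain U l e where f: "(U, l, e) \<in> frames E" "p \<in> U" using vector_bundle_frame_at[OF assms(1)] .
  note fr = vector_bundle_frame[OF assms(1) f(1)]
  have sec: "\<forall>i<l. smooth_section_on M E U (e i)" using fr(3) by simp
  have ind: "\<forall>x. (\<Sum>i<l. x i *\<^sub>R e i p) = 0 \<longrightarrow> (\<forall>i<l. x i = 0)"
    using basis_family_zero[OF fr(2)[OF f(2)]] by simp
  obtain V w b where V: "open V" "p \<in> V" "V \<subseteq> U" and w: "\<forall>i<l. smooth_section_on M E V (w i)"
    and "\<forall>i<l. \<forall>j<l. smooth_fun_on M V (b i j)"
    and *: "\<forall>q\<in>V. (\<forall>i<l. w i q = (\<Sum>j<l. b i j q *\<^sub>R e j q)) \<and> (\<forall>i<l. w i q \<noteq> 0) \<and>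
      (\<forall>i<l. \<forall>j<l. i \<noteq> j \<longrightarrow> g q (w i q) (w j q) = 0) \<and>
      (\<forall>a\<in>fib E q. (\<forall>i<l. g q a (w i q) = 0) \<longrightarrow> (\<forall>i<l. g q a (e i q) = 0))"
    using gram_schmidt_frame[OF assms fr(1) f(2) sec ind] .
  have "a = 0" if q: "q \<in> V" and a: "a \<in> fib E q" "\<forall>i<l. g q a (w i q) = 0" for q a
  proof -
    interpret inner_fibre "fib E q" "g q" by (rule inner_fibre_bundle[OF assms])
    have bf: "basis_family l (\<lambda>i. e i q) (fib E q)" using fr(2) q V(3) by blast
    have 0: "\<forall>i<l. g q a (e i q) = 0" using bspec[OF * q] a by blast
    have "g q a a = g q a (\<Sum>i<l. frame_coef l (\<lambda>i. e i q) a i *\<^sub>R e i q)"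
      by (simp add: frame_coef_expand[OF bf a(1)])
    also have "\<dots> = (\<Sum>i<l. frame_coef l (\<lambda>i. e i q) a i * g q a (e i q))"
      by (rule lincomb_right) (use basis_family_mem[OF bf] a(1) in auto)
    also have "\<dots> = 0" using 0 by simp
    finally show ?thesis by (rule eq_zero[OF a(1)])
  qed
  note 0 = this
  show thesis
  proof (rule that[OF V(1,2) w], intro ballI conjI)
    fix q assume q: "q \<in> V"
    show "\<forall>i<l. w i q \<noteq> 0" using bspec[OF * q] by (elim conjE)
    show "\<forall>i<l. \<forall>j<l. i \<noteq> j \<longrightarrow> g q (w i q) (w j q) = 0" using bspec[OF * q] by (elim conjE)
    show "(\<forall>i<l. g q a (w i q) = 0) \<longrightarrow> a = 0" if "a \<in> fib E q" for a
      using 0[OF q that] by (rule impI)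
  next
    show "\<forall>q\<in>V. \<exists>u. basis_family l u (fib E q)" using fr(2) V(3) by blast
  qed
qed

text \<open>
  Near each point the horizontal space has an orthogonal frame \<open>w\<close>.  It arises by orthogonalising the
  Riesz representatives of the forms \<open>\<theta>\<^sub>c \<circ> \<Phi>\<close>, where \<open>\<theta>\<close> is a local coframe of \<open>F\<close>; so
  \<open>g a (w b) = \<eta> b (\<Phi> a)\<close> with a smooth form \<open>\<eta> b\<close>, and no matrix has to be inverted.
\<close>
lemma horizontal_frame:
  assumes "vector_bundle M E" "bundle_metric M E g" "vector_bundle M F" "bundle_map M E F \<Phi>"
    "\<And>p. \<Phi> p ` fib E p = fib F p"
  obtains V and n :: nat and w \<eta> where "open V" "p \<in> V" "\<forall>i<n. smooth_section_on M E V (w i)"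
    "\<forall>q\<in>V. (\<forall>i<n. w i q \<noteq> 0) \<and> (\<forall>i<n. \<forall>j<n. i \<noteq> j \<longrightarrow> g q (w i q) (w j q) = 0) \<and>
      (\<forall>a\<in>fib E q. \<Phi> q a = 0 \<longleftrightarrow> (\<forall>i<n. g q a (w i q) = 0)) \<and>
      (\<forall>a\<in>fib E q. \<forall>i<n. g q a (w i q) = \<eta> i q (\<Phi> q a))"
    "\<forall>W S. open W \<longrightarrow> W \<subseteq> V \<longrightarrow> smooth_section_on M F W S \<longrightarrow>
      (\<forall>i<n. smooth_fun_on M W (\<lambda>q. \<eta> i q (S q)))"
proof -
  obtain V0 and l :: nat and w0 where V0: "open V0" "p \<in> V0" and w0: "\<forall>i<l. smooth_section_on M E V0 (w0 i)"
    and w0': "\<forall>q\<in>V0. (\<forall>i<l. w0 i q \<noteq> 0) \<and> (\<forall>i<l. \<forall>j<l. i \<noteq> j \<longrightarrow> g q (w0 i q) (w0 j q) = 0) \<and>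
      (\<forall>a\<in>fib E q. (\<forall>i<l. g q a (w0 i q) = 0) \<longrightarrow> a = 0)"
    using orthogonal_frame[OF assms(1,2)] .
  obtain U n f where f: "(U, n, f) \<in> frames F" "p \<in> U" using vector_bundle_frame_at[OF assms(3)] .
  note fr = vector_bundle_frame[OF assms(3) f(1)]
  define V1 where "V1 = U \<inter> V0"
  have V1: "open V1" "p \<in> V1" using V0 fr(1) f(2) by (auto simp: V1_def)
  define \<theta> where "\<theta> c q S = frame_coef n (\<lambda>i. f i q) S c" for c q S
  have \<theta>_smooth: "smooth_fun_on M W (\<lambda>q. \<theta> c q (S q))"
    if "open W" "W \<subseteq> V1" "smooth_section_on M F W S" "c < n" for W S c
  proof -
    have "U \<inter> W = W" using that(2) by (auto simp: V1_def)
    then show ?thesis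
      using smooth_sectionD[OF assms(3) that(3,1) f(1) that(4)] by (simp add: \<theta>_def)
  qed
  have bf: "basis_family n (\<lambda>i. f i q) (fib F q)" if "q \<in> V1" for q
    using fr(2) that by (simp add: V1_def)
  have w1: "smooth_section_on M E V1 (w0 j)" if "j < l" for j
    by (rule section_subset[of _ V0]) (use w0 that in \<open>auto simp: V1_def\<close>)
  \<comment> \<open>The Riesz representative of the form
    \<open>\<theta> c q \<circ> \<Phi> q\<close>, written in the orthogonal frame: values of the
    form on \<open>w0 j\<close> divided by squared lengths.\<close>
  define h where "h c q = (\<Sum>j<l. (\<theta> c q (\<Phi> q (w0 j q)) / g q (w0 j q) (w0 j q)) *\<^sub>R w0 j q)" for c q
  have h: "smooth_section_on M E V1 (h c)" if c: "c < n" for c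
    unfolding h_def
  proof (rule section_lincomb[OF assms(1) V1(1)])
    fix j assume "j \<in> {..<l}"
    then have j: "j < l" by simp
    show "smooth_section_on M E V1 (w0 j)" by (rule w1[OF j])
    show "smooth_fun_on M V1 (\<lambda>q. \<theta> c q (\<Phi> q (w0 j q)) / g q (w0 j q) (w0 j q))"
    proof (rule smooth_fun_on_divide[OF V1(1)])
      show "smooth_fun_on M V1 (\<lambda>q. \<theta> c q (\<Phi> q (w0 j q)))"
        by (rule \<theta>_smooth[OF V1(1) subset_refl bundle_map_section[OF assms(1,3,4) V1(1) w1[OF j]] c])
      show "smooth_fun_on M V1 (\<lambda>q. g q (w0 j q) (w0 j q))"
        by (rule metric_smooth[OF assms(1,2) V1(1) w1[OF j] w1[OF j]])
      fix q assume q: "q \<in> V1"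
      then have "q \<in> V0" by (simp add: V1_def)
      interpret inner_fibre "fib E q" "g q" by (rule inner_fibre_bundle[OF assms(1,2)])
      have "w0 j q \<noteq> 0" using bspec[OF w0' \<open>q \<in> V0\<close>] j by blast
      then show "g q (w0 j q) (w0 j q) \<noteq> 0" using eq_zero[OF section_mem[OF w1[OF j] q]] by blast
    qed
  qed
  have gh: "g q a (h c q) = \<theta> c q (\<Phi> q a)" if q: "q \<in> V1" and a: "a \<in> fib E q" and c: "c < n" for q a c
  proof -
    interpret inner_fibre "fib E q" "g q" by (rule inner_fibre_bundle[OF assms(1,2)])
    have q0: "q \<in> V0" using q by (simp add: V1_def)
    have m: "w0 j q \<in> fib E q" if "j < l" for j using section_mem[OF w1[OF that] q] .
    have "a - proj l (\<lambda>j. w0 j q) a = 0"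
    proof -
      have "\<forall>j<l. g q (a - proj l (\<lambda>j. w0 j q) a) (w0 j q) = 0"
        using proj_orthogonal[of l "\<lambda>j. w0 j q" a] m a bspec[OF w0' q0] by blast
      moreover have "a - proj l (\<lambda>j. w0 j q) a \<in> fib E q" by (intro diff_mem a proj_mem m)
      ultimately show ?thesis using bspec[OF w0' q0] by blast
    qed
    then have "a = (\<Sum>j<l. (g q a (w0 j q) / g q (w0 j q) (w0 j q)) *\<^sub>R w0 j q)"
      by (simp add: proj_def)
    then have "\<Phi> q a = \<Phi> q (\<Sum>j<l. (g q a (w0 j q) / g q (w0 j q) (w0 j q)) *\<^sub>R w0 j q)" by simp
    also have "\<dots> = (\<Sum>j<l. (g q a (w0 j q) / g q (w0 j q) (w0 j q)) *\<^sub>R \<Phi> q (w0 j q))"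
      by (rule bundle_map_lincomb[OF assms(1,4)]) (use m in auto)
    finally have "\<theta> c q (\<Phi> q a) = (\<Sum>j<l. (g q a (w0 j q) / g q (w0 j q) (w0 j q)) * \<theta> c q (\<Phi> q (w0 j q)))"
      unfolding \<theta>_def
      using frame_coef_lincomb[OF bf[OF q], of "{..<l}" "\<lambda>j. \<Phi> q (w0 j q)" c] c bundle_mapD(1)[OF assms(4) m]
      by simp
    moreover have "g q a (h c q) = (\<Sum>j<l. \<theta> c q (\<Phi> q (w0 j q)) / g q (w0 j q) (w0 j q) * g q a (w0 j q))"
      unfolding h_def by (rule lincomb_right) (use m a in auto)
    ultimately show ?thesis by (simp add: mult.commute)
  qed
  have h_sec: "\<forall>c<n. smooth_section_on M E V1 (h c)" using h by simp
  have ind: "\<forall>x. (\<Sum>i<n. x i *\<^sub>R h i p) = 0 \<longrightarrow> (\<forall>i<n. x i = 0)"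
  proof (intro allI impI)
    fix x d assume x: "(\<Sum>i<n. x i *\<^sub>R h i p) = 0" and d: "d < n"
    interpret inner_fibre "fib E p" "g p" by (rule inner_fibre_bundle[OF assms(1,2)])
    \<comment> \<open>Surjectivity of \<open>\<Phi>\<close> enters here: pairing a relation among
      the \<open>h i\<close> with a preimage of the frame vector \<open>f d\<close> isolates the
      coefficient \<open>x d\<close>.\<close>
    obtain a where a: "a \<in> fib E p" "\<Phi> p a = f d p"
      using basis_family_mem[OF bf[OF V1(2)] d] assms(5) by (metis imageE)
    have "0 = g p a (\<Sum>i<n. x i *\<^sub>R h i p)" using x zero_right[OF a(1)] by simp
    also have "\<dots> = (\<Sum>i<n. x i * g p a (h i p))"
      by (rule lincomb_right) (use section_mem[OF h V1(2)] a(1) in auto)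
    also have "\<dots> = (\<Sum>i<n. if i = d then x d else 0)"
      using gh[OF V1(2) a(1)] frame_coef_basis[OF bf[OF V1(2)] d] by (intro sum.cong) (auto simp: \<theta>_def a(2))
    finally show "x d = 0" using d by simp
  qed
  obtain V w b where V: "open V" "p \<in> V" "V \<subseteq> V1" and w: "\<forall>i<n. smooth_section_on M E V (w i)"
    and b: "\<forall>i<n. \<forall>j<n. smooth_fun_on M V (b i j)"
    and *: "\<forall>q\<in>V. (\<forall>i<n. w i q = (\<Sum>j<n. b i j q *\<^sub>R h j q)) \<and> (\<forall>i<n. w i q \<noteq> 0) \<and>
      (\<forall>i<n. \<forall>j<n. i \<noteq> j \<longrightarrow> g q (w i q) (w j q) = 0) \<and>
      (\<forall>a\<in>fib E q. (\<forall>i<n. g q a (w i q) = 0) \<longrightarrow> (\<forall>i<n. g q a (h i q) = 0))"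
    using gram_schmidt_frame[OF assms(1,2) V1 h_sec ind] .
  define \<eta> where "\<eta> i q S = (\<Sum>c<n. b i c q * \<theta> c q S)" for i q S
  have gw: "g q a (w i q) = \<eta> i q (\<Phi> q a)" if q: "q \<in> V" and a: "a \<in> fib E q" and i: "i < n" for q a i
  proof -
    interpret inner_fibre "fib E q" "g q" by (rule inner_fibre_bundle[OF assms(1,2)])
    have q1: "q \<in> V1" using q V(3) by blast
    have "w i q = (\<Sum>j<n. b i j q *\<^sub>R h j q)" using bspec[OF * q] i by blast
    then have "g q a (w i q) = (\<Sum>c<n. b i c q * g q a (h c q))"
      using lincomb_right[of "{..<n}" "\<lambda>c. h c q" a "\<lambda>c. b i c q"] section_mem[OF h q1] a by simp
    then show ?thesis using gh[OF q1 a] by (simp add: \<eta>_def)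
  qed
  have \<eta>_smooth: "smooth_fun_on M W (\<lambda>q. \<eta> i q (S q))"
    if W: "open W" "W \<subseteq> V" "smooth_section_on M F W S" and i: "i < n" for W S i
    unfolding \<eta>_def
  proof (rule smooth_fun_on_sum[OF W(1)], rule smooth_fun_on_mult[OF W(1)])
    fix c assume c: "c \<in> {..<n}"
    show "smooth_fun_on M W (b i c)"
      by (rule smooth_fun_on_subset[OF _ W(2)]) (use b i c in simp)
    show "smooth_fun_on M W (\<lambda>q. \<theta> c q (S q))"
      using \<theta>_smooth[OF W(1) _ W(3)] W(2) V(3) c by blast
  qed
  have ker: "\<Phi> q a = 0 \<longleftrightarrow> (\<forall>i<n. g q a (w i q) = 0)" if q: "q \<in> V" and a: "a \<in> fib E q" for q a
  proof
    have q1: "q \<in> V1" using q V(3) by blast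
    have Fa: "\<Phi> q a \<in> fib F q" using bundle_mapD(1)[OF assms(4) a] .
    have z: "\<theta> c q 0 = 0" if "c < n" for c
      using frame_coef_lincomb[OF bf[OF q1], of "{}" "\<lambda>_. 0" c "\<lambda>_. 0"] that by (simp add: \<theta>_def)
    show "\<forall>i<n. g q a (w i q) = 0" if "\<Phi> q a = 0"
      using gw[OF q a] that z by (simp add: \<eta>_def)
    assume "\<forall>i<n. g q a (w i q) = 0"
    then have "\<forall>c<n. g q a (h c q) = 0" using bspec[OF * q] a by blast
    then have "\<forall>c<n. frame_coef n (\<lambda>i. f i q) (\<Phi> q a) c = 0" using gh[OF q1 a] by (simp add: \<theta>_def)
    then have "(\<Sum>i<n. frame_coef n (\<lambda>i. f i q) (\<Phi> q a) i *\<^sub>R f i q) = 0"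
      by (intro sum.neutral) simp
    then show "\<Phi> q a = 0" using frame_coef_expand[OF bf[OF q1] Fa] by simp
  qed
  have A: "\<forall>q\<in>V. (\<forall>i<n. w i q \<noteq> 0) \<and> (\<forall>i<n. \<forall>j<n. i \<noteq> j \<longrightarrow> g q (w i q) (w j q) = 0) \<and>
      (\<forall>a\<in>fib E q. \<Phi> q a = 0 \<longleftrightarrow> (\<forall>i<n. g q a (w i q) = 0)) \<and>
      (\<forall>a\<in>fib E q. \<forall>i<n. g q a (w i q) = \<eta> i q (\<Phi> q a))"
  proof (intro ballI conjI)
    fix q assume q: "q \<in> V"
    show "\<forall>i<n. w i q \<noteq> 0" using bspec[OF * q] by (elim conjE)
    show "\<forall>i<n. \<forall>j<n. i \<noteq> j \<longrightarrow> g q (w i q) (w j q) = 0" using bspec[OF * q] by (elim conjE)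
    show "\<Phi> q a = 0 \<longleftrightarrow> (\<forall>i<n. g q a (w i q) = 0)" if "a \<in> fib E q" for a
      by (rule ker[OF q that])
    show "\<forall>i<n. g q a (w i q) = \<eta> i q (\<Phi> q a)" if "a \<in> fib E q" for a
      using gw[OF q that] by simp
  qed
  have B: "\<forall>W S. open W \<longrightarrow> W \<subseteq> V \<longrightarrow> smooth_section_on M F W S \<longrightarrow>
      (\<forall>i<n. smooth_fun_on M W (\<lambda>q. \<eta> i q (S q)))"
    using \<eta>_smooth by simp
  show thesis by (rule that[OF V(1,2) w A B])
qed

end

section \<open>The horizontal lift \<gamma> and the vertical projection \<omega>\<close>

locale riemannian_submersion = manifold M
  for M :: "('b::{t2_space,second_countable_topology}, 'e::real_inner) atlas" +
  fixes A :: "('b, 'v::real_vector) algebroid" and g :: "'b \<Rightarrow> 'v \<Rightarrow> 'v \<Rightarrow> real"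
  assumes riemannian: "riemannian_submersion_algebroid M A g"
begin

abbreviation "K \<equiv> ker_anchor M A"

lemma lie: "lie_algebroid M A" and metric: "bundle_metric M A g"
  using riemannian by (simp_all add: riemannian_submersion_algebroid_def)

lemma vbA: "vector_bundle M A"
  using lie unfolding lie_algebroid_def by (elim conjE)

lemma anchor_map: "bundle_map M A (TB M) (anchor A)"
  using lie unfolding lie_algebroid_def by (elim conjE)

lemma anchor_onto: "anchor A p ` fib A p = fib (TB M) p"
  using riemannian unfolding riemannian_submersion_algebroid_def transitive_def by blast

lemmas anchor_mem = bundle_mapD(1)[OF anchor_map]
lemmas anchor_add = bundle_mapD(2)[OF anchor_map]
lemmas anchor_scale = bundle_mapD(3)[OF anchor_map]

lemma inner_fibre_A: "inner_fibre (fib A p) (g p)"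
  by (rule inner_fibre_bundle[OF vbA metric])

lemma anchor_diff: "a \<in> fib A p \<Longrightarrow> b \<in> fib A p \<Longrightarrow> anchor A p (a - b) = anchor A p a - anchor A p b"
proof -
  assume a: "a \<in> fib A p" "b \<in> fib A p"
  interpret inner_fibre "fib A p" "g p" by (rule inner_fibre_A)
  show ?thesis using anchor_add[OF a(1) scale_mem[OF a(2), of "-1"]] anchor_scale[OF a(2), of "-1"] by simp
qed

lemma fib_K: "fib K p = {a \<in> fib A p. anchor A p a = 0}"
  and frames_K: "frames K = {(U, k, e). open U \<and> (\<forall>p\<in>U. basis_family k (\<lambda>i. e i p) (fib K p)) \<and>
        (\<forall>i<k. smooth_section_on M A U (e i))}"
  and anchor_K: "anchor K = (\<lambda>p a. 0)" and brkt_K: "brkt K = brkt A"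
  by (simp_all add: ker_anchor_def)

lemma subspace_K: "subspace (fib K p)"
proof -
  interpret inner_fibre "fib A p" "g p" by (rule inner_fibre_A)
  have "anchor A p 0 = 0" using anchor_scale[OF zero_mem, of 0] by simp
  then show ?thesis
    unfolding subspace_def fib_K using zero_mem add_mem scale_mem anchor_add anchor_scale by auto
qed

text \<open>Two candidates differ by a vertical vector that is orthogonal to all vertical vectors,
  hence to itself. This evaluates the \<open>THE\<close> in \<open>hlift\<close>.\<close>

lemma hlift_unique:
  assumes "a \<in> fib A p" "\<And>v. v \<in> fib K p \<Longrightarrow> g p a v = 0" "anchor A p a = S"
  shows "hlift A g p S = a"
  unfolding hlift_def
proof (rule the_equality)
  show "a \<in> fib A p \<and> (\<forall>v\<in>fib A p. anchor A p v = 0 \<longrightarrow> g p a v = 0) \<and> anchor A p a = S"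
    using assms by (simp add: fib_K)
  fix c assume c: "c \<in> fib A p \<and> (\<forall>v\<in>fib A p. anchor A p v = 0 \<longrightarrow> g p c v = 0) \<and> anchor A p c = S"
  interpret inner_fibre "fib A p" "g p" by (rule inner_fibre_A)
  have d: "c - a \<in> fib K p" using c assms(1,3) by (simp add: fib_K diff_mem anchor_diff)
  then have "g p (c - a) (c - a) = g p c (c - a) - g p a (c - a)"
    using c assms(1) by (intro diff_left) (auto simp: fib_K)
  also have "\<dots> = 0" using d c assms(2)[OF d] by (simp add: fib_K)
  finally have "c - a = 0" by (rule eq_zero[rotated]) (use d in \<open>simp add: fib_K\<close>)
  then show "c = a" by simp
qed

text \<open>The lift of \<open>S\<close> is the projection onto the horizontal frame of any
  \<open>a\<close> with anchor \<open>S\<close>. The products of \<open>a\<close> with the frame are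
  \<open>\<eta> i q S\<close>, which depend on \<open>S\<close> alone, so the formula involves no
  choice of \<open>a\<close> and inherits smoothness from \<open>\<eta>\<close>.\<close>

lemma hlift_local:
  obtains V and n :: nat and w \<eta> where "open V" "p \<in> V" "\<forall>i<n. smooth_section_on M A V (w i)"
    "\<forall>q\<in>V. (\<forall>i<n. w i q \<noteq> 0) \<and> (\<forall>i<n. \<forall>j<n. i \<noteq> j \<longrightarrow> g q (w i q) (w j q) = 0) \<and>
      (\<forall>a\<in>fib A q. anchor A q a = 0 \<longleftrightarrow> (\<forall>i<n. g q a (w i q) = 0))"
    "\<forall>W S. open W \<longrightarrow> W \<subseteq> V \<longrightarrow> smooth_section_on M (TB M) W S \<longrightarrow>
      (\<forall>i<n. smooth_fun_on M W (\<lambda>q. \<eta> i q (S q)))"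
    "\<forall>q\<in>V. \<forall>S\<in>fib (TB M) q. \<forall>h. h = (\<Sum>i<n. (\<eta> i q S / g q (w i q) (w i q)) *\<^sub>R w i q) \<longrightarrow>
      h \<in> fib A q \<and> (\<forall>v\<in>fib K q. g q h v = 0) \<and> anchor A q h = S"
proof -
  obtain V and n :: nat and w \<eta> where V: "open V" "p \<in> V" and w: "\<forall>i<n. smooth_section_on M A V (w i)"
    and *: "\<forall>q\<in>V. (\<forall>i<n. w i q \<noteq> 0) \<and> (\<forall>i<n. \<forall>j<n. i \<noteq> j \<longrightarrow> g q (w i q) (w j q) = 0) \<and>
      (\<forall>a\<in>fib A q. anchor A q a = 0 \<longleftrightarrow> (\<forall>i<n. g q a (w i q) = 0)) \<and>
      (\<forall>a\<in>fib A q. \<forall>i<n. g q a (w i q) = \<eta> i q (anchor A q a))"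
    and \<eta>: "\<forall>W S. open W \<longrightarrow> W \<subseteq> V \<longrightarrow> smooth_section_on M (TB M) W S \<longrightarrow>
      (\<forall>i<n. smooth_fun_on M W (\<lambda>q. \<eta> i q (S q)))"
    using horizontal_frame[OF vbA metric vector_bundle_TB anchor_map anchor_onto] .
  have lift: "h \<in> fib A q \<and> (\<forall>v\<in>fib K q. g q h v = 0) \<and> anchor A q h = S"
    if q: "q \<in> V" and S: "S \<in> fib (TB M) q"
      and h: "h = (\<Sum>i<n. (\<eta> i q S / g q (w i q) (w i q)) *\<^sub>R w i q)" for q S h
  proof -
    interpret inner_fibre "fib A q" "g q" by (rule inner_fibre_A)
    have m: "w i q \<in> fib A q" if "i < n" for i using section_mem[OF w[rule_format, OF that] q] .
    obtain a where a: "a \<in> fib A q" "anchor A q a = S" using S anchor_onto by (metis imageE)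
    have "\<eta> i q S = g q a (w i q)" if "i < n" for i
      using bspec[OF * q] a that by simp
    then have hp: "h = proj n (\<lambda>i. w i q) a"
      by (simp add: h proj_def)
    have hm: "h \<in> fib A q" unfolding hp by (rule proj_mem[OF m])
    have "g q (a - h) (w i q) = 0" if "i < n" for i
      unfolding hp by (rule proj_orthogonal) (use m a(1) that bspec[OF * q] in auto)
    then have "anchor A q (a - h) = 0" using bspec[OF * q] diff_mem[OF a(1) hm] by blast
    then have "anchor A q h = S" using anchor_diff[OF a(1) hm] a(2) by simp
    moreover have "g q h v = 0" if v: "v \<in> fib K q" for v
    proof -
      have vA: "v \<in> fib A q" using v by (simp add: fib_K)
      then have "g q v (w i q) = 0" if "i < n" for i
        using v that bspec[OF * q] by (simp add: fib_K)
      then have "g q (w i q) v = 0" if "i < n" for i using that sym[OF m vA] by simp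
      moreover have "g q h v = (\<Sum>i<n. \<eta> i q S / g q (w i q) (w i q) * g q (w i q) v)"
        unfolding h by (rule lincomb_left) (use m vA in auto)
      ultimately show ?thesis by simp
    qed
    ultimately show ?thesis using hm by blast
  qed
  show thesis
  proof (rule that[OF V w _ \<eta>])
    show "\<forall>q\<in>V. (\<forall>i<n. w i q \<noteq> 0) \<and> (\<forall>i<n. \<forall>j<n. i \<noteq> j \<longrightarrow> g q (w i q) (w j q) = 0) \<and>
      (\<forall>a\<in>fib A q. anchor A q a = 0 \<longleftrightarrow> (\<forall>i<n. g q a (w i q) = 0))"
      using * by blast
    show "\<forall>q\<in>V. \<forall>S\<in>fib (TB M) q. \<forall>h. h = (\<Sum>i<n. (\<eta> i q S / g q (w i q) (w i q)) *\<^sub>R w i q) \<longrightarrow>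
      h \<in> fib A q \<and> (\<forall>v\<in>fib K q. g q h v = 0) \<and> anchor A q h = S"
      using lift by blast
  qed
qed

lemma hlift:
  assumes "S \<in> fib (TB M) p"
  shows "hlift A g p S \<in> fib A p" "v \<in> fib K p \<Longrightarrow> g p (hlift A g p S) v = 0"
    "anchor A p (hlift A g p S) = S"
proof -
  obtain V and n :: nat and w \<eta> where V: "open V" "p \<in> V"
    and lift: "\<forall>q\<in>V. \<forall>S\<in>fib (TB M) q. \<forall>h. h = (\<Sum>i<n. (\<eta> i q S / g q (w i q) (w i q)) *\<^sub>R w i q) \<longrightarrow>
      h \<in> fib A q \<and> (\<forall>v\<in>fib K q. g q h v = 0) \<and> anchor A q h = S"
    by (rule hlift_local[of p])
  define h where "h = (\<Sum>i<n. (\<eta> i p S / g p (w i p) (w i p)) *\<^sub>R w i p)"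
  have h: "h \<in> fib A p" "\<forall>v\<in>fib K p. g p h v = 0" "anchor A p h = S"
    using bspec[OF bspec[OF lift V(2)] assms, THEN spec, THEN mp, OF h_def] by simp_all
  then have "hlift A g p S = h" by (intro hlift_unique) auto
  with h show "hlift A g p S \<in> fib A p" "v \<in> fib K p \<Longrightarrow> g p (hlift A g p S) v = 0"
    "anchor A p (hlift A g p S) = S" by auto
qed

lemma hlift_smooth:
  assumes "open W" "smooth_section_on M (TB M) W S"
  shows "smooth_section_on M A W (\<lambda>q. hlift A g q (S q))"
proof (rule section_local[OF vbA])
  fix p assume p: "p \<in> W"
  obtain V and n :: nat and w \<eta> where V: "open V" "p \<in> V" and w: "\<forall>i<n. smooth_section_on M A V (w i)"
    and *: "\<forall>q\<in>V. (\<forall>i<n. w i q \<noteq> 0) \<and> (\<forall>i<n. \<forall>j<n. i \<noteq> j \<longrightarrow> g q (w i q) (w j q) = 0) \<and>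
      (\<forall>a\<in>fib A q. anchor A q a = 0 \<longleftrightarrow> (\<forall>i<n. g q a (w i q) = 0))"
    and \<eta>: "\<forall>W S. open W \<longrightarrow> W \<subseteq> V \<longrightarrow> smooth_section_on M (TB M) W S \<longrightarrow>
      (\<forall>i<n. smooth_fun_on M W (\<lambda>q. \<eta> i q (S q)))"
    and lift: "\<forall>q\<in>V. \<forall>S\<in>fib (TB M) q. \<forall>h. h = (\<Sum>i<n. (\<eta> i q S / g q (w i q) (w i q)) *\<^sub>R w i q) \<longrightarrow>
      h \<in> fib A q \<and> (\<forall>v\<in>fib K q. g q h v = 0) \<and> anchor A q h = S"
    using hlift_local .
  have o: "open (W \<inter> V)" using assms(1) V(1) by blast
  have S: "smooth_section_on M (TB M) (W \<inter> V) S" by (rule section_subset[OF assms(2)]) blast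
  have wW: "smooth_section_on M A (W \<inter> V) (w i)" if "i < n" for i
    by (rule section_subset[of _ V]) (use w that in auto)
  have "smooth_section_on M A (W \<inter> V) (\<lambda>q. \<Sum>i<n. (\<eta> i q (S q) / g q (w i q) (w i q)) *\<^sub>R w i q)"
  proof (rule section_lincomb[OF vbA o])
    fix i assume "i \<in> {..<n}"
    then have i: "i < n" by simp
    show "smooth_section_on M A (W \<inter> V) (w i)" by (rule wW[OF i])
    show "smooth_fun_on M (W \<inter> V) (\<lambda>q. \<eta> i q (S q) / g q (w i q) (w i q))"
    proof (rule smooth_fun_on_divide[OF o _ metric_smooth[OF vbA metric o wW[OF i] wW[OF i]]])
      show "smooth_fun_on M (W \<inter> V) (\<lambda>q. \<eta> i q (S q))"
        using \<eta>[rule_format, OF o _ S i] by blast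
      fix q assume q: "q \<in> W \<inter> V"
      interpret inner_fibre "fib A q" "g q" by (rule inner_fibre_A)
      have "w i q \<noteq> 0" using bspec[OF *] q i by blast
      then show "g q (w i q) (w i q) \<noteq> 0" using eq_zero[OF section_mem[OF wW[OF i] q]] by blast
    qed
  qed
  then have "smooth_section_on M A (W \<inter> V) (\<lambda>q. hlift A g q (S q))"
  proof (rule section_cong)
    fix q assume q: "q \<in> W \<inter> V"
    have "S q \<in> fib (TB M) q" using section_mem[OF S q] .
    then have "hlift A g q (S q) = (\<Sum>i<n. (\<eta> i q (S q) / g q (w i q) (w i q)) *\<^sub>R w i q)"
      using lift q by (intro hlift_unique) blast+
    then show "(\<Sum>i<n. (\<eta> i q (S q) / g q (w i q) (w i q)) *\<^sub>R w i q) = hlift A g q (S q)" by simp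
  qed
  then show "\<exists>W'. open W' \<and> p \<in> W' \<and> smooth_section_on M A W' (\<lambda>q. hlift A g q (S q))"
    using o p V(2) by blast
qed

lemma anchor_smooth:
  "open W \<Longrightarrow> smooth_section_on M A W s \<Longrightarrow> smooth_section_on M (TB M) W (\<lambda>q. anchor A q (s q))"
  by (rule bundle_map_section[OF vbA vector_bundle_TB anchor_map])

lemma vproj_smooth:
  "open W \<Longrightarrow> smooth_section_on M A W s \<Longrightarrow> smooth_section_on M A W (\<lambda>q. vproj A g q (s q))"
  unfolding vproj_def by (intro section_diff[OF vbA] hlift_smooth anchor_smooth)

lemma vproj_mem:
  assumes "a \<in> fib A p"
  shows "vproj A g p a \<in> fib K p"
proof -
  interpret inner_fibre "fib A p" "g p" by (rule inner_fibre_A)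
  have S: "anchor A p a \<in> fib (TB M) p" by (rule anchor_mem[OF assms])
  show ?thesis
    unfolding vproj_def fib_K using diff_mem[OF assms hlift(1)[OF S]] anchor_diff[OF assms hlift(1)[OF S]]
      hlift(3)[OF S] by simp
qed

lemma hlift_zero: "hlift A g p 0 = 0"
proof (rule hlift_unique)
  interpret inner_fibre "fib A p" "g p" by (rule inner_fibre_A)
  show "0 \<in> fib A p" by (rule zero_mem)
  show "g p 0 v = 0" if "v \<in> fib K p" for v using that zero_left by (simp add: fib_K)
  show "anchor A p 0 = 0" using anchor_scale[OF zero_mem, of 0] by simp
qed

lemma vproj_K: "a \<in> fib K p \<Longrightarrow> vproj A g p a = a"
  by (simp add: vproj_def fib_K hlift_zero)

end

section \<open>The kernel bundle\<close>

context riemannian_submersion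
begin

text \<open>A basis of the kernel at \<open>p\<close> is extended to vertical sections and
  orthogonalised. If these failed to span a nearby kernel, a nonzero vertical \<open>a\<close>
  orthogonal to them would, together with them and the \<open>n\<close> horizontal vectors, form
  \<open>n + m + 1\<close> independent vectors in a fibre of dimension \<open>l\<close>, although
  \<open>l \<le> n + m\<close>.\<close>

lemma kernel_frame:
  obtains U m e where "(U, m, e) \<in> frames K" "p \<in> U"
proof -
  obtain V and n :: nat and w \<eta> where V: "open V" "p \<in> V" and w: "\<forall>i<n. smooth_section_on M A V (w i)"
    and *: "\<forall>q\<in>V. (\<forall>i<n. w i q \<noteq> 0) \<and> (\<forall>i<n. \<forall>j<n. i \<noteq> j \<longrightarrow> g q (w i q) (w j q) = 0) \<and>
      (\<forall>a\<in>fib A q. anchor A q a = 0 \<longleftrightarrow> (\<forall>i<n. g q a (w i q) = 0))"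
    by (rule hlift_local[of p])
  obtain U0 l e0 where f: "(U0, l, e0) \<in> frames A" "p \<in> U0" using vector_bundle_frame_at[OF vbA] .
  note fr = vector_bundle_frame[OF vbA f(1)]
  have e0_span: "inj_on (\<lambda>i. e0 i q) {..<l}" "independent ((\<lambda>i. e0 i q) ` {..<l})"
    "span ((\<lambda>i. e0 i q) ` {..<l}) = fib A q" if "q \<in> U0" for q
    using fr(2)[OF that] by (auto simp: basis_family_def)
  have "fib K p \<subseteq> span ((\<lambda>i. e0 i p) ` {..<l})" using e0_span(3)[OF f(2)] by (auto simp: fib_K)
  then obtain m v where v: "basis_family m v (fib K p)"
    using basis_family_exists[OF subspace_K, of "(\<lambda>i. e0 i p) ` {..<l}" p] by auto
  have "\<exists>X. X \<in> sections M A \<and> X p = v i" if "i < m" for i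
  proof -
    have vi: "v i \<in> fib A p" using basis_family_mem[OF v that] by (simp add: fib_K)
    obtain X where "X \<in> sections M A" "X p = v i" using global_section_through[OF vbA vi] .
    then show ?thesis by blast
  qed
  then obtain X where X: "\<And>i. i < m \<Longrightarrow> X i \<in> sections M A" "\<And>i. i < m \<Longrightarrow> X i p = v i" by metis
  \<comment> \<open>Projecting makes the extension vertical everywhere and does not change its value
    at \<open>p\<close>, which is vertical already.\<close>
  define t where "t i q = vproj A g q (X i q)" for i q
  define V1 where "V1 = V \<inter> U0"
  have V1: "open V1" "p \<in> V1" using V fr(1) f(2) by (auto simp: V1_def)
  have t: "\<forall>i<m. smooth_section_on M A V1 (t i)"
  proof (intro allI impI)
    fix i assume "i < m"
    have "smooth_section_on M A UNIV (t i)"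
      unfolding t_def by (rule vproj_smooth[OF open_UNIV sectionsD(1)[OF X(1)[OF \<open>i < m\<close>]]])
    then show "smooth_section_on M A V1 (t i)" by (rule section_subset) simp
  qed
  have tK: "t i q \<in> fib K q" if "i < m" for i q
    unfolding t_def by (rule vproj_mem[OF sectionsD(2)[OF X(1)[OF that]]])
  have tp: "t i p = v i" if "i < m" for i
    using vproj_K[OF basis_family_mem[OF v that]] X(2)[OF that] by (simp add: t_def)
  have ind: "\<forall>x. (\<Sum>i<m. x i *\<^sub>R t i p) = 0 \<longrightarrow> (\<forall>i<m. x i = 0)"
    using basis_family_zero[OF v] by (simp add: tp)
  obtain V2 w' b where V2: "open V2" "p \<in> V2" "V2 \<subseteq> V1" and w': "\<forall>i<m. smooth_section_on M A V2 (w' i)"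
    and "\<forall>i<m. \<forall>j<m. smooth_fun_on M V2 (b i j)"
    and **: "\<forall>q\<in>V2. (\<forall>i<m. w' i q = (\<Sum>j<m. b i j q *\<^sub>R t j q)) \<and> (\<forall>i<m. w' i q \<noteq> 0) \<and>
      (\<forall>i<m. \<forall>j<m. i \<noteq> j \<longrightarrow> g q (w' i q) (w' j q) = 0) \<and>
      (\<forall>a\<in>fib A q. (\<forall>i<m. g q a (w' i q) = 0) \<longrightarrow> (\<forall>i<m. g q a (t i q) = 0))"
    using gram_schmidt_frame[OF vbA metric V1 t ind] .
  have w'K: "w' i q \<in> fib K q" if "q \<in> V2" "i < m" for i q
  proof -
    have e: "w' i q = (\<Sum>j<m. b i j q *\<^sub>R t j q)" using bspec[OF ** that(1)] that(2) by blast
    show ?thesis unfolding e using tK by (intro subspace_sum subspace_scale subspace_K) auto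
  qed
  have w'0: "w' i q \<noteq> 0" if "q \<in> V2" "i < m" for i q
    using bspec[OF ** that(1)] that(2) by blast
  have w'o: "g q (w' i q) (w' j q) = 0" if "q \<in> V2" "i < m" "j < m" "i \<noteq> j" for i j q
    using bspec[OF ** that(1)] that(2-) by blast
  \<comment> \<open>Read off at \<open>p\<close>, where the horizontal vectors and the basis
    \<open>v\<close> of the kernel span the fibre. The bound then serves at nearby points because
    \<open>l\<close> and \<open>n\<close> are constant there.\<close>
  have rank: "l \<le> n + m"
  proof -
    interpret inner_fibre "fib A p" "g p" by (rule inner_fibre_A)
    have wm: "w i p \<in> fib A p" if "i < n" for i using section_mem[OF w[rule_format, OF that] V(2)] .
    let ?S = "(\<lambda>i. w i p) ` {..<n} \<union> v ` {..<m}"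
    have "a \<in> span ?S" if a: "a \<in> fib A p" for a
    proof -
      have pm: "proj n (\<lambda>i. w i p) a \<in> fib A p" by (intro proj_mem wm)
      have "g p (a - proj n (\<lambda>i. w i p) a) (w i p) = 0" if "i < n" for i
        by (rule proj_orthogonal) (use wm a that bspec[OF * V(2)] in auto)
      then have "a - proj n (\<lambda>i. w i p) a \<in> fib K p"
        using bspec[OF * V(2)] diff_mem[OF a pm] by (simp add: fib_K)
      also have "fib K p = span (v ` {..<m})" using v by (simp add: basis_family_def)
      finally have "a - proj n (\<lambda>i. w i p) a \<in> span ?S" by (meson span_mono subsetD sup_ge2)
      moreover have "proj n (\<lambda>i. w i p) a \<in> span ?S"
        unfolding proj_def by (intro span_sum span_scale span_base) auto
      ultimately have "a - proj n (\<lambda>i. w i p) a + proj n (\<lambda>i. w i p) a \<in> span ?S"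
        by (rule span_add)
      then show ?thesis by simp
    qed
    then have "(\<lambda>i. e0 i p) ` {..<l} \<subseteq> span ?S"
      using basis_family_mem[OF fr(2)[OF f(2)]] by auto
    then have "card ((\<lambda>i. e0 i p) ` {..<l}) \<le> card ?S"
      using independent_span_bound[OF _ e0_span(2)[OF f(2)]] by auto
    also have "\<dots> \<le> card ((\<lambda>i. w i p) ` {..<n}) + card (v ` {..<m})" by (rule card_Un_le)
    also have "\<dots> \<le> n + m"
      using card_image_le[of "{..<n}" "\<lambda>i. w i p"] card_image_le[of "{..<m}" v] by simp
    finally show ?thesis using card_image[OF e0_span(1)[OF f(2)]] by simp
  qed
  have complete: "a = 0" if q: "q \<in> V2" and a: "a \<in> fib K q" "\<forall>i<m. g q a (w' i q) = 0" for q a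
  proof (rule ccontr)
    assume "a \<noteq> 0"
    interpret inner_fibre "fib A q" "g q" by (rule inner_fibre_A)
    have qV: "q \<in> V" and qU: "q \<in> U0" using q V2(3) by (auto simp: V1_def)
    have wm: "w i q \<in> fib A q" if "i < n" for i using section_mem[OF w[rule_format, OF that] qV] .
    have K_sub: "x \<in> fib A q" if "x \<in> fib K q" for x using that by (simp add: fib_K)
    have K_w: "g q x (w i q) = 0" if "x \<in> fib K q" "i < n" for x i
      using bspec[OF * qV] that unfolding fib_K by blast
    \<comment> \<open>One list: \<open>n\<close> horizontal vectors, then the \<open>m\<close>
      vertical ones, then the supposed extra vector \<open>a\<close> at index
      \<open>n + m\<close>.\<close>
    define z where "z i = (if i < n then w i q else if i < n + m then w' (i - n) q else a)" for i
    have zm: "z i \<in> fib A q" if "i < n + m + 1" for i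
      using that wm K_sub[OF a(1)] K_sub[OF w'K[OF q]] by (simp add: z_def)
    have z0: "z i \<noteq> 0" if "i < n + m + 1" for i
      using that \<open>a \<noteq> 0\<close> w'0[OF q] bspec[OF * qV] by (simp add: z_def)
    have zz: "g q (z j) (z i) = 0" if ij: "i < j" "j < n + m + 1" for i j
    proof -
      \<comment> \<open>For \<open>i < j\<close>: both horizontal; horizontal against vertical; two
        members of \<open>w'\<close>; a member of \<open>w'\<close> against
        \<open>a\<close>.\<close>
      consider "j < n" | "n \<le> j" "i < n" | "n \<le> i" "j < n + m" | "n \<le> i" "i < n + m" "j = n + m"
        using ij by linarith
      then show ?thesis
      proof cases
        case 1
        then show ?thesis using ij bspec[OF * qV] by (simp add: z_def)
      next
        case 2
        then have "z j \<in> fib K q" using ij a(1) w'K[OF q] by (simp add: z_def)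
        then show ?thesis using K_w 2 by (simp add: z_def)
      next
        case 3
        then show ?thesis using ij w'o[OF q, of "j - n" "i - n"] by (simp add: z_def)
      next
        case 4
        then show ?thesis using a(2)[rule_format, of "i - n"] by (simp add: z_def)
      qed
    qed
    have orth: "g q (z i) (z j) = 0" if "i < n + m + 1" "j < n + m + 1" "i \<noteq> j" for i j
    proof (cases "i < j")
      case True
      then show ?thesis using zz[OF True that(2)] sym[OF zm[OF that(1)] zm[OF that(2)]] by simp
    next
      case False
      then show ?thesis using zz[of j i] that by simp
    qed
    have "z ` {..<n + m + 1} \<subseteq> span ((\<lambda>i. e0 i q) ` {..<l})"
      using zm e0_span(3)[OF qU] by auto
    moreover have ind: "independent (z ` {..<n + m + 1})" and inj: "inj_on z {..<n + m + 1}"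
      by (rule orthogonal_independent; use zm z0 orth in simp)+
    ultimately have "card (z ` {..<n + m + 1}) \<le> card ((\<lambda>i. e0 i q) ` {..<l})"
      using independent_span_bound[OF finite_imageI[OF finite_lessThan] ind] by simp
    also have "\<dots> \<le> l" using card_image_le[of "{..<l}" "\<lambda>i. e0 i q"] by simp
    finally have "n + m + 1 \<le> l"
      using card_image[OF inj] by simp
    then show False using rank by simp
  qed
  have basis: "basis_family m (\<lambda>i. w' i q) (fib K q)" if q: "q \<in> V2" for q
  proof -
    interpret inner_fibre "fib A q" "g q" by (rule inner_fibre_A)
    have m: "w' i q \<in> fib A q" if "i < m" for i using w'K[OF q that] by (simp add: fib_K)
    have "inj_on (\<lambda>i. w' i q) {..<m}" "independent ((\<lambda>i. w' i q) ` {..<m})"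
      by (rule orthogonal_independent; use m w'0[OF q] w'o[OF q] in simp)+
    moreover have "span ((\<lambda>i. w' i q) ` {..<m}) = fib K q"
    proof (intro equalityI subsetI)
      fix a assume "a \<in> span ((\<lambda>i. w' i q) ` {..<m})"
      then show "a \<in> fib K q"
        using span_minimal[OF _ subspace_K, of "(\<lambda>i. w' i q) ` {..<m}" q] w'K[OF q] by auto
    next
      fix a assume a: "a \<in> fib K q"
      have pm: "proj m (\<lambda>i. w' i q) a \<in> fib K q"
        unfolding proj_def using w'K[OF q] by (intro subspace_sum subspace_scale subspace_K) auto
      have "g q (a - proj m (\<lambda>i. w' i q) a) (w' i q) = 0" if "i < m" for i
        by (rule proj_orthogonal) (use m w'0[OF q] w'o[OF q] a that in \<open>auto simp: fib_K\<close>)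
      then have "a - proj m (\<lambda>i. w' i q) a = 0"
        using complete[OF q subspace_diff[OF subspace_K a pm]] by blast
      then have "a = proj m (\<lambda>i. w' i q) a" by simp
      also have "\<dots> \<in> span ((\<lambda>i. w' i q) ` {..<m})"
        unfolding proj_def by (intro span_sum span_scale span_base) auto
      finally show "a \<in> span ((\<lambda>i. w' i q) ` {..<m})" .
    qed
    ultimately show ?thesis by (simp add: basis_family_def)
  qed
  have "(V2, m, w') \<in> frames K" using V2(1) w' basis by (simp add: frames_K)
  then show thesis using that V2(2) by blast
qed

text \<open>A frame of \<open>ker #\<close> need not belong to a frame of \<open>A\<close>, so
  smoothness in \<open>A\<close> says nothing directly about coordinates in it. Orthogonalising the
  frame within \<open>A\<close> gives \<open>s\<close> the coefficients \<open>d j\<close>, which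
  are quotients of metric products, and the \<open>b j i\<close> convert these into coordinates in
  the given frame.\<close>

lemma kernel_section_of_section:
  assumes "open W" "smooth_section_on M A W s" "\<And>p. p \<in> W \<Longrightarrow> s p \<in> fib K p"
  shows "smooth_section_on M K W s"
proof (rule smooth_section_onI[OF assms(3)])
  fix U k e assume f: "(U, k, e) \<in> frames K"
  then have U: "open U" and e: "\<And>i. i < k \<Longrightarrow> smooth_section_on M A U (e i)"
    and bf: "\<And>p. p \<in> U \<Longrightarrow> basis_family k (\<lambda>i. e i p) (fib K p)"
    by (auto simp: frames_K)
  define c where "c i p = frame_coef k (\<lambda>i. e i p) (s p) i" for i p
  have "smooth_fun_on M (U \<inter> W) (c i)" if i: "i < k" for i
  proof (rule smooth_fun_on_local)
    fix p assume p: "p \<in> U \<inter> W"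
    have o: "open (U \<inter> W)" using U assms(1) by blast
    have eW: "\<forall>i<k. smooth_section_on M A (U \<inter> W) (e i)"
      using section_subset[OF e, of _ "U \<inter> W"] by simp
    have "p \<in> U" using p by simp
    have ind: "\<forall>x. (\<Sum>i<k. x i *\<^sub>R e i p) = 0 \<longrightarrow> (\<forall>i<k. x i = 0)"
      using basis_family_zero[OF bf[OF \<open>p \<in> U\<close>]] by simp
    obtain V w b where V: "open V" "p \<in> V" "V \<subseteq> U \<inter> W" and w: "\<forall>i<k. smooth_section_on M A V (w i)"
      and b: "\<forall>i<k. \<forall>j<k. smooth_fun_on M V (b i j)"
      and *: "\<forall>q\<in>V. (\<forall>i<k. w i q = (\<Sum>j<k. b i j q *\<^sub>R e j q)) \<and> (\<forall>i<k. w i q \<noteq> 0) \<and>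
        (\<forall>i<k. \<forall>j<k. i \<noteq> j \<longrightarrow> g q (w i q) (w j q) = 0) \<and>
        (\<forall>a\<in>fib A q. (\<forall>i<k. g q a (w i q) = 0) \<longrightarrow> (\<forall>i<k. g q a (e i q) = 0))"
      using gram_schmidt_frame[OF vbA metric o p eW ind] .
    define d where "d j q = g q (s q) (w j q) / g q (w j q) (w j q)" for j q
    have sV: "smooth_section_on M A V s"
      by (rule section_subset[OF assms(2)]) (use V(3) in blast)
    have d: "smooth_fun_on M V (d j)" if j: "j < k" for j
      unfolding d_def
    proof (rule smooth_fun_on_divide[OF V(1)])
      note wj = w[rule_format, OF j]
      show "smooth_fun_on M V (\<lambda>q. g q (s q) (w j q))" by (rule metric_smooth[OF vbA metric V(1) sV wj])
      show "smooth_fun_on M V (\<lambda>q. g q (w j q) (w j q))" by (rule metric_smooth[OF vbA metric V(1) wj wj])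
      fix q assume q: "q \<in> V"
      interpret inner_fibre "fib A q" "g q" by (rule inner_fibre_A)
      have "w j q \<noteq> 0" using bspec[OF * q] j by blast
      then show "g q (w j q) (w j q) \<noteq> 0" using eq_zero[OF section_mem[OF wj q]] by blast
    qed
    have "smooth_fun_on M V (\<lambda>q. \<Sum>j<k. d j q * b j i q)"
      by (intro smooth_fun_on_sum[OF V(1)] smooth_fun_on_mult[OF V(1)]) (use d b i in auto)
    then have "smooth_fun_on M V (c i)"
    proof (rule smooth_fun_on_cong[OF V(1)])
      fix q assume q: "q \<in> V"
      then have qU: "q \<in> U" "q \<in> W" using V(3) by auto
      interpret inner_fibre "fib A q" "g q" by (rule inner_fibre_A)
      have sK: "s q \<in> fib K q" by (rule assms(3)[OF qU(2)])
      then have sA: "s q \<in> fib A q" by (simp add: fib_K)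
      have em: "e i q \<in> fib K q" if "i < k" for i by (rule basis_family_mem[OF bf[OF qU(1)] that])
      then have eA: "e i q \<in> fib A q" if "i < k" for i using that by (simp add: fib_K)
      have wq: "w j q = (\<Sum>i<k. b j i q *\<^sub>R e i q)" if "j < k" for j
        using bspec[OF * q] that by blast
      have wm: "w j q \<in> fib A q" if "j < k" for j by (rule section_mem[OF w[rule_format, OF that] q])
      have wK: "w j q \<in> fib K q" if "j < k" for j
        unfolding wq[OF that] using em by (intro subspace_sum subspace_scale subspace_K) auto
      \<comment> \<open>The remainder lies in the kernel and is orthogonal to the
        \<open>w j\<close>, hence to the frame \<open>e\<close> by the Gram-Schmidt clause, hence to
        itself.\<close>
      define r where "r = s q - proj k (\<lambda>j. w j q) (s q)"
      have "proj k (\<lambda>j. w j q) (s q) \<in> fib K q"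
        unfolding proj_def using wK by (intro subspace_sum subspace_scale subspace_K) auto
      then have rK: "r \<in> fib K q" unfolding r_def by (rule subspace_diff[OF subspace_K sK])
      then have rA: "r \<in> fib A q" by (simp add: fib_K)
      have "g q r (w j q) = 0" if "j < k" for j
        unfolding r_def by (rule proj_orthogonal) (use wm sA that bspec[OF * q] in auto)
      then have re: "\<forall>j<k. g q r (e j q) = 0" using bspec[OF * q] rA by blast
      have "g q r r = g q r (\<Sum>i<k. frame_coef k (\<lambda>i. e i q) r i *\<^sub>R e i q)"
        by (simp add: frame_coef_expand[OF bf[OF qU(1)] rK])
      also have "\<dots> = (\<Sum>i<k. frame_coef k (\<lambda>i. e i q) r i * g q r (e i q))"
        by (rule lincomb_right) (use eA rA in auto)
      also have "\<dots> = 0" using re by simp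
      finally have "r = 0" by (rule eq_zero[OF rA])
      then have "s q = (\<Sum>j<k. d j q *\<^sub>R w j q)" by (simp add: r_def proj_def d_def)
      also have "\<dots> = (\<Sum>j<k. \<Sum>i<k. (d j q * b j i q) *\<^sub>R e i q)"
        using wq by (simp add: scaleR_sum_right)
      also have "\<dots> = (\<Sum>i<k. (\<Sum>j<k. d j q * b j i q) *\<^sub>R e i q)"
        unfolding scaleR_sum_left by (rule sum.swap)
      finally have "(\<Sum>i<k. (\<Sum>j<k. d j q * b j i q) *\<^sub>R e i q) = s q" by simp
      from frame_coef_unique[OF bf[OF qU(1)] this sK i]
      show "(\<Sum>j<k. d j q * b j i q) = c i q" by (simp add: c_def)
    qed
    then show "\<exists>W'. open W' \<and> p \<in> W' \<and> smooth_fun_on M W' (c i)" using V by blast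
  qed
  moreover have "s p = (\<Sum>i<k. c i p *\<^sub>R e i p)" if "p \<in> U \<inter> W" for p
    unfolding c_def using frame_coef_expand[OF bf assms(3)] that by simp
  ultimately show "\<exists>c. (\<forall>i<k. smooth_fun_on M (U \<inter> W) (c i)) \<and>
      (\<forall>p\<in>U \<inter> W. s p = (\<Sum>i<k. c i p *\<^sub>R e i p))"
    by (intro exI[of _ c]) simp
qed

lemma vector_bundle_K: "vector_bundle M K"
  unfolding vector_bundle_def
proof (intro conjI allI ballI)
  show "subspace (fib K p)" for p by (rule subspace_K)
  show "(\<Union>(U, k, e)\<in>frames K. U) = UNIV"
  proof (intro equalityI subset_UNIV subsetI)
    fix p
    obtain U k e where "(U, k, e) \<in> frames K" "p \<in> U" using kernel_frame .
    then show "p \<in> (\<Union>(U, k, e)\<in>frames K. U)" by blast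
  qed
  fix x assume x: "x \<in> frames K"
  obtain U k e where xe: "x = (U, k, e)" by (cases x)
  have U: "open U" and e: "\<And>i. i < k \<Longrightarrow> smooth_section_on M A U (e i)"
    and bf: "\<And>p. p \<in> U \<Longrightarrow> basis_family k (\<lambda>i. e i p) (fib K p)"
    using x by (auto simp: frames_K xe)
  have "smooth_section_on M K U (e i)" if "i < k" for i
    by (rule kernel_section_of_section[OF U e[OF that] basis_family_mem[OF bf that]])
  then show "case x of (U, k, e) \<Rightarrow> open U \<and> (\<forall>p\<in>U. basis_family k (\<lambda>i. e i p) (fib K p)) \<and>
      (\<forall>i<k. smooth_section_on M K U (e i))"
    using U bf by (simp add: xe)
qed

lemma section_of_kernel_section:
  assumes "open W" "smooth_section_on M K W s"
  shows "smooth_section_on M A W s"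
proof (rule section_local[OF vbA])
  fix p assume p: "p \<in> W"
  obtain U k e where f: "(U, k, e) \<in> frames K" "p \<in> U" using kernel_frame .
  then have U: "open U" and e: "\<And>i. i < k \<Longrightarrow> smooth_section_on M A U (e i)"
    by (auto simp: frames_K)
  have o: "open (U \<inter> W)" using U assms(1) by blast
  obtain c where c: "\<forall>i<k. smooth_fun_on M (U \<inter> W) (c i)"
      "\<forall>p\<in>U \<inter> W. s p = (\<Sum>i<k. c i p *\<^sub>R e i p)"
    using section_coefs[OF assms(2) f(1)] .
  have "smooth_section_on M A (U \<inter> W) (\<lambda>p. \<Sum>i<k. c i p *\<^sub>R e i p)"
  proof (rule section_lincomb[OF vbA o])
    fix i assume "i \<in> {..<k}"
    then show "smooth_fun_on M (U \<inter> W) (c i)" using c(1) by simp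
    show "smooth_section_on M A (U \<inter> W) (e i)"
      by (rule section_subset[OF e]) (use \<open>i \<in> {..<k}\<close> in auto)
  qed
  then have "smooth_section_on M A (U \<inter> W) s"
    by (rule section_cong) (use c(2) in simp)
  then show "\<exists>W'. open W' \<and> p \<in> W' \<and> smooth_section_on M A W' s" using o p f(2) by blast
qed

text \<open>Makes \<iota> literally the identity on sections: from here on, smoothness in
  \<open>ker #\<close> is smoothness in \<open>A\<close> together with a pointwise
  condition.\<close>

lemma sections_K_iff: "X \<in> sections M K \<longleftrightarrow> X \<in> sections M A \<and> (\<forall>p. X p \<in> fib K p)"
proof
  assume X: "X \<in> sections M K"
  have "smooth_section_on M A UNIV X" by (rule section_of_kernel_section[OF open_UNIV sectionsD(1)[OF X]])
  then show "X \<in> sections M A \<and> (\<forall>p. X p \<in> fib K p)" using sectionsD(2)[OF X] by (simp add: sections_def)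
next
  assume "X \<in> sections M A \<and> (\<forall>p. X p \<in> fib K p)"
  then have "smooth_section_on M K UNIV X"
    by (intro kernel_section_of_section[OF open_UNIV sectionsD(1)]) auto
  then show "X \<in> sections M K" by (simp add: sections_def)
qed

end

section \<open>Derivations and their blocks\<close>

lemma mem_so_derivations:
  "(S, D) \<in> secs (so_derivations M E g) \<longleftrightarrow>
     S \<in> sections M (TB M) \<and> D \<in> sections M E \<rightarrow>\<^sub>E sections M E \<and>
     (\<forall>X\<in>sections M E. \<forall>Y\<in>sections M E. D (\<lambda>p. X p + Y p) = (\<lambda>p. D X p + D Y p)) \<and>
     (\<forall>X\<in>sections M E. \<forall>r. D (\<lambda>p. r *\<^sub>R X p) = (\<lambda>p. r *\<^sub>R D X p)) \<and>
     (\<forall>X\<in>sections M E. \<forall>f\<in>Cinf M.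
        D (\<lambda>p. f p *\<^sub>R X p) = (\<lambda>p. act (S p) f *\<^sub>R X p + f p *\<^sub>R D X p)) \<and>
     (\<forall>Y\<in>sections M E. \<forall>Z\<in>sections M E. \<forall>p.
        act (S p) (\<lambda>q. g q (Y q) (Z q)) = g p (D Y p) (Z p) + g p (Y p) (D Z p))"
  by (simp add: so_derivations_def derivations_def)

lemma so_derivation:
  assumes "(S, D) \<in> secs (so_derivations M E g)"
  shows "S \<in> sections M (TB M)" "D \<in> sections M E \<rightarrow>\<^sub>E sections M E"
    "X \<in> sections M E \<Longrightarrow> D X \<in> sections M E"
    "X \<in> sections M E \<Longrightarrow> Y \<in> sections M E \<Longrightarrow> D (\<lambda>p. X p + Y p) = (\<lambda>p. D X p + D Y p)"
    "X \<in> sections M E \<Longrightarrow> D (\<lambda>p. r *\<^sub>R X p) = (\<lambda>p. r *\<^sub>R D X p)"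
    "X \<in> sections M E \<Longrightarrow> f \<in> Cinf M \<Longrightarrow>
      D (\<lambda>p. f p *\<^sub>R X p) = (\<lambda>p. act (S p) f *\<^sub>R X p + f p *\<^sub>R D X p)"
    "X \<in> sections M E \<Longrightarrow> Y \<in> sections M E \<Longrightarrow>
      act (S p) (\<lambda>q. g q (X q) (Y q)) = g p (D X p) (Y p) + g p (X p) (D Y p)"
  using assms unfolding mem_so_derivations by (auto simp: PiE_mem)

section \<open>Uniqueness of the Levi-Civita connection\<close>

lemma levi_civitaD:
  assumes "levi_civita M E g nabla"
  shows "X \<in> sections M E \<Longrightarrow> nabla X \<in> secs (so_derivations M E g)"
    "X \<in> sections M E \<Longrightarrow> fst (nabla X) = (\<lambda>p. anchor E p (X p))"
    "X \<in> sections M E \<Longrightarrow> Y \<in> sections M E \<Longrightarrow>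
      snd (nabla X) Y p - snd (nabla Y) X p = brkt E X Y p"
  using assms unfolding levi_civita_def anchored_map_def
  by (simp_all add: section_module_of_def so_derivations_def fun_eq_iff)

text \<open>
  The difference \<open>T X Y Z = \<langle>\<nabla>\<^sub>X Y - \<nabla>'\<^sub>X Y, Z\<rangle>\<close> is symmetric in \<open>X, Y\<close> and skew in \<open>Y, Z\<close>, hence zero.
\<close>
lemma (in manifold) levi_civita_unique:
  assumes E: "vector_bundle M E" and inner: "\<And>p. inner_fibre (fib E p) (g p)"
    and lc: "levi_civita M E g nabla"
    and der: "\<And>X. X \<in> sections M E \<Longrightarrow> nabla' X \<in> secs (so_derivations M E g)"
    and anch: "\<And>X. X \<in> sections M E \<Longrightarrow> fst (nabla' X) = (\<lambda>p. anchor E p (X p))"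
    and torsion: "\<And>X Y p. X \<in> sections M E \<Longrightarrow> Y \<in> sections M E \<Longrightarrow>
      snd (nabla' X) Y p - snd (nabla' Y) X p = brkt E X Y p"
    and X: "X \<in> sections M E"
  shows "nabla X = nabla' X"
proof (rule prod_eqI)
  show "fst (nabla X) = fst (nabla' X)" using levi_civitaD(2)[OF lc X] anch[OF X] by simp
  have der1: "(fst (nabla X), snd (nabla X)) \<in> secs (so_derivations M E g)"
    and der2: "(fst (nabla' X), snd (nabla' X)) \<in> secs (so_derivations M E g)"
    if "X \<in> sections M E" for X
    using levi_civitaD(1)[OF lc that] der[OF that] by simp_all
  define B where "B X Y p = snd (nabla X) Y p - snd (nabla' X) Y p" for X Y p
  have B_sec: "B X Y \<in> sections M E" if "X \<in> sections M E" "Y \<in> sections M E" for X Y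
    unfolding B_def sections_def mem_Collect_eq
    by (intro section_diff[OF E open_UNIV] sectionsD(1) so_derivation(3)[OF der1] so_derivation(3)[OF der2] that)
  have B_sym: "B X Y = B Y X" if "X \<in> sections M E" "Y \<in> sections M E" for X Y
  proof
    fix p
    have "snd (nabla X) Y p - snd (nabla Y) X p = snd (nabla' X) Y p - snd (nabla' Y) X p"
      by (simp only: levi_civitaD(3)[OF lc that] torsion[OF that])
    then show "B X Y p = B Y X p" by (simp add: B_def algebra_simps)
  qed
  define T where "T X Y Z p = g p (B X Y p) (Z p)" for X Y Z p
  have T_sym: "T X Y Z p = T Y X Z p" if "X \<in> sections M E" "Y \<in> sections M E" for X Y Z p
    by (simp add: T_def B_sym[OF that])
  have T_skew: "T X Y Z p = - T X Z Y p"
    if s: "X \<in> sections M E" "Y \<in> sections M E" "Z \<in> sections M E" for X Y Z p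
  proof -
    interpret inner_fibre "fib E p" "g p" by (rule inner)
    have m: "Y p \<in> fib E p" "Z p \<in> fib E p" "snd (nabla X) Y p \<in> fib E p" "snd (nabla' X) Y p \<in> fib E p"
      "snd (nabla X) Z p \<in> fib E p" "snd (nabla' X) Z p \<in> fib E p" "B X Z p \<in> fib E p"
      using sectionsD(2)[OF s(2)] sectionsD(2)[OF s(3)] sectionsD(2)[OF B_sec[OF s(1,3)]]
        sectionsD(2)[OF so_derivation(3)[OF der1[OF s(1)] s(2)]]
        sectionsD(2)[OF so_derivation(3)[OF der2[OF s(1)] s(2)]]
        sectionsD(2)[OF so_derivation(3)[OF der1[OF s(1)] s(3)]]
        sectionsD(2)[OF so_derivation(3)[OF der2[OF s(1)] s(3)]] by simp_all
    have "g p (snd (nabla X) Y p) (Z p) + g p (Y p) (snd (nabla X) Z p)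
        = g p (snd (nabla' X) Y p) (Z p) + g p (Y p) (snd (nabla' X) Z p)"
      using so_derivation(7)[OF der1[OF s(1)] s(2,3), of p] so_derivation(7)[OF der2[OF s(1)] s(2,3), of p]
        levi_civitaD(2)[OF lc s(1)] anch[OF s(1)] by simp
    then have "T X Y Z p = - g p (Y p) (B X Z p)"
      using m by (simp add: T_def B_def diff_left diff_right)
    then show ?thesis using sym[OF m(1) m(7)] by (simp add: T_def)
  qed
  have B0: "B X Y p = 0" if Y: "Y \<in> sections M E" for Y p
  proof -
    interpret inner_fibre "fib E p" "g p" by (rule inner)
    \<comment> \<open>With this choice \<open>T X Y Z\<close> is the squared length of
      \<open>B X Y\<close>. Six alternating swaps return to the same triple with the opposite
      sign.\<close>
    define Z where "Z = B X Y"
    have Z: "Z \<in> sections M E" unfolding Z_def by (rule B_sec[OF X Y])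
    have "T X Y Z p = - T Y Z X p" using T_sym[OF X Y] T_skew[OF Y X Z] by simp
    also have "\<dots> = T Z X Y p" using T_sym[OF Y Z] T_skew[OF Z Y X] by simp
    also have "\<dots> = - T X Y Z p" using T_sym[OF Z X] T_skew[OF X Z Y] by simp
    finally have "g p (B X Y p) (B X Y p) = 0" by (simp add: T_def Z_def)
    then show ?thesis by (rule eq_zero[OF sectionsD(2)[OF B_sec[OF X Y]]])
  qed
  show "snd (nabla X) = snd (nabla' X)"
  proof (rule PiE_ext[OF so_derivation(2)[OF der1[OF X]] so_derivation(2)[OF der2[OF X]]])
    fix Y assume "Y \<in> sections M E"
    then show "snd (nabla X) Y = snd (nabla' X) Y"
      using B0[of Y] by (intro ext) (simp add: B_def)
  qed
qed

section \<open>From operators on sections to bundle maps\<close>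

context manifold
begin

lemma sections_add:
  "vector_bundle M E \<Longrightarrow> X \<in> sections M E \<Longrightarrow> Y \<in> sections M E \<Longrightarrow> (\<lambda>p. X p + Y p) \<in> sections M E"
  unfolding sections_def mem_Collect_eq by (rule section_add[OF _ open_UNIV])

lemma sections_diff:
  "vector_bundle M E \<Longrightarrow> X \<in> sections M E \<Longrightarrow> Y \<in> sections M E \<Longrightarrow> (\<lambda>p. X p - Y p) \<in> sections M E"
  unfolding sections_def mem_Collect_eq by (rule section_diff[OF _ open_UNIV])

lemma sections_scale:
  "vector_bundle M E \<Longrightarrow> f \<in> Cinf M \<Longrightarrow> X \<in> sections M E \<Longrightarrow> (\<lambda>p. f p *\<^sub>R X p) \<in> sections M E"
  unfolding sections_def Cinf_def mem_Collect_eq by (rule section_scale[OF _ open_UNIV])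

lemma const_Cinf: "(\<lambda>p. r) \<in> Cinf M"
  by (simp add: Cinf_def smooth_fun_on_const)

lemma fibre_map_eq:
  assumes "\<And>X Y p. X \<in> sections M E \<Longrightarrow> Y \<in> sections M E \<Longrightarrow> X p = Y p \<Longrightarrow> L X p = L Y p"
    "X \<in> sections M E"
  shows "fibre_map M E L p (X p) = L X p"
  unfolding fibre_map_def
proof (rule the_equality)
  show "\<exists>Y\<in>sections M E. Y p = X p \<and> L X p = L Y p" using assms(2) by blast
  fix w assume "\<exists>Y\<in>sections M E. Y p = X p \<and> w = L Y p"
  then obtain Y where "Y \<in> sections M E" "Y p = X p" "w = L Y p" by blast
  then show "w = L X p" using assms(1)[OF _ assms(2)] by simp
qed

text \<open>Dependence on point values makes the \<open>THE\<close> well defined. Fibrewise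
  linearity is seen on global sections through the given vectors, and smoothness on a global section
  that agrees with a frame section near the point, where the fibre map is just \<open>L\<close> of
  that section.\<close>

lemma fibre_map_bundle_map:
  assumes E: "vector_bundle M E" and F: "vector_bundle M F" and L: "Cinf_linear M E F L"
    and local: "\<And>X Y p. X \<in> sections M E \<Longrightarrow> Y \<in> sections M E \<Longrightarrow> X p = Y p \<Longrightarrow> L X p = L Y p"
  shows "bundle_map M E F (fibre_map M E L)"
proof -
  have eq: "fibre_map M E L p (X p) = L X p" if "X \<in> sections M E" for X p
    by (rule fibre_map_eq[OF _ that]) (rule local)
  have L_sec: "L X \<in> sections M F" if "X \<in> sections M E" for X
    using L that by (simp add: Cinf_linear_def)
  have mem: "fibre_map M E L p a \<in> fib F p" if a: "a \<in> fib E p" for p a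
  proof -
    obtain X where X: "X \<in> sections M E" "X p = a" using global_section_through[OF E a] .
    then show ?thesis using eq[OF X(1), of p] sectionsD(2)[OF L_sec[OF X(1)], of p] by simp
  qed
  have add: "fibre_map M E L p (a + b) = fibre_map M E L p a + fibre_map M E L p b"
    if a: "a \<in> fib E p" and b: "b \<in> fib E p" for p a b
  proof -
    obtain X where X: "X \<in> sections M E" "X p = a" using global_section_through[OF E a] .
    obtain Y where Y: "Y \<in> sections M E" "Y p = b" using global_section_through[OF E b] .
    have "L (\<lambda>p. X p + Y p) = (\<lambda>p. L X p + L Y p)" using L X(1) Y(1) by (simp add: Cinf_linear_def)
    then show ?thesis
      using eq[OF X(1), of p] eq[OF Y(1), of p] eq[OF sections_add[OF E X(1) Y(1)], of p]
        X(2) Y(2) by simp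
  qed
  have scale: "fibre_map M E L p (r *\<^sub>R a) = r *\<^sub>R fibre_map M E L p a" if a: "a \<in> fib E p" for p a r
  proof -
    obtain X where X: "X \<in> sections M E" "X p = a" using global_section_through[OF E a] .
    have "L (\<lambda>p. r *\<^sub>R X p) = (\<lambda>p. r *\<^sub>R L X p)"
      using L X(1) const_Cinf by (simp add: Cinf_linear_def)
    then show ?thesis
      using eq[OF X(1), of p] eq[OF sections_scale[OF E const_Cinf X(1)], of p] X(2) by simp
  qed
  have smooth: "smooth_section_on M F U (\<lambda>p. fibre_map M E L p (e i p))"
    if f: "(U, k, e) \<in> frames E" and i: "i < k" for U k e i
  proof (rule section_local[OF F])
    fix p assume p: "p \<in> U"
    note fr = vector_bundle_frame[OF E f]
    obtain X V where X: "X \<in> sections M E" and V: "open V" "p \<in> V" "V \<subseteq> U" "\<forall>q\<in>V. X q = e i q"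
      using section_extend[OF E fr(1) p fr(3)[OF i]] .
    have "smooth_section_on M F V (L X)"
      by (rule section_subset[OF sectionsD(1)[OF L_sec[OF X]]]) simp
    then have "smooth_section_on M F V (\<lambda>p. fibre_map M E L p (e i p))"
    proof (rule section_cong)
      fix q assume "q \<in> V"
      then show "L X q = fibre_map M E L q (e i q)" using eq[OF X, of q] V(4) by simp
    qed
    then show "\<exists>W'. open W' \<and> p \<in> W' \<and> smooth_section_on M F W' (\<lambda>p. fibre_map M E L p (e i p))"
      using V(1,2) by blast
  qed
  show ?thesis
    unfolding bundle_map_def
  proof (intro conjI allI ballI)
    fix x assume "x \<in> frames E"
    then show "case x of (U, k, e) \<Rightarrow> \<forall>i<k. smooth_section_on M F U (\<lambda>p. fibre_map M E L p (e i p))"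
      using smooth by (cases x) simp
  qed (use mem add scale in auto)
qed

end

section \<open>Algebra of \<gamma> and \<omega> and the induced metrics\<close>

context riemannian_submersion
begin

abbreviation "\<gamma> \<equiv> hlift A g"
abbreviation "\<omega> \<equiv> vproj A g"

lemma TB_subspace: "subspace (fib (TB M) p)"
  by (rule vector_bundle_subspace[OF vector_bundle_TB])

lemma hlift_add:
  assumes "S \<in> fib (TB M) p" "T \<in> fib (TB M) p"
  shows "\<gamma> p (S + T) = \<gamma> p S + \<gamma> p T"
proof (rule hlift_unique)
  interpret inner_fibre "fib A p" "g p" by (rule inner_fibre_A)
  note h = hlift[OF assms(1)] hlift[OF assms(2)]
  show "\<gamma> p S + \<gamma> p T \<in> fib A p" using add_mem h by blast
  show "g p (\<gamma> p S + \<gamma> p T) v = 0" if "v \<in> fib K p" for v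
    using add_left[OF h(1,4)] h(2,5)[OF that] that by (simp add: fib_K)
  show "anchor A p (\<gamma> p S + \<gamma> p T) = S + T" using anchor_add h by simp
qed

lemma hlift_scale:
  assumes "S \<in> fib (TB M) p"
  shows "\<gamma> p (r *\<^sub>R S) = r *\<^sub>R \<gamma> p S"
proof (rule hlift_unique)
  interpret inner_fibre "fib A p" "g p" by (rule inner_fibre_A)
  note h = hlift[OF assms(1)]
  show "r *\<^sub>R \<gamma> p S \<in> fib A p" using scale_mem h by blast
  show "g p (r *\<^sub>R \<gamma> p S) v = 0" if "v \<in> fib K p" for v
    using scale_left[OF h(1)] h(2)[OF that] that by (simp add: fib_K)
  show "anchor A p (r *\<^sub>R \<gamma> p S) = r *\<^sub>R S" using anchor_scale h by simp
qed

lemma vproj_add: "a \<in> fib A p \<Longrightarrow> b \<in> fib A p \<Longrightarrow> \<omega> p (a + b) = \<omega> p a + \<omega> p b"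
  by (simp add: vproj_def anchor_add hlift_add anchor_mem)

lemma vproj_scale: "a \<in> fib A p \<Longrightarrow> \<omega> p (r *\<^sub>R a) = r *\<^sub>R \<omega> p a"
  by (simp add: vproj_def anchor_scale hlift_scale anchor_mem scaleR_diff_right)

lemma vproj_hlift: "S \<in> fib (TB M) p \<Longrightarrow> \<omega> p (\<gamma> p S) = 0"
  by (simp add: vproj_def hlift)

text \<open>\<open>a - \<omega> p a\<close> is horizontal and therefore invisible to vertical
  \<open>v\<close>. Together with \<open>metric_hlift\<close> this removes the projections from
  metric identities.\<close>

lemma metric_vproj:
  assumes "a \<in> fib A p" "v \<in> fib K p"
  shows "g p (\<omega> p a) v = g p a v"
proof -
  interpret inner_fibre "fib A p" "g p" by (rule inner_fibre_A)
  have S: "anchor A p a \<in> fib (TB M) p" by (rule anchor_mem[OF assms(1)])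
  show ?thesis
    using diff_left[OF assms(1) hlift(1)[OF S], of v] hlift(2)[OF S assms(2)] assms(2)
    by (simp add: vproj_def fib_K)
qed

text \<open>\<open>a\<close> differs from the lift of its anchor by its vertical part, which is
  orthogonal to every lift.\<close>

lemma metric_hlift:
  assumes "a \<in> fib A p" "S \<in> fib (TB M) p"
  shows "g p (\<gamma> p S) (\<gamma> p (anchor A p a)) = g p (\<gamma> p S) a"
proof -
  interpret inner_fibre "fib A p" "g p" by (rule inner_fibre_A)
  have T: "anchor A p a \<in> fib (TB M) p" by (rule anchor_mem[OF assms(1)])
  have "g p (\<gamma> p S) (\<omega> p a) = 0" by (rule hlift(2)[OF assms(2) vproj_mem[OF assms(1)]])
  then show ?thesis
    using diff_right[OF assms(1) hlift(1)[OF T] hlift(1)[OF assms(2)]] by (simp add: vproj_def)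
qed

lemma inner_fibre_TB: "inner_fibre (fib (TB M) p) (metric_TB A g p)"
proof -
  interpret inner_fibre "fib A p" "g p" by (rule inner_fibre_A)
  show ?thesis
  proof
    show "subspace (fib (TB M) p)" by (rule TB_subspace)
    show "metric_TB A g p a b = metric_TB A g p b a" if "a \<in> fib (TB M) p" "b \<in> fib (TB M) p" for a b
      unfolding metric_TB_def by (rule sym[OF hlift(1)[OF that(1)] hlift(1)[OF that(2)]])
    show "metric_TB A g p (a + b) c = metric_TB A g p a c + metric_TB A g p b c"
      if "a \<in> fib (TB M) p" "b \<in> fib (TB M) p" "c \<in> fib (TB M) p" for a b c
      unfolding metric_TB_def using that by (simp add: hlift_add add_left hlift(1))
    show "metric_TB A g p (r *\<^sub>R a) b = r * metric_TB A g p a b"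
      if "a \<in> fib (TB M) p" "b \<in> fib (TB M) p" for a b r
      unfolding metric_TB_def using that by (simp add: hlift_scale scale_left hlift(1))
    show "metric_TB A g p a a > 0" if "a \<in> fib (TB M) p" "a \<noteq> 0" for a
    proof -
      \<comment> \<open>\<gamma> is injective because the anchor is a left inverse of it.\<close>
      have "\<gamma> p a \<noteq> 0"
      proof
        assume "\<gamma> p a = 0"
        then have "a = anchor A p 0" using hlift(3)[OF that(1)] by simp
        then show False using that(2) anchor_scale[OF zero_mem, of 0] by simp
      qed
      then show ?thesis unfolding metric_TB_def by (rule pos[OF hlift(1)[OF that(1)]])
    qed
  qed
qed

lemma inner_fibre_K: "inner_fibre (fib K p) (metric_ker g p)"
proof -
  interpret inner_fibre "fib A p" "g p" by (rule inner_fibre_A)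
  show ?thesis
    unfolding metric_ker_def
    by unfold_locales (use subspace_K sym add_left scale_left pos in \<open>auto simp: fib_K\<close>)
qed

lemma hlift_sections: "T \<in> sections M (TB M) \<Longrightarrow> (\<lambda>q. \<gamma> q (T q)) \<in> sections M A"
  unfolding sections_def mem_Collect_eq by (rule hlift_smooth[OF open_UNIV])

lemma anchor_sections: "X \<in> sections M A \<Longrightarrow> (\<lambda>q. anchor A q (X q)) \<in> sections M (TB M)"
  unfolding sections_def mem_Collect_eq by (rule anchor_smooth[OF open_UNIV])

lemma vproj_sections: "X \<in> sections M A \<Longrightarrow> (\<lambda>q. \<omega> q (X q)) \<in> sections M K"
  unfolding sections_K_iff using vproj_smooth[OF open_UNIV] vproj_mem
  by (auto simp: sections_def section_mem)

lemma K_section: "V \<in> sections M K \<Longrightarrow> V \<in> sections M A"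
  by (simp add: sections_K_iff)

lemma brkt_anchor:
  assumes "X \<in> sections M A" "Y \<in> sections M A"
  shows "brkt A X Y \<in> sections M A"
    "anchor A p (brkt A X Y p) = vf_bracket (\<lambda>p. anchor A p (X p)) (\<lambda>p. anchor A p (Y p)) p"
proof -
  have "\<forall>X\<in>sections M A. \<forall>Y\<in>sections M A. brkt A X Y \<in> sections M A"
    using lie unfolding lie_algebroid_def by (elim conjE)
  then show "brkt A X Y \<in> sections M A" using assms by blast
  have "\<forall>X\<in>sections M A. \<forall>Y\<in>sections M A. (\<lambda>p. anchor A p (brkt A X Y p)) =
          vf_bracket (\<lambda>p. anchor A p (X p)) (\<lambda>p. anchor A p (Y p))"
    using lie unfolding lie_algebroid_def by (elim conjE)
  then show "anchor A p (brkt A X Y p) = vf_bracket (\<lambda>p. anchor A p (X p)) (\<lambda>p. anchor A p (Y p)) p"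
    using assms by (metis (no_types, lifting))
qed

section \<open>The diagonal blocks\<close>

lemma block_TB_derivation:
  assumes "(S, D) \<in> secs (so_derivations M A g)"
  shows "block_TB M A g (S, D) \<in> secs (so_derivations M (TB M) (metric_TB A g))"
proof -
  note D = so_derivation[OF assms]
  note \<gamma>D = D(3)[OF hlift_sections]
  have mem: "D (\<lambda>q. \<gamma> q (T q)) p \<in> fib A p" "T p \<in> fib (TB M) p" if "T \<in> sections M (TB M)" for T p
    using sectionsD(2)[OF \<gamma>D[OF that]] sectionsD(2)[OF that] by auto
  have add: "(\<lambda>q. \<gamma> q (X q + Y q)) = (\<lambda>q. \<gamma> q (X q) + \<gamma> q (Y q))"
    if "X \<in> sections M (TB M)" "Y \<in> sections M (TB M)" for X Y
    using mem that by (simp add: hlift_add)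
  have scale: "(\<lambda>q. \<gamma> q (f q *\<^sub>R X q)) = (\<lambda>q. f q *\<^sub>R \<gamma> q (X q))" if "X \<in> sections M (TB M)" for f X
    using mem that by (simp add: hlift_scale)
  note [simp] = sections_add[OF vector_bundle_TB] sections_scale[OF vector_bundle_TB]
    sections_scale[OF vector_bundle_TB const_Cinf] scale add
  show ?thesis
    unfolding block_TB_def prod.case mem_so_derivations
  proof (intro conjI ballI allI)
    show "S \<in> sections M (TB M)" by (rule D(1))
    show "(\<lambda>T\<in>sections M (TB M). \<lambda>p. anchor A p (D (\<lambda>q. \<gamma> q (T q)) p))
        \<in> sections M (TB M) \<rightarrow>\<^sub>E sections M (TB M)"
      by (intro PiE_I) (simp_all add: anchor_sections \<gamma>D)
  next
    fix X Y assume "X \<in> sections M (TB M)" "Y \<in> sections M (TB M)"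
    then show "(\<lambda>T\<in>sections M (TB M). \<lambda>p. anchor A p (D (\<lambda>q. \<gamma> q (T q)) p)) (\<lambda>p. X p + Y p)
      = (\<lambda>p. (\<lambda>T\<in>sections M (TB M). \<lambda>p. anchor A p (D (\<lambda>q. \<gamma> q (T q)) p)) X p
        + (\<lambda>T\<in>sections M (TB M). \<lambda>p. anchor A p (D (\<lambda>q. \<gamma> q (T q)) p)) Y p)"
      by (simp add: D(4) hlift_sections anchor_add mem)
  next
    fix X r assume "X \<in> sections M (TB M)"
    then show "(\<lambda>T\<in>sections M (TB M). \<lambda>p. anchor A p (D (\<lambda>q. \<gamma> q (T q)) p)) (\<lambda>p. r *\<^sub>R X p)
      = (\<lambda>p. r *\<^sub>R (\<lambda>T\<in>sections M (TB M). \<lambda>p. anchor A p (D (\<lambda>q. \<gamma> q (T q)) p)) X p)"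
      by (simp add: D(5) hlift_sections anchor_scale mem)
  next
    fix X f assume X: "X \<in> sections M (TB M)" and f: "f \<in> Cinf M"
    \<comment> \<open>The anchor undoes the lift, so the derivative term of the Leibniz rule
      reappears with \<open>X\<close> itself.\<close>
    have "anchor A p (act (S p) f *\<^sub>R \<gamma> p (X p) + f p *\<^sub>R D (\<lambda>q. \<gamma> q (X q)) p)
        = act (S p) f *\<^sub>R X p + f p *\<^sub>R anchor A p (D (\<lambda>q. \<gamma> q (X q)) p)" for p
    proof -
      interpret inner_fibre "fib A p" "g p" by (rule inner_fibre_A)
      show ?thesis using mem[OF X] by (simp add: anchor_add anchor_scale hlift scale_mem)
    qed
    then show "(\<lambda>T\<in>sections M (TB M). \<lambda>p. anchor A p (D (\<lambda>q. \<gamma> q (T q)) p)) (\<lambda>p. f p *\<^sub>R X p)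
      = (\<lambda>p. act (S p) f *\<^sub>R X p
        + f p *\<^sub>R (\<lambda>T\<in>sections M (TB M). \<lambda>p. anchor A p (D (\<lambda>q. \<gamma> q (T q)) p)) X p)"
      using X f by (simp add: D(6) hlift_sections)
  next
    fix Y Z p assume YZ: "Y \<in> sections M (TB M)" "Z \<in> sections M (TB M)"
    interpret inner_fibre "fib A p" "g p" by (rule inner_fibre_A)
    let ?DY = "D (\<lambda>q. \<gamma> q (Y q)) p" and ?DZ = "D (\<lambda>q. \<gamma> q (Z q)) p"
    \<comment> \<open>Paired with a lift, \<open>?DY\<close> and its horizontal part give the same
      value, so the metric rule for \<open>D\<close> becomes that of the block.\<close>
    have "g p (\<gamma> p (anchor A p ?DY)) (\<gamma> p (Z p)) = g p ?DY (\<gamma> p (Z p))"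
      using metric_hlift[OF mem(1)[OF YZ(1)] mem(2)[OF YZ(2)]]
        sym[OF hlift(1)[OF anchor_mem[OF mem(1)[OF YZ(1)]]] hlift(1)[OF mem(2)[OF YZ(2)]]]
        sym[OF mem(1)[OF YZ(1)] hlift(1)[OF mem(2)[OF YZ(2)]]] by simp
    then show "act (S p) (\<lambda>q. metric_TB A g q (Y q) (Z q))
      = metric_TB A g p ((\<lambda>T\<in>sections M (TB M). \<lambda>p. anchor A p (D (\<lambda>q. \<gamma> q (T q)) p)) Y p) (Z p)
      + metric_TB A g p (Y p) ((\<lambda>T\<in>sections M (TB M). \<lambda>p. anchor A p (D (\<lambda>q. \<gamma> q (T q)) p)) Z p)"
      using D(7)[OF hlift_sections[OF YZ(1)] hlift_sections[OF YZ(2)], of p]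
        metric_hlift[OF mem(1)[OF YZ(2)] mem(2)[OF YZ(1)]] YZ
      by (simp add: metric_TB_def)
  qed
qed

lemma block_ker_derivation:
  assumes "(S, D) \<in> secs (so_derivations M A g)"
  shows "block_ker M A g (S, D) \<in> secs (so_derivations M K (metric_ker g))"
proof -
  note D = so_derivation[OF assms]
  note KD = D(3)[OF K_section]
  have mem: "D V p \<in> fib A p" "V p \<in> fib K p" "V p \<in> fib A p" if "V \<in> sections M K" for V p
    using sectionsD(2)[OF KD[OF that]] sectionsD(2)[OF that] sectionsD(2)[OF K_section[OF that]] by auto
  note [simp] = sections_add[OF vector_bundle_K] sections_scale[OF vector_bundle_K]
    sections_scale[OF vector_bundle_K const_Cinf]
  show ?thesis
    unfolding block_ker_def prod.case mem_so_derivations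
  proof (intro conjI ballI allI)
    show "S \<in> sections M (TB M)" by (rule D(1))
    show "(\<lambda>V\<in>sections M K. \<lambda>p. \<omega> p (D V p)) \<in> sections M K \<rightarrow>\<^sub>E sections M K"
      by (intro PiE_I) (simp_all add: vproj_sections KD)
  next
    fix X Y assume "X \<in> sections M K" "Y \<in> sections M K"
    then show "(\<lambda>V\<in>sections M K. \<lambda>p. \<omega> p (D V p)) (\<lambda>p. X p + Y p)
      = (\<lambda>p. (\<lambda>V\<in>sections M K. \<lambda>p. \<omega> p (D V p)) X p + (\<lambda>V\<in>sections M K. \<lambda>p. \<omega> p (D V p)) Y p)"
      by (simp add: D(4) K_section vproj_add mem)
  next
    fix X r assume "X \<in> sections M K"
    then show "(\<lambda>V\<in>sections M K. \<lambda>p. \<omega> p (D V p)) (\<lambda>p. r *\<^sub>R X p)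
      = (\<lambda>p. r *\<^sub>R (\<lambda>V\<in>sections M K. \<lambda>p. \<omega> p (D V p)) X p)"
      by (simp add: D(5) K_section vproj_scale mem)
  next
    fix X f assume X: "X \<in> sections M K" and f: "f \<in> Cinf M"
    \<comment> \<open>\<omega> fixes the vertical \<open>X\<close>, so the derivative term of the
      Leibniz rule is preserved.\<close>
    have "\<omega> p (act (S p) f *\<^sub>R X p + f p *\<^sub>R D X p) = act (S p) f *\<^sub>R X p + f p *\<^sub>R \<omega> p (D X p)" for p
    proof -
      interpret inner_fibre "fib A p" "g p" by (rule inner_fibre_A)
      show ?thesis using mem[OF X] by (simp add: vproj_add vproj_scale vproj_K scale_mem)
    qed
    then show "(\<lambda>V\<in>sections M K. \<lambda>p. \<omega> p (D V p)) (\<lambda>p. f p *\<^sub>R X p)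
      = (\<lambda>p. act (S p) f *\<^sub>R X p + f p *\<^sub>R (\<lambda>V\<in>sections M K. \<lambda>p. \<omega> p (D V p)) X p)"
      using X f by (simp add: D(6) K_section)
  next
    fix Y Z p assume YZ: "Y \<in> sections M K" "Z \<in> sections M K"
    interpret inner_fibre "fib A p" "g p" by (rule inner_fibre_A)
    have vA: "\<omega> p (D Z p) \<in> fib A p" using vproj_mem[OF mem(1)[OF YZ(2)]] by (simp add: fib_K)
    have "g p (Y p) (\<omega> p (D Z p)) = g p (Y p) (D Z p)"
      using metric_vproj[OF mem(1)[OF YZ(2)] mem(2)[OF YZ(1)]] sym[OF mem(3)[OF YZ(1)] vA]
        sym[OF mem(3)[OF YZ(1)] mem(1)[OF YZ(2)]] by simp
    then show "act (S p) (\<lambda>q. metric_ker g q (Y q) (Z q))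
      = metric_ker g p ((\<lambda>V\<in>sections M K. \<lambda>p. \<omega> p (D V p)) Y p) (Z p)
      + metric_ker g p (Y p) ((\<lambda>V\<in>sections M K. \<lambda>p. \<omega> p (D V p)) Z p)"
      using D(7)[OF K_section[OF YZ(1)] K_section[OF YZ(2)], of p]
        metric_vproj[OF mem(1)[OF YZ(1)] mem(2)[OF YZ(2)]] YZ
      by (simp add: metric_ker_def)
  qed
qed

lemma block_TB_anchored:
  "anchored_map M (so_derivations M A g) (so_derivations M (TB M) (metric_TB A g)) (block_TB M A g)"
  unfolding anchored_map_def
proof (intro conjI ballI)
  fix x assume x: "x \<in> secs (so_derivations M A g)"
  obtain S D where x': "x = (S, D)" by (cases x)
  note D = so_derivation[OF x[unfolded x']]
  have mem: "D (\<lambda>q. \<gamma> q (T q)) p \<in> fib A p" if "T \<in> sections M (TB M)" for T p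
    using sectionsD(2)[OF D(3)[OF hlift_sections[OF that]]] by auto
  show "block_TB M A g x \<in> secs (so_derivations M (TB M) (metric_TB A g))"
    using block_TB_derivation x by (simp add: x')
  show "sanchor (so_derivations M (TB M) (metric_TB A g)) (block_TB M A g x) = sanchor (so_derivations M A g) x"
    by (simp add: so_derivations_def block_TB_def x')
  \<comment> \<open>Off the smooth sections both operators are \<open>undefined\<close>; unfolding
    \<open>restrict\<close> lets equality be checked there too.\<close>
  show "block_TB M A g (smul (so_derivations M A g) f x)
    = smul (so_derivations M (TB M) (metric_TB A g)) f (block_TB M A g x)" for f
    by (auto simp: so_derivations_def block_TB_def x' hlift_sections anchor_scale mem fun_eq_iff restrict_def)
  fix y assume y: "y \<in> secs (so_derivations M A g)"
  obtain S' D' where y': "y = (S', D')" by (cases y)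
  have mem': "D' (\<lambda>q. \<gamma> q (T q)) p \<in> fib A p" if "T \<in> sections M (TB M)" for T p
    using sectionsD(2)[OF so_derivation(3)[OF y[unfolded y'] hlift_sections[OF that]]] by auto
  show "block_TB M A g (sadd (so_derivations M A g) x y)
    = sadd (so_derivations M (TB M) (metric_TB A g)) (block_TB M A g x) (block_TB M A g y)"
    by (auto simp: so_derivations_def block_TB_def x' y' hlift_sections anchor_add mem mem' fun_eq_iff restrict_def)
qed

lemma block_ker_anchored:
  "anchored_map M (so_derivations M A g) (so_derivations M K (metric_ker g)) (block_ker M A g)"
  unfolding anchored_map_def
proof (intro conjI ballI)
  fix x assume x: "x \<in> secs (so_derivations M A g)"
  obtain S D where x': "x = (S, D)" by (cases x)
  note D = so_derivation[OF x[unfolded x']]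
  have mem: "D V p \<in> fib A p" if "V \<in> sections M K" for V p
    using sectionsD(2)[OF D(3)[OF K_section[OF that]]] by auto
  show "block_ker M A g x \<in> secs (so_derivations M K (metric_ker g))"
    using block_ker_derivation x by (simp add: x')
  show "sanchor (so_derivations M K (metric_ker g)) (block_ker M A g x) = sanchor (so_derivations M A g) x"
    by (simp add: so_derivations_def block_ker_def x')
  show "block_ker M A g (smul (so_derivations M A g) f x)
    = smul (so_derivations M K (metric_ker g)) f (block_ker M A g x)" for f
    by (auto simp: so_derivations_def block_ker_def x' K_section vproj_scale mem fun_eq_iff restrict_def)
  fix y assume y: "y \<in> secs (so_derivations M A g)"
  obtain S' D' where y': "y = (S', D')" by (cases y)
  have mem': "D' V p \<in> fib A p" if "V \<in> sections M K" for V p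
    using sectionsD(2)[OF so_derivation(3)[OF y[unfolded y'] K_section[OF that]]] by auto
  show "block_ker M A g (sadd (so_derivations M A g) x y)
    = sadd (so_derivations M K (metric_ker g)) (block_ker M A g x) (block_ker M A g y)"
    by (auto simp: so_derivations_def block_ker_def x' y' K_section vproj_add mem mem' fun_eq_iff restrict_def)
qed

text \<open>The lift need not preserve brackets: the bracket of two lifts may differ from the lift
  of the bracket. The difference has anchor zero because the anchor preserves brackets, so applying
  \<open>#\<close> to the torsion identity in \<open>A\<close> gives the one in
  \<open>TB\<close>.\<close>

lemma levi_civita_TB:
  assumes lc: "levi_civita M A g nabla" and lc': "levi_civita M (TB M) (metric_TB A g) nabla'"
    and S: "S \<in> sections M (TB M)"
  shows "nabla' S = block_TB M A g (nabla (\<lambda>p. \<gamma> p (S p)))"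
proof (rule levi_civita_unique[OF vector_bundle_TB inner_fibre_TB lc' _ _ _ S])
  have der: "(fst (nabla X), snd (nabla X)) \<in> secs (so_derivations M A g)" if "X \<in> sections M A" for X
    using levi_civitaD(1)[OF lc that] by simp
  fix X assume X: "X \<in> sections M (TB M)"
  note \<gamma>X = hlift_sections[OF X]
  show "block_TB M A g (nabla (\<lambda>p. \<gamma> p (X p))) \<in> secs (so_derivations M (TB M) (metric_TB A g))"
    using block_TB_derivation[OF der[OF \<gamma>X]] by simp
  show "fst (block_TB M A g (nabla (\<lambda>p. \<gamma> p (X p)))) = (\<lambda>p. anchor (TB M) p (X p))"
    using levi_civitaD(2)[OF lc \<gamma>X] hlift(3)[OF sectionsD(2)[OF X]]
    by (simp add: block_TB_def TB_simps case_prod_beta)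
  fix Y p assume Y: "Y \<in> sections M (TB M)"
  note \<gamma>Y = hlift_sections[OF Y]
  have snd_block: "snd (block_TB M A g x) T p = anchor A p (snd x (\<lambda>q. \<gamma> q (T q)) p)"
    if "T \<in> sections M (TB M)" for x T p
    using that by (simp add: block_TB_def case_prod_beta)
  have "anchor A p (snd (nabla (\<lambda>p. \<gamma> p (X p))) (\<lambda>p. \<gamma> p (Y p)) p)
      - anchor A p (snd (nabla (\<lambda>p. \<gamma> p (Y p))) (\<lambda>p. \<gamma> p (X p)) p)
      = anchor A p (brkt A (\<lambda>p. \<gamma> p (X p)) (\<lambda>p. \<gamma> p (Y p)) p)"
    using anchor_diff[OF sectionsD(2)[OF so_derivation(3)[OF der[OF \<gamma>X] \<gamma>Y]]
        sectionsD(2)[OF so_derivation(3)[OF der[OF \<gamma>Y] \<gamma>X]], of p] levi_civitaD(3)[OF lc \<gamma>X \<gamma>Y] by simp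
  also have "\<dots> = vf_bracket X Y p"
    using brkt_anchor(2)[OF \<gamma>X \<gamma>Y] hlift(3)[OF sectionsD(2)[OF X]] hlift(3)[OF sectionsD(2)[OF Y]] by simp
  finally show "snd (block_TB M A g (nabla (\<lambda>p. \<gamma> p (X p)))) Y p - snd (block_TB M A g (nabla (\<lambda>p. \<gamma> p (Y p)))) X p
      = brkt (TB M) X Y p"
    by (simp add: snd_block X Y TB_simps)
qed

text \<open>Applying \<omega> to the torsion identity in \<open>A\<close> gives the one in
  \<open>ker #\<close>, provided \<omega> fixes the bracket, that is, provided brackets of vertical
  sections are vertical.\<close>

lemma levi_civita_ker:
  assumes lc: "levi_civita M A g nabla" and lc': "levi_civita M K (metric_ker g) nabla'"
    and V: "V \<in> sections M K"
  shows "nabla' V = block_ker M A g (nabla V)"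
proof (rule levi_civita_unique[OF vector_bundle_K inner_fibre_K lc' _ _ _ V])
  have der: "(fst (nabla X), snd (nabla X)) \<in> secs (so_derivations M A g)" if "X \<in> sections M A" for X
    using levi_civitaD(1)[OF lc that] by simp
  fix X assume X: "X \<in> sections M K"
  note XA = K_section[OF X]
  have X0: "anchor A p (X p) = 0" for p using X sectionsD(2)[OF X, of p] by (simp add: fib_K)
  show "block_ker M A g (nabla X) \<in> secs (so_derivations M K (metric_ker g))"
    using block_ker_derivation[OF der[OF XA]] by simp
  show "fst (block_ker M A g (nabla X)) = (\<lambda>p. anchor K p (X p))"
    using levi_civitaD(2)[OF lc XA] X0
    by (simp add: block_ker_def anchor_K case_prod_beta)
  fix Y p assume Y: "Y \<in> sections M K"
  note YA = K_section[OF Y]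
  have Y0: "anchor A p (Y p) = 0" for p using Y sectionsD(2)[OF Y, of p] by (simp add: fib_K)
  have snd_block: "snd (block_ker M A g x) T p = \<omega> p (snd x T p)"
    if "T \<in> sections M K" for x T p
    using that by (simp add: block_ker_def case_prod_beta)
  have m: "snd (nabla X) Y p \<in> fib A p" "snd (nabla Y) X p \<in> fib A p"
    using sectionsD(2)[OF so_derivation(3)[OF der[OF XA] YA]]
      sectionsD(2)[OF so_derivation(3)[OF der[OF YA] XA]] by auto
  \<comment> \<open>The anchor maps the bracket to the bracket of two zero vector fields.\<close>
  have "anchor A p (brkt A X Y p) = 0"
    using brkt_anchor(2)[OF XA YA, of p]
    by (simp add: X0 Y0 vf_bracket_def act_functional zero_functional_def)
  then have "brkt A X Y p \<in> fib K p"
    using sectionsD(2)[OF brkt_anchor(1)[OF XA YA]] by (simp add: fib_K)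
  then have "brkt A X Y p = \<omega> p (snd (nabla X) Y p - snd (nabla Y) X p)"
    using levi_civitaD(3)[OF lc XA YA, of p] vproj_K by simp
  also have "\<dots> = \<omega> p (snd (nabla X) Y p) - \<omega> p (snd (nabla Y) X p)"
  proof -
    interpret inner_fibre "fib A p" "g p" by (rule inner_fibre_A)
    show ?thesis
      using vproj_add[OF m(1) scale_mem[OF m(2), of "-1"]] vproj_scale[OF m(2), of "-1"] by simp
  qed
  finally show "snd (block_ker M A g (nabla X)) Y p - snd (block_ker M A g (nabla Y)) X p = brkt K X Y p"
    by (simp add: snd_block X Y brkt_K)
qed

section \<open>The off-diagonal blocks\<close>

lemma blocks_adjoint:
  assumes SD: "(S, D) \<in> secs (so_derivations M A g)"
    and T: "T \<in> sections M (TB M)" and V: "V \<in> sections M K"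
  shows "metric_ker g p (block_TB_ker A g (S, D) T p) (V p)
    = - metric_TB A g p (T p) (block_ker_TB A (S, D) V p)"
proof -
  note D = so_derivation[OF SD]
  note \<gamma>T = hlift_sections[OF T] and VA = K_section[OF V]
  have "g q (\<gamma> q (T q)) (V q) = 0" for q
    by (rule hlift(2)[OF sectionsD(2)[OF T] sectionsD(2)[OF V]])
  then have "act (S p) (\<lambda>q. g q (\<gamma> q (T q)) (V q)) = 0"
    using act_zero_fun[OF sectionsD(2)[OF D(1)]] by simp
  then have "g p (D (\<lambda>q. \<gamma> q (T q)) p) (V p) = - g p (\<gamma> p (T p)) (D V p)"
    using D(7)[OF \<gamma>T VA, of p] by simp
  then show ?thesis
    using metric_vproj[OF sectionsD(2)[OF D(3)[OF \<gamma>T]] sectionsD(2)[OF V], of p]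
      metric_hlift[OF sectionsD(2)[OF D(3)[OF VA]] sectionsD(2)[OF T], of p]
    by (simp add: metric_ker_def metric_TB_def block_TB_ker_def block_ker_TB_def)
qed

text \<open>The derivative term of the Leibniz rule is a multiple of a horizontal lift, which
  \<omega> kills. On the diagonal this term survives, which separates linear maps from
  derivations.\<close>

lemma block_TB_ker_linear:
  assumes SD: "(S, D) \<in> secs (so_derivations M A g)"
  shows "Cinf_linear M (TB M) K (block_TB_ker A g (S, D))"
proof -
  note D = so_derivation[OF SD]
  have mem: "D (\<lambda>q. \<gamma> q (T q)) p \<in> fib A p" "T p \<in> fib (TB M) p" if "T \<in> sections M (TB M)" for T p
    using sectionsD(2)[OF D(3)[OF hlift_sections[OF that]]] sectionsD(2)[OF that] by auto
  show ?thesis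
    unfolding Cinf_linear_def block_TB_ker_def prod.case
  proof (intro conjI ballI)
    fix X assume X: "X \<in> sections M (TB M)"
    show "(\<lambda>p. \<omega> p (D (\<lambda>q. \<gamma> q (X q)) p)) \<in> sections M K"
      by (rule vproj_sections[OF D(3)[OF hlift_sections[OF X]]])
    show "(\<lambda>p. \<omega> p (D (\<lambda>q. \<gamma> q (X q + Y q)) p))
      = (\<lambda>p. \<omega> p (D (\<lambda>q. \<gamma> q (X q)) p) + \<omega> p (D (\<lambda>q. \<gamma> q (Y q)) p))"
      if Y: "Y \<in> sections M (TB M)" for Y
      using X Y mem by (simp add: hlift_add D(4) hlift_sections vproj_add)
    fix f assume f: "f \<in> Cinf M"
    have "\<omega> p (act (S p) f *\<^sub>R \<gamma> p (X p) + f p *\<^sub>R D (\<lambda>q. \<gamma> q (X q)) p)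
        = f p *\<^sub>R \<omega> p (D (\<lambda>q. \<gamma> q (X q)) p)" for p
    proof -
      interpret inner_fibre "fib A p" "g p" by (rule inner_fibre_A)
      show ?thesis using mem[OF X] by (simp add: vproj_add vproj_scale vproj_hlift hlift scale_mem)
    qed
    then show "(\<lambda>p. \<omega> p (D (\<lambda>q. \<gamma> q (f q *\<^sub>R X q)) p)) = (\<lambda>p. f p *\<^sub>R \<omega> p (D (\<lambda>q. \<gamma> q (X q)) p))"
      using X f mem by (simp add: hlift_scale D(6) hlift_sections)
  qed
qed

text \<open>The derivative term is a multiple of the vertical \<open>X\<close>, which the anchor
  kills.\<close>

lemma block_ker_TB_linear:
  assumes SD: "(S, D) \<in> secs (so_derivations M A g)"
  shows "Cinf_linear M K (TB M) (block_ker_TB A (S, D))"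
proof -
  note D = so_derivation[OF SD]
  have mem: "D V p \<in> fib A p" "V p \<in> fib A p" "anchor A p (V p) = 0" if "V \<in> sections M K" for V p
    using sectionsD(2)[OF D(3)[OF K_section[OF that]]] sectionsD(2)[OF that, of p] by (auto simp: fib_K)
  show ?thesis
    unfolding Cinf_linear_def block_ker_TB_def prod.case
  proof (intro conjI ballI)
    fix X assume X: "X \<in> sections M K"
    show "(\<lambda>p. anchor A p (D X p)) \<in> sections M (TB M)"
      by (rule anchor_sections[OF D(3)[OF K_section[OF X]]])
    show "(\<lambda>p. anchor A p (D (\<lambda>p. X p + Y p) p)) = (\<lambda>p. anchor A p (D X p) + anchor A p (D Y p))"
      if Y: "Y \<in> sections M K" for Y
      using X Y mem by (simp add: D(4) K_section anchor_add)
    fix f assume f: "f \<in> Cinf M"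
    have "anchor A p (act (S p) f *\<^sub>R X p + f p *\<^sub>R D X p) = f p *\<^sub>R anchor A p (D X p)" for p
    proof -
      interpret inner_fibre "fib A p" "g p" by (rule inner_fibre_A)
      show ?thesis using mem[OF X] by (simp add: anchor_add anchor_scale scale_mem)
    qed
    then show "(\<lambda>p. anchor A p (D (\<lambda>p. f p *\<^sub>R X p) p)) = (\<lambda>p. f p *\<^sub>R anchor A p (D X p))"
      using X f by (simp add: D(6) K_section)
  qed
qed

text \<open>By adjointness, the value of one off-diagonal block at \<open>p\<close> is determined by the value of its argument at \<open>p\<close>.\<close>
lemma block_TB_ker_local:
  assumes SD: "(S, D) \<in> secs (so_derivations M A g)"
    and X: "X \<in> sections M (TB M)" and Y: "Y \<in> sections M (TB M)" and eq: "X p = Y p"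
  shows "block_TB_ker A g (S, D) X p = block_TB_ker A g (S, D) Y p"
proof -
  let ?L = "block_TB_ker A g (S, D)"
  interpret inner_fibre "fib K p" "metric_ker g p" by (rule inner_fibre_K)
  have s: "?L X \<in> sections M K" "?L Y \<in> sections M K"
    using block_TB_ker_linear[OF SD] X Y by (simp_all add: Cinf_linear_def)
  \<comment> \<open>Testing adjointness against the difference of the two values turns it into the
    vanishing of a squared length; the difference is itself a section and so a legitimate
    test.\<close>
  define V where "V p = ?L X p - ?L Y p" for p
  have V: "V \<in> sections M K" unfolding V_def by (rule sections_diff[OF vector_bundle_K s])
  have "metric_ker g p (V p) (V p) = metric_ker g p (?L X p) (V p) - metric_ker g p (?L Y p) (V p)"
    using diff_left[OF sectionsD(2)[OF s(1)] sectionsD(2)[OF s(2)] sectionsD(2)[OF V]] by (simp add: V_def)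
  also have "\<dots> = 0" using blocks_adjoint[OF SD X V] blocks_adjoint[OF SD Y V] eq by simp
  finally show ?thesis using eq_zero[OF sectionsD(2)[OF V]] by (simp add: V_def)
qed

lemma block_ker_TB_local:
  assumes SD: "(S, D) \<in> secs (so_derivations M A g)"
    and X: "X \<in> sections M K" and Y: "Y \<in> sections M K" and eq: "X p = Y p"
  shows "block_ker_TB A (S, D) X p = block_ker_TB A (S, D) Y p"
proof -
  let ?L = "block_ker_TB A (S, D)"
  interpret inner_fibre "fib (TB M) p" "metric_TB A g p" by (rule inner_fibre_TB)
  have s: "?L X \<in> sections M (TB M)" "?L Y \<in> sections M (TB M)"
    using block_ker_TB_linear[OF SD] X Y by (simp_all add: Cinf_linear_def)
  define T where "T p = ?L X p - ?L Y p" for p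
  have T: "T \<in> sections M (TB M)" unfolding T_def by (rule sections_diff[OF vector_bundle_TB s])
  have "metric_TB A g p (T p) (T p) = metric_TB A g p (T p) (?L X p) - metric_TB A g p (T p) (?L Y p)"
    using diff_right[OF sectionsD(2)[OF s(1)] sectionsD(2)[OF s(2)] sectionsD(2)[OF T]] by (simp add: T_def)
  also have "\<dots> = 0" using blocks_adjoint[OF SD T X, of p] blocks_adjoint[OF SD T Y, of p] eq by simp
  finally show ?thesis using eq_zero[OF sectionsD(2)[OF T]] by (simp add: T_def)
qed

lemma off_diagonal_blocks:
  assumes "D \<in> secs (so_derivations M A g)"
  defines "L \<equiv> block_TB_ker A g D" and "L' \<equiv> block_ker_TB A D"
  defines "\<Phi> \<equiv> fibre_map M (TB M) L" and "\<Psi> \<equiv> fibre_map M K L'"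
  shows "Cinf_linear M (TB M) K L" "Cinf_linear M K (TB M) L'"
    "bundle_map M (TB M) K \<Phi>" "bundle_map M K (TB M) \<Psi>"
    "S \<in> sections M (TB M) \<Longrightarrow> \<Phi> p (S p) = L S p" "V \<in> sections M K \<Longrightarrow> \<Psi> p (V p) = L' V p"
    "s \<in> fib (TB M) p \<Longrightarrow> v \<in> fib K p \<Longrightarrow> metric_ker g p (\<Phi> p s) v = - metric_TB A g p s (\<Psi> p v)"
proof -
  obtain S' D' where D: "D = (S', D')" by (cases D)
  note SD = assms(1)[unfolded D]
  note loc = block_TB_ker_local[OF SD, folded D, folded L_def]
    and loc' = block_ker_TB_local[OF SD, folded D, folded L'_def]
  show lin: "Cinf_linear M (TB M) K L" and lin': "Cinf_linear M K (TB M) L'"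
    unfolding L_def L'_def D by (rule block_TB_ker_linear[OF SD], rule block_ker_TB_linear[OF SD])
  show "bundle_map M (TB M) K \<Phi>"
    unfolding \<Phi>_def by (rule fibre_map_bundle_map[OF vector_bundle_TB vector_bundle_K lin]) (rule loc)
  show "bundle_map M K (TB M) \<Psi>"
    unfolding \<Psi>_def by (rule fibre_map_bundle_map[OF vector_bundle_K vector_bundle_TB lin']) (rule loc')
  show \<Phi>: "\<Phi> p (S p) = L S p" if "S \<in> sections M (TB M)" for S p
    unfolding \<Phi>_def by (rule fibre_map_eq[OF _ that]) (rule loc)
  show \<Psi>: "\<Psi> p (V p) = L' V p" if "V \<in> sections M K" for V p
    unfolding \<Psi>_def by (rule fibre_map_eq[OF _ that]) (rule loc')
  assume s: "s \<in> fib (TB M) p" and v: "v \<in> fib K p"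
  \<comment> \<open>Both vectors are extended to global sections, for which adjointness is
    known.\<close>
  obtain S where S: "S \<in> sections M (TB M)" "S p = s" using global_section_through[OF vector_bundle_TB s] .
  obtain V where V: "V \<in> sections M K" "V p = v" using global_section_through[OF vector_bundle_K v] .
  have "metric_ker g p (L S p) (V p) = - metric_TB A g p (S p) (L' V p)"
    using blocks_adjoint[OF SD S(1) V(1)] by (simp add: L_def L'_def D)
  then show "metric_ker g p (\<Phi> p s) v = - metric_TB A g p s (\<Psi> p v)"
    using \<Phi>[OF S(1), of p] \<Psi>[OF V(1), of p] S(2) V(2) by simp
qed

end

theorem theorem4p3:
  fixes M :: "('b::{t2_space,second_countable_topology}, 'e::real_inner) atlas"
    and A :: "('b, 'v::real_vector) algebroid"
    and g :: "'b \<Rightarrow> 'v \<Rightarrow> 'v \<Rightarrow> real"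
    and nabla :: "('b \<Rightarrow> 'v) \<Rightarrow> ('b, 'v) derivation"
    and nabla_TB :: "('b \<Rightarrow> 'b functional) \<Rightarrow> ('b, 'b functional) derivation"
    and nabla_ker :: "('b \<Rightarrow> 'v) \<Rightarrow> ('b, 'v) derivation"
  defines "K \<equiv> ker_anchor M A"
    and "\<gamma> \<equiv> hlift A g"
    and "g_TB \<equiv> metric_TB A g"
    and "g_ker \<equiv> metric_ker g"
  assumes "smooth_manifold M"
    and "riemannian_submersion_algebroid M A g"
    and "levi_civita M A g nabla"
    and "levi_civita M (TB M) g_TB nabla_TB"
    and "levi_civita M K g_ker nabla_ker"
  shows
    "(anchored_map M (so_derivations M A g) (so_derivations M (TB M) g_TB) (block_TB M A g) \<and>
      (\<forall>S\<in>sections M (TB M). nabla_TB S = block_TB M A g (nabla (\<lambda>p. \<gamma> p (S p))))) \<and>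
     (anchored_map M (so_derivations M A g) (so_derivations M K g_ker) (block_ker M A g) \<and>
      (\<forall>V\<in>sections M K. nabla_ker V = block_ker M A g (nabla V))) \<and>
     (\<forall>D\<in>secs (so_derivations M A g).
        let L = block_TB_ker A g D; \<Phi> = fibre_map M (TB M) L;
            L' = block_ker_TB A D; \<Psi> = fibre_map M K L'
        in
          Cinf_linear M (TB M) K L \<and> Cinf_linear M K (TB M) L' \<and>
          bundle_map M (TB M) K \<Phi> \<and> (\<forall>S\<in>sections M (TB M). \<forall>p. \<Phi> p (S p) = L S p) \<and>
          bundle_map M K (TB M) \<Psi> \<and> (\<forall>V\<in>sections M K. \<forall>p. \<Psi> p (V p) = L' V p) \<and>
          (\<forall>p. \<forall>S\<in>fib (TB M) p. \<forall>V\<in>fib K p. g_ker p (\<Phi> p S) V = - g_TB p S (\<Psi> p V)))"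
proof -
  interpret riemannian_submersion M A g using assms(5,6) by unfold_locales
  show ?thesis
    unfolding K_def \<gamma>_def g_TB_def g_ker_def Let_def
  proof (intro conjI ballI allI)
    show "nabla_TB S = block_TB M A g (nabla (\<lambda>p. hlift A g p (S p)))" if "S \<in> sections M (TB M)" for S
      by (rule levi_civita_TB[OF assms(7) assms(8)[unfolded g_TB_def] that])
    show "nabla_ker V = block_ker M A g (nabla V)" if "V \<in> sections M (ker_anchor M A)" for V
      by (rule levi_civita_ker[OF assms(7) assms(9)[unfolded g_ker_def K_def] that])
  qed (rule block_TB_anchored block_ker_anchored | (erule off_diagonal_blocks; assumption))+
qed

end
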